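(* Let $(M,g)$ be a four dimensional Einstein manifold, with scalar curvature $R$ and Weyl tensor $W$. Then $$\frac{1}{2}\Delta |\nabla W|^{2} = |\nabla^{2} W|^{2}+\frac{13}{12}R|\nabla W|^{2}-10\,W_{ijkl}W_{ijpq,t}W_{klpq,t}$$ on $M$.
   Context: Manifolds are smooth and without boundary. A Riemannian manifold $(M^n,g)$ is Einstein if $\mathrm{Ric}=\lambda g$ for some constant $\lambda\in\mathbb{R}$; then $R=n\lambda$ is constant. Tensor components are taken in a local orthonormal frame $e_i$, and repeated indices are summed. With $\mathrm{R}(X,Y)Z=\nabla_X\nabla_YZ-\nabla_Y\nabla_XZ-\nabla_{[X,Y]}Z$, the $(0,4)$ Riemann tensor is $R_{ijkl}=g(e_i,\mathrm{R}(e_k,e_l)e_j)$, the Ricci tensor is $R_{ik}=R_{ijkj}$ and the scalar curvature is $R=R_{ii}$. In dimension four the Weyl tensor is $W_{ijkl}=R_{ijkl}-\frac12(R_{ik}g_{jl}-R_{il}g_{jk}+R_{jl}g_{ik}-R_{jk}g_{il})+\frac{R}{6}(g_{ik}g_{jl}-g_{il}g_{jk})$. Indices after a comma denote covariant derivatives: $T_{\ldots,p}=\nabla_pT_{\ldots}$ and $T_{\ldots,pq}=\nabla_q\nabla_pT_{\ldots}$. The Laplacian is $\Delta T_{\ldots}=T_{\ldots,pp}$. Norms are full contractions: $|\nabla W|^2=W_{ijkl,s}W_{ijkl,s}$, $|\nabla^2W|^2=W_{ijkl,st}W_{ijkl,st}$. *)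

theory Defs
  imports "HOL-Analysis.Analysis"
begin

section \<open>Smooth manifolds\<close>

primrec Ck_on :: "nat \<Rightarrow> 'b::real_normed_vector set \<Rightarrow> ('b \<Rightarrow> 'c::real_normed_vector) \<Rightarrow> bool" where
  "Ck_on 0 S = (\<lambda>f. continuous_on S f)"
| "Ck_on (Suc k) S = (\<lambda>f. (\<forall>x\<in>S. f differentiable (at x)) \<and>
     (\<forall>v. Ck_on k S (\<lambda>x. frechet_derivative f (at x) v)))"

text \<open>Only used for open \<open>S\<close>.\<close>
definition smooth_on :: "'b::real_normed_vector set \<Rightarrow> ('b \<Rightarrow> 'c::real_normed_vector) \<Rightarrow> bool" where
  "smooth_on S f \<longleftrightarrow> (\<forall>k. Ck_on k S f)"

type_synonym ('a, 'n) atlas = "('a set \<times> ('a \<Rightarrow> real ^ 'n)) set"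

text \<open>The dimension is \<open>CARD('n)\<close>. The atlas need not be maximal.\<close>
definition smooth_manifold :: "'a topology \<Rightarrow> ('a, 'n::finite) atlas \<Rightarrow> bool" where
  "smooth_manifold M A \<longleftrightarrow>
     Hausdorff_space M \<and> second_countable M \<and> (\<Union>(U, \<phi>)\<in>A. U) = topspace M \<and>
     (\<forall>(U, \<phi>)\<in>A. openin M U \<and> open (\<phi> ` U) \<and>
        homeomorphic_map (subtopology M U) (top_of_set (\<phi> ` U)) \<phi>) \<and>
     (\<forall>(U, \<phi>)\<in>A. \<forall>(V, \<psi>)\<in>A. smooth_on (\<phi> ` (U \<inter> V)) (\<psi> \<circ> inv_into U \<phi>))"

definition smooth_fun_on :: "'a topology \<Rightarrow> ('a, 'n::finite) atlas \<Rightarrow> 'a set \<Rightarrow> ('a \<Rightarrow> real) \<Rightarrow> bool" where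
  "smooth_fun_on M A U f \<longleftrightarrow> openin M U \<and>
     (\<forall>(V, \<phi>)\<in>A. smooth_on (\<phi> ` (U \<inter> V)) (f \<circ> inv_into V \<phi>))"

definition smooth_near :: "'a topology \<Rightarrow> ('a, 'n::finite) atlas \<Rightarrow> 'a \<Rightarrow> ('a \<Rightarrow> real) \<Rightarrow> bool" where
  "smooth_near M A x f \<longleftrightarrow> (\<exists>U. x \<in> U \<and> smooth_fun_on M A U f)"

section \<open>Tangent vectors and vector fields\<close>

type_synonym 'a tvec = "('a \<Rightarrow> real) \<Rightarrow> real"
type_synonym 'a vfield = "'a \<Rightarrow> 'a tvec"

text \<open>A tangent vector at \<open>x\<close> is a derivation of the algebra of germs at \<open>x\<close> of smooth functions.
  Germs are represented by total functions; the value \<open>0\<close> on functions that are not smooth near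
  \<open>x\<close> makes a tangent vector determined by its derivation.\<close>
definition tangent_space :: "'a topology \<Rightarrow> ('a, 'n::finite) atlas \<Rightarrow> 'a \<Rightarrow> 'a tvec set" where
  "tangent_space M A x = {v.
     (\<forall>f h. smooth_near M A x f \<and> smooth_near M A x h \<longrightarrow>
        v (\<lambda>y. f y + h y) = v f + v h \<and> v (\<lambda>y. f y * h y) = v f * h x + f x * v h) \<and>
     (\<forall>f c. smooth_near M A x f \<longrightarrow> v (\<lambda>y. c * f y) = c * v f) \<and>
     (\<forall>f h U. smooth_near M A x f \<and> openin M U \<and> x \<in> U \<and> (\<forall>y\<in>U. f y = h y) \<longrightarrow> v f = v h) \<and>
     (\<forall>f. \<not> smooth_near M A x f \<longrightarrow> v f = 0)}"

text \<open>Values outside \<open>U\<close> are irrelevant.\<close>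
definition vector_field_on :: "'a topology \<Rightarrow> ('a, 'n::finite) atlas \<Rightarrow> 'a set \<Rightarrow> 'a vfield \<Rightarrow> bool" where
  "vector_field_on M A U X \<longleftrightarrow> openin M U \<and> (\<forall>x\<in>U. X x \<in> tangent_space M A x) \<and>
     (\<forall>V f. V \<subseteq> U \<and> smooth_fun_on M A V f \<longrightarrow> smooth_fun_on M A V (\<lambda>x. X x f))"

definition vf_add :: "'a vfield \<Rightarrow> 'a vfield \<Rightarrow> 'a vfield" where
  "vf_add X Y = (\<lambda>x f. X x f + Y x f)"

definition vf_scale :: "('a \<Rightarrow> real) \<Rightarrow> 'a vfield \<Rightarrow> 'a vfield" where
  "vf_scale u X = (\<lambda>x f. u x * X x f)"

definition lie_bracket :: "'a topology \<Rightarrow> ('a, 'n::finite) atlas \<Rightarrow> 'a vfield \<Rightarrow> 'a vfield \<Rightarrow> 'a vfield" where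
  "lie_bracket M A X Y =
     (\<lambda>x f. if smooth_near M A x f then X x (\<lambda>y. Y y f) - Y x (\<lambda>y. X y f) else 0)"

section \<open>Riemannian metrics and the Levi-Civita connection\<close>

type_synonym 'a metric_field = "'a \<Rightarrow> 'a tvec \<Rightarrow> 'a tvec \<Rightarrow> real"

definition riemannian_metric :: "'a topology \<Rightarrow> ('a, 'n::finite) atlas \<Rightarrow> 'a metric_field \<Rightarrow> bool" where
  "riemannian_metric M A g \<longleftrightarrow>
     (\<forall>x\<in>topspace M. \<forall>u\<in>tangent_space M A x. \<forall>v\<in>tangent_space M A x. \<forall>w\<in>tangent_space M A x.
        g x u v = g x v u \<and>
        g x (\<lambda>f. u f + v f) w = g x u w + g x v w \<and>
        (\<forall>c. g x (\<lambda>f. c * u f) v = c * g x u v) \<and>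
        (u \<noteq> (\<lambda>f. 0) \<longrightarrow> g x u u > 0)) \<and>
     (\<forall>U X Y. vector_field_on M A U X \<and> vector_field_on M A U Y \<longrightarrow>
        smooth_fun_on M A U (\<lambda>x. g x (X x) (Y x)))"

definition riemannian_manifold :: "'a topology \<Rightarrow> ('a, 'n::finite) atlas \<Rightarrow> 'a metric_field \<Rightarrow> bool" where
  "riemannian_manifold M A g \<longleftrightarrow> smooth_manifold M A \<and> riemannian_metric M A g"

text \<open>\<open>D X Y\<close> stands for the covariant derivative of \<open>Y\<close> along \<open>X\<close>.\<close>
type_synonym 'a connection = "'a vfield \<Rightarrow> 'a vfield \<Rightarrow> 'a vfield"

text \<open>The connection acts on vector fields over every open subset \<open>U\<close>. The axioms determine
  \<open>D X Y\<close> on \<open>U\<close> (Koszul's formula), so \<open>D\<close> is local and over each \<open>U\<close> it is the Levi-Civita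
  connection of the open submanifold \<open>U\<close>.\<close>
definition levi_civita :: "'a topology \<Rightarrow> ('a, 'n::finite) atlas \<Rightarrow> 'a metric_field \<Rightarrow> 'a connection \<Rightarrow> bool" where
  "levi_civita M A g D \<longleftrightarrow>
     (\<forall>U X Y Z u. vector_field_on M A U X \<and> vector_field_on M A U Y \<and> vector_field_on M A U Z \<and>
          smooth_fun_on M A U u \<longrightarrow>
        vector_field_on M A U (D X Y) \<and>
        (\<forall>x\<in>U.
           D (vf_add X Y) Z x = vf_add (D X Z) (D Y Z) x \<and>
           D (vf_scale u X) Y x = vf_scale u (D X Y) x \<and>
           D X (vf_add Y Z) x = vf_add (D X Y) (D X Z) x \<and>
           D X (vf_scale u Y) x = vf_add (vf_scale u (D X Y)) (vf_scale (\<lambda>y. X y u) Y) x \<and>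
           (\<lambda>f. D X Y x f - D Y X x f) = lie_bracket M A X Y x \<and>
           X x (\<lambda>y. g y (Y y) (Z y)) = g x (D X Y x) (Z x) + g x (Y x) (D X Z x)))"

text \<open>A smooth local frame on \<open>U\<close> that is orthonormal at every point; linear independence
  follows from orthonormality.\<close>
definition orthonormal_frame_on ::
  "'a topology \<Rightarrow> ('a, 'n::finite) atlas \<Rightarrow> 'a metric_field \<Rightarrow> 'a set \<Rightarrow> ('n \<Rightarrow> 'a vfield) \<Rightarrow> bool" where
  "orthonormal_frame_on M A g U e \<longleftrightarrow> openin M U \<and>
     (\<forall>i. vector_field_on M A U (e i)) \<and>
     (\<forall>x\<in>U. \<forall>i j. g x (e i x) (e j x) = (if i = j then 1 else 0)) \<and>
     (\<forall>x\<in>U. \<forall>v\<in>tangent_space M A x. \<exists>c. v = (\<lambda>f. \<Sum>i\<in>UNIV. c i * e i x f))"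

section \<open>Tensors\<close>

text \<open>A covariant \<open>k\<close>-tensor field is applied to the list of its \<open>k\<close> arguments, so its components
  in a frame \<open>e\<close> are \<open>T [e i\<^sub>1, ..., e i\<^sub>k]\<close>.\<close>
type_synonym 'a tensor = "'a vfield list \<Rightarrow> 'a \<Rightarrow> real"

text \<open>The direction of differentiation is the last argument: \<open>cov_deriv D T [e i, ..., e p]\<close> is
  \<open>T\<^bsub>i...,p\<^esub>\<close>, and \<open>cov_deriv D (cov_deriv D T) [e i, ..., e p, e q]\<close> is \<open>T\<^bsub>i...,pq\<^esub>\<close>.\<close>
definition cov_deriv :: "'a connection \<Rightarrow> 'a tensor \<Rightarrow> 'a tensor" where
  "cov_deriv D T Zs x =
     (let Xs = butlast Zs; Y = last Zs
      in Y x (T Xs) - (\<Sum>i<length Xs. T (Xs[i := D Y (Xs ! i)]) x))"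

definition laplacian :: "'a connection \<Rightarrow> ('n::finite \<Rightarrow> 'a vfield) \<Rightarrow> 'a tensor \<Rightarrow> 'a tensor" where
  "laplacian D e T Xs x = (\<Sum>p\<in>UNIV. cov_deriv D (cov_deriv D T) (Xs @ [e p, e p]) x)"

definition norm_sq :: "('n::finite \<Rightarrow> 'a vfield) \<Rightarrow> nat \<Rightarrow> 'a tensor \<Rightarrow> 'a \<Rightarrow> real" where
  "norm_sq e k T x = (\<Sum>is | length is = k. (T (map e is) x)\<^sup>2)"

section \<open>Curvature\<close>

definition curvature_op ::
  "'a topology \<Rightarrow> ('a, 'n::finite) atlas \<Rightarrow> 'a connection \<Rightarrow> 'a vfield \<Rightarrow> 'a vfield \<Rightarrow> 'a vfield \<Rightarrow> 'a vfield" where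
  "curvature_op M A D X Y Z =
     (\<lambda>x f. D X (D Y Z) x f - D Y (D X Z) x f - D (lie_bracket M A X Y) Z x f)"

definition riemann ::
  "'a topology \<Rightarrow> ('a, 'n::finite) atlas \<Rightarrow> 'a metric_field \<Rightarrow> 'a connection \<Rightarrow> 'a tensor" where
  "riemann M A g D Xs x =
     g x ((Xs ! 0) x) (curvature_op M A D (Xs ! 2) (Xs ! 3) (Xs ! 1) x)"

text \<open>Traces are taken in an orthonormal frame \<open>e\<close>; their values do not depend on it.\<close>
definition ricci ::
  "'a topology \<Rightarrow> ('a, 'n::finite) atlas \<Rightarrow> 'a metric_field \<Rightarrow> 'a connection \<Rightarrow> ('n \<Rightarrow> 'a vfield) \<Rightarrow> 'a tensor" where
  "ricci M A g D e Xs x = (\<Sum>j\<in>UNIV. riemann M A g D [Xs ! 0, e j, Xs ! 1, e j] x)"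

definition scalar_curv ::
  "'a topology \<Rightarrow> ('a, 'n::finite) atlas \<Rightarrow> 'a metric_field \<Rightarrow> 'a connection \<Rightarrow> ('n \<Rightarrow> 'a vfield) \<Rightarrow> 'a \<Rightarrow> real" where
  "scalar_curv M A g D e x = (\<Sum>i\<in>UNIV. ricci M A g D e [e i, e i] x)"

definition einstein ::
  "'a topology \<Rightarrow> ('a, 'n::finite) atlas \<Rightarrow> 'a metric_field \<Rightarrow> 'a connection \<Rightarrow> bool" where
  "einstein M A g D \<longleftrightarrow>
     (\<exists>c. \<forall>U e X Y. orthonormal_frame_on M A g U e \<and> vector_field_on M A U X \<and> vector_field_on M A U Y \<longrightarrow>
        (\<forall>x\<in>U. ricci M A g D e [X, Y] x = c * g x (X x) (Y x)))"

text \<open>The coefficients \<open>1 / 2\<close> and \<open>1 / 6\<close> are those of dimension four.\<close>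
definition weyl ::
  "'a topology \<Rightarrow> ('a, 4) atlas \<Rightarrow> 'a metric_field \<Rightarrow> 'a connection \<Rightarrow> (4 \<Rightarrow> 'a vfield) \<Rightarrow> 'a tensor" where
  "weyl M A g D e Xs x =
     (let G = (\<lambda>a b. g x ((Xs ! a) x) ((Xs ! b) x));
          Ric = (\<lambda>a b. ricci M A g D e [Xs ! a, Xs ! b] x)
      in riemann M A g D Xs x
         - 1 / 2 * (Ric 0 2 * G 1 3 - Ric 0 3 * G 1 2 + Ric 1 3 * G 0 2 - Ric 1 2 * G 0 3)
         + scalar_curv M A g D e x / 6 * (G 0 2 * G 1 3 - G 0 3 * G 1 2))"

end

theory Submission
  imports Defs "HOL-Library.Function_Algebras"
begin

text \<open>
  In an orthonormal frame the Bochner formula reduces the claim to the evaluation of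
  \<open>W\<^bsub>ijkl,t\<^esub> W\<^bsub>ijkl,tss\<^esub>\<close>. For an Einstein metric \<open>\<nabla>W = \<nabla>Rm\<close> and the divergence of \<open>W\<close>
  vanishes, so commuting derivatives turns \<open>W\<^bsub>ijkl,tss\<^esub>\<close> into \<open>W\<^bsub>ijkl,sst\<^esub>\<close> and the second Bianchi
  identity turns the latter into a divergence, up to terms of the form \<open>Rm * \<nabla>W\<close>. Splitting \<open>Rm\<close> into its
  Weyl and scalar parts leaves \<open>13/12 R |\<nabla>W|\<^sup>2\<close> and cubic contractions of \<open>W\<close> with two copies of
  \<open>\<nabla>W\<close>. In dimension four \<open>W\<^bsub>ij\<^esub>\<^bsup>kl\<^esup> \<delta>\<^bsub>m\<^esub>\<^bsup>n\<^esup>\<close> antisymmetrised over \<open>ijm\<close> and \<open>kln\<close> is zero; together with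
  the Bianchi identities this expresses all these contractions through
  \<open>W\<^bsub>ijkl\<^esub> W\<^bsub>ijpq,t\<^esub> W\<^bsub>klpq,t\<^esub>\<close>.
\<close>

section \<open>Tensor calculus in an orthonormal frame\<close>

text \<open>Put \<kappa> = R/12, so that Ric = 3\<kappa>g and Rm is W plus \<kappa> times the
  constant-curvature tensor. Write A for the cubic term of the theorem and n for |\<nabla>W|^2.
  Exchanging derivatives in both orders gives eight equal commutators, each worth (\<kappa>n - A)/2
  against \<nabla>W, and a Ricci term 3\<kappa>n. The two divergences left by the second Bianchi
  identity give 3\<kappa>n - 3A each. The total is 13\<kappa>n - 10A. The obstacle is that fields
  are total functions with arbitrary values outside the domain of the frame, so the usual identities
  hold only on that domain. Hence three layers: an abstract calculus of fields extended by zero,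
  finite sums of real components at one point, and an instantiation that carries the given objects
  into the calculus.\<close>

lemma additive_on_diff:
  fixes F :: "'c::ab_group_add \<Rightarrow> 'd::ab_group_add"
  assumes "\<And>x y. x \<in> S \<Longrightarrow> y \<in> S \<Longrightarrow> F (x + y) = F x + F y"
    and "\<And>x y. x \<in> S \<Longrightarrow> y \<in> S \<Longrightarrow> x - y \<in> S" "x \<in> S" "y \<in> S"
  shows "F (x - y) = F x - F y"
  using assms(1)[of "x - y" y] assms(2-) by (simp add: algebra_simps)

lemma sum_three_zeroD: "a + b + c = 0 \<Longrightarrow> a = - b - (c :: 'b::ab_group_add)"
proof -
  assume "a + b + c = 0"
  moreover have "a = (a + b + c) - b - c" by simp
  ultimately show ?thesis by simp
qed

lemma sum_fun_apply: "(\<Sum>i\<in>I. F i) x = (\<Sum>i\<in>I. F i x)"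
  by (induction I rule: infinite_finite_induct) auto

text \<open>
  Abstracts the functions and vector fields on an open set, extended by zero outside of it: in this form
  identities between fields on the open set are plain equations. The element \<open>un\<close> stands for the
  function that is \<open>1\<close> on the open set.
\<close>
locale frame_calculus =
  fixes Fn :: "'f::comm_ring set" and Vf :: "'v::ab_group_add set"
    and act :: "'v \<Rightarrow> 'f \<Rightarrow> 'f" and smul :: "'f \<Rightarrow> 'v \<Rightarrow> 'v" and ip :: "'v \<Rightarrow> 'v \<Rightarrow> 'f"
    and nab :: "'v \<Rightarrow> 'v \<Rightarrow> 'v" and E :: "'n::finite \<Rightarrow> 'v" and un :: 'f
  assumes Fn_add [simp]: "f \<in> Fn \<Longrightarrow> h \<in> Fn \<Longrightarrow> f + h \<in> Fn"
    and Fn_uminus [simp]: "f \<in> Fn \<Longrightarrow> - f \<in> Fn"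
    and Fn_mult [simp]: "f \<in> Fn \<Longrightarrow> h \<in> Fn \<Longrightarrow> f * h \<in> Fn"
    and un_Fn [simp]: "un \<in> Fn"
    and un_mult [simp]: "f \<in> Fn \<Longrightarrow> un * f = f"
    and Vf_add [simp]: "X \<in> Vf \<Longrightarrow> Y \<in> Vf \<Longrightarrow> X + Y \<in> Vf"
    and Vf_uminus [simp]: "X \<in> Vf \<Longrightarrow> - X \<in> Vf"
    and Vf_smul [simp]: "u \<in> Fn \<Longrightarrow> X \<in> Vf \<Longrightarrow> smul u X \<in> Vf"
    and act_Fn [simp]: "X \<in> Vf \<Longrightarrow> f \<in> Fn \<Longrightarrow> act X f \<in> Fn"
    and act_add_left: "X \<in> Vf \<Longrightarrow> Y \<in> Vf \<Longrightarrow> f \<in> Fn \<Longrightarrow> act (X + Y) f = act X f + act Y f"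
    and act_smul: "u \<in> Fn \<Longrightarrow> X \<in> Vf \<Longrightarrow> f \<in> Fn \<Longrightarrow> act (smul u X) f = u * act X f"
    and act_add: "X \<in> Vf \<Longrightarrow> f \<in> Fn \<Longrightarrow> h \<in> Fn \<Longrightarrow> act X (f + h) = act X f + act X h"
    and act_mult: "X \<in> Vf \<Longrightarrow> f \<in> Fn \<Longrightarrow> h \<in> Fn \<Longrightarrow> act X (f * h) = act X f * h + f * act X h"
    and ip_Fn [simp]: "X \<in> Vf \<Longrightarrow> Y \<in> Vf \<Longrightarrow> ip X Y \<in> Fn"
    and ip_sym: "X \<in> Vf \<Longrightarrow> Y \<in> Vf \<Longrightarrow> ip X Y = ip Y X"
    and ip_add_left: "X \<in> Vf \<Longrightarrow> Y \<in> Vf \<Longrightarrow> Z \<in> Vf \<Longrightarrow> ip (X + Y) Z = ip X Z + ip Y Z"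
    and ip_smul_left: "u \<in> Fn \<Longrightarrow> X \<in> Vf \<Longrightarrow> Y \<in> Vf \<Longrightarrow> ip (smul u X) Y = u * ip X Y"
    and nab_Vf [simp]: "X \<in> Vf \<Longrightarrow> Y \<in> Vf \<Longrightarrow> nab X Y \<in> Vf"
    and nab_add_left: "X \<in> Vf \<Longrightarrow> Y \<in> Vf \<Longrightarrow> Z \<in> Vf \<Longrightarrow> nab (X + Y) Z = nab X Z + nab Y Z"
    and nab_smul_left: "u \<in> Fn \<Longrightarrow> X \<in> Vf \<Longrightarrow> Y \<in> Vf \<Longrightarrow> nab (smul u X) Y = smul u (nab X Y)"
    and nab_add: "X \<in> Vf \<Longrightarrow> Y \<in> Vf \<Longrightarrow> Z \<in> Vf \<Longrightarrow> nab X (Y + Z) = nab X Y + nab X Z"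
    and nab_smul: "u \<in> Fn \<Longrightarrow> X \<in> Vf \<Longrightarrow> Y \<in> Vf \<Longrightarrow> nab X (smul u Y) = smul u (nab X Y) + smul (act X u) Y"
    and torsion: "X \<in> Vf \<Longrightarrow> Y \<in> Vf \<Longrightarrow> f \<in> Fn \<Longrightarrow>
      act (nab X Y - nab Y X) f = act X (act Y f) - act Y (act X f)"
    and metric: "X \<in> Vf \<Longrightarrow> Y \<in> Vf \<Longrightarrow> Z \<in> Vf \<Longrightarrow> act X (ip Y Z) = ip (nab X Y) Z + ip Y (nab X Z)"
    and jacobi: "X \<in> Vf \<Longrightarrow> Y \<in> Vf \<Longrightarrow> Z \<in> Vf \<Longrightarrow>
      (nab X (nab Y Z - nab Z Y) - nab (nab Y Z - nab Z Y) X)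
      + (nab Y (nab Z X - nab X Z) - nab (nab Z X - nab X Z) Y)
      + (nab Z (nab X Y - nab Y X) - nab (nab X Y - nab Y X) Z) = 0"
    and E_Vf [simp]: "E i \<in> Vf"
    and E_orthonormal: "ip (E i) (E j) = (if i = j then un else 0)"
    and E_expand: "X \<in> Vf \<Longrightarrow> X = (\<Sum>i\<in>UNIV. smul (ip X (E i)) (E i))"
    and smul_add: "smul u (X + Y) = smul u X + smul u Y"
    and smul_add_left: "u \<in> Fn \<Longrightarrow> v \<in> Fn \<Longrightarrow> X \<in> Vf \<Longrightarrow> smul (u + v) X = smul u X + smul v X"
    and smul_uminus: "smul u (- X) = - smul u X"
    and smul_smul: "smul u (smul v X) = smul (u * v) X"
    and two_torsion_free: "(f::'f) + f = 0 \<Longrightarrow> f = 0"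
begin

lemma Fn_diff [simp]: "f \<in> Fn \<Longrightarrow> h \<in> Fn \<Longrightarrow> f - h \<in> Fn"
  using Fn_add[of f "- h"] by simp

lemma Vf_diff [simp]: "X \<in> Vf \<Longrightarrow> Y \<in> Vf \<Longrightarrow> X - Y \<in> Vf"
  using Vf_add[of X "- Y"] by simp

lemma Fn_zero [simp]: "0 \<in> Fn"
  using Fn_diff[of un un] by simp

lemma Vf_zero [simp]: "0 \<in> Vf"
  using Vf_diff[of "E undefined" "E undefined"] by simp

lemma Fn_sum [simp]: "(\<And>i. i \<in> I \<Longrightarrow> f i \<in> Fn) \<Longrightarrow> sum f I \<in> Fn"
  by (induction I rule: infinite_finite_induct) auto

lemma Vf_sum [simp]: "(\<And>i. i \<in> I \<Longrightarrow> X i \<in> Vf) \<Longrightarrow> sum X I \<in> Vf"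
  by (induction I rule: infinite_finite_induct) auto

lemma act_diff: "X \<in> Vf \<Longrightarrow> f \<in> Fn \<Longrightarrow> h \<in> Fn \<Longrightarrow> act X (f - h) = act X f - act X h"
  by (rule additive_on_diff[where S = Fn]) (auto simp: act_add)

lemma act_diff_left: "X \<in> Vf \<Longrightarrow> Y \<in> Vf \<Longrightarrow> f \<in> Fn \<Longrightarrow> act (X - Y) f = act X f - act Y f"
  by (rule additive_on_diff[where S = Vf and F = "\<lambda>X. act X f"]) (auto simp: act_add_left)

lemma act_zero [simp]: "X \<in> Vf \<Longrightarrow> act X 0 = 0"
  using act_diff[of X 0 0] by simp

lemma act_sum: "X \<in> Vf \<Longrightarrow> (\<And>i. i \<in> I \<Longrightarrow> f i \<in> Fn) \<Longrightarrow> act X (sum f I) = (\<Sum>i\<in>I. act X (f i))"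
  by (induction I rule: infinite_finite_induct) (auto simp: act_add)

text \<open>\<open>un\<close> is idempotent, so the product rule gives
  \<open>act X un = act X un + act X un\<close>.\<close>

lemma act_un [simp]: "X \<in> Vf \<Longrightarrow> act X un = 0"
  using act_mult[of X un un] by (simp add: mult.commute[of "act X un" un])

lemma ip_diff_left: "X \<in> Vf \<Longrightarrow> Y \<in> Vf \<Longrightarrow> Z \<in> Vf \<Longrightarrow> ip (X - Y) Z = ip X Z - ip Y Z"
  by (rule additive_on_diff[where S = Vf and F = "\<lambda>X. ip X Z"]) (auto simp: ip_add_left)

lemma ip_add: "X \<in> Vf \<Longrightarrow> Y \<in> Vf \<Longrightarrow> Z \<in> Vf \<Longrightarrow> ip X (Y + Z) = ip X Y + ip X Z"
  by (simp add: ip_sym[of X] ip_add_left)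

lemma ip_diff: "X \<in> Vf \<Longrightarrow> Y \<in> Vf \<Longrightarrow> Z \<in> Vf \<Longrightarrow> ip X (Y - Z) = ip X Y - ip X Z"
  by (simp add: ip_sym[of X] ip_diff_left)

lemma ip_smul: "u \<in> Fn \<Longrightarrow> X \<in> Vf \<Longrightarrow> Y \<in> Vf \<Longrightarrow> ip X (smul u Y) = u * ip X Y"
  by (simp add: ip_sym[of X] ip_smul_left)

lemma nab_diff_left: "X \<in> Vf \<Longrightarrow> Y \<in> Vf \<Longrightarrow> Z \<in> Vf \<Longrightarrow> nab (X - Y) Z = nab X Z - nab Y Z"
  by (rule additive_on_diff[where S = Vf and F = "\<lambda>X. nab X Z"]) (auto simp: nab_add_left)

lemma nab_diff: "X \<in> Vf \<Longrightarrow> Y \<in> Vf \<Longrightarrow> Z \<in> Vf \<Longrightarrow> nab X (Y - Z) = nab X Y - nab X Z"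
  by (rule additive_on_diff[where S = Vf and F = "nab X"]) (auto simp: nab_add)

lemma smul_diff: "smul u (X - Y) = smul u X - smul u Y"
  using smul_add[of u X "- Y"] by (simp add: smul_uminus)

section \<open>Curvature operator and Bianchi identities\<close>

definition br :: "'v \<Rightarrow> 'v \<Rightarrow> 'v" where "br X Y = nab X Y - nab Y X"

lemma br_Vf [simp]: "X \<in> Vf \<Longrightarrow> Y \<in> Vf \<Longrightarrow> br X Y \<in> Vf"
  by (simp add: br_def)

lemma act_br: "X \<in> Vf \<Longrightarrow> Y \<in> Vf \<Longrightarrow> f \<in> Fn \<Longrightarrow> act (br X Y) f = act X (act Y f) - act Y (act X f)"
  by (simp add: br_def torsion)

definition Rop :: "'v \<Rightarrow> 'v \<Rightarrow> 'v \<Rightarrow> 'v" where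
  "Rop X Y Z = nab X (nab Y Z) - nab Y (nab X Z) - nab (br X Y) Z"

lemma Rop_Vf [simp]: "X \<in> Vf \<Longrightarrow> Y \<in> Vf \<Longrightarrow> Z \<in> Vf \<Longrightarrow> Rop X Y Z \<in> Vf"
  by (simp add: Rop_def)

lemma Rop_antisym: "X \<in> Vf \<Longrightarrow> Y \<in> Vf \<Longrightarrow> Z \<in> Vf \<Longrightarrow> Rop Y X Z = - Rop X Y Z"
  by (simp add: Rop_def br_def nab_diff_left)

lemma Rop_add: "X \<in> Vf \<Longrightarrow> Y \<in> Vf \<Longrightarrow> Z \<in> Vf \<Longrightarrow> Z' \<in> Vf \<Longrightarrow> Rop X Y (Z + Z') = Rop X Y Z + Rop X Y Z'"
  by (simp add: Rop_def nab_add)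

lemma Rop_add_left: "X \<in> Vf \<Longrightarrow> Y \<in> Vf \<Longrightarrow> Z \<in> Vf \<Longrightarrow> X' \<in> Vf \<Longrightarrow> Rop (X + X') Y Z = Rop X Y Z + Rop X' Y Z"
  by (simp add: Rop_def br_def nab_add nab_add_left nab_diff_left)

lemma Rop_add_mid: "X \<in> Vf \<Longrightarrow> Y \<in> Vf \<Longrightarrow> Z \<in> Vf \<Longrightarrow> Y' \<in> Vf \<Longrightarrow> Rop X (Y + Y') Z = Rop X Y Z + Rop X Y' Z"
  by (simp add: Rop_def br_def nab_add nab_add_left nab_diff_left)

lemma Rop_diff_left: "X \<in> Vf \<Longrightarrow> Y \<in> Vf \<Longrightarrow> Z \<in> Vf \<Longrightarrow> X' \<in> Vf \<Longrightarrow> Rop (X - X') Y Z = Rop X Y Z - Rop X' Y Z"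
  by (simp add: Rop_def br_def nab_diff nab_diff_left)

lemma smul_diff_left: "u \<in> Fn \<Longrightarrow> v \<in> Fn \<Longrightarrow> X \<in> Vf \<Longrightarrow> smul (u - v) X = smul u X - smul v X"
  by (rule additive_on_diff[where S = Fn and F = "\<lambda>u. smul u X"]) (auto simp: smul_add_left)

text \<open>The second derivatives of \<open>u\<close> from the first two terms cancel against
  \<open>act (br X Y) u\<close>, which is where torsion-freeness enters; the mixed first-order terms
  cancel in pairs.\<close>

lemma Rop_smul: 
  assumes "X \<in> Vf" "Y \<in> Vf" "Z \<in> Vf" "u \<in> Fn"
  shows "Rop X Y (smul u Z) = smul u (Rop X Y Z)"
  using assms
  by (simp add: Rop_def nab_add nab_smul smul_add smul_diff act_br smul_diff_left)

lemma Rop_smul_left: 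
  assumes "X \<in> Vf" "Y \<in> Vf" "Z \<in> Vf" "u \<in> Fn"
  shows "Rop (smul u X) Y Z = smul u (Rop X Y Z)"
  using assms
  by (simp add: Rop_def br_def nab_smul nab_smul_left nab_add_left nab_diff_left smul_diff)

lemma Rop_smul_mid: 
  assumes "X \<in> Vf" "Y \<in> Vf" "Z \<in> Vf" "u \<in> Fn"
  shows "Rop X (smul u Y) Z = smul u (Rop X Y Z)"
  using Rop_smul_left[of Y X Z u] Rop_antisym[of Y X Z] Rop_antisym[of "smul u Y" X Z] assms
  by (simp add: smul_uminus)

text \<open>Differentiating \<open>ip Z W\<close> along \<open>br X Y\<close> agrees with the
  commutator of the derivatives along \<open>X\<close> and \<open>Y\<close>. After expansion by
  metric compatibility the products of first derivatives cancel and the curvature terms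
  remain.\<close>

lemma Rop_skew:
  assumes "X \<in> Vf" "Y \<in> Vf" "Z \<in> Vf" "W \<in> Vf"
  shows "ip W (Rop X Y Z) = - ip Z (Rop X Y W)"
proof -
  have "act (br X Y) (ip Z W) = act X (act Y (ip Z W)) - act Y (act X (ip Z W))"
    using assms by (simp add: act_br)
  then show ?thesis
    using assms
    by (simp add: Rop_def metric act_add ip_diff ip_diff_left ip_sym[of W] algebra_simps)
       (simp add: ip_sym ip_diff ip_diff_left ip_add algebra_simps)
qed

text \<open>The cyclic sum regroups into the Jacobi expression:
  \<open>nab X (br Y Z) - nab (br Y Z) X\<close> is the bracket of \<open>X\<close> with
  \<open>br Y Z\<close>.\<close>

lemma Rop_bianchi1:
  assumes "X \<in> Vf" "Y \<in> Vf" "Z \<in> Vf"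
  shows "Rop X Y Z + Rop Y Z X + Rop Z X Y = 0"
  using jacobi[OF assms] assms
  by (simp add: Rop_def br_def nab_diff nab_diff_left algebra_simps)

text \<open>The covariant derivative of the curvature operator, (\<nabla>_V R)(Y, Z)X, kept as a
  field.\<close>

definition dRop :: "'v \<Rightarrow> 'v \<Rightarrow> 'v \<Rightarrow> 'v \<Rightarrow> 'v" where
  "dRop V Y Z X = nab V (Rop Y Z X) - Rop (nab V Y) Z X - Rop Y (nab V Z) X - Rop Y Z (nab V X)"

lemma dRop_Vf [simp]: "V \<in> Vf \<Longrightarrow> X \<in> Vf \<Longrightarrow> Y \<in> Vf \<Longrightarrow> Z \<in> Vf \<Longrightarrow> dRop V X Y Z \<in> Vf"
  by (simp add: dRop_def)

lemma dRop_bianchi2: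
  assumes "X \<in> Vf" "Y \<in> Vf" "Z \<in> Vf" "W \<in> Vf"
  shows "dRop X Y Z W + dRop Y Z X W + dRop Z X Y W = 0"
proof -
  \<comment> \<open>The six corrections with \<open>nab\<close> in one of the first two slots of
    \<open>Rop\<close> pair up by antisymmetry into three with a bracket there.\<close>
  have a: "dRop X Y Z W + dRop Y Z X W + dRop Z X Y W =
     (nab X (Rop Y Z W) - Rop Y Z (nab X W)) + (nab Y (Rop Z X W) - Rop Z X (nab Y W))
     + (nab Z (Rop X Y W) - Rop X Y (nab Z W))
     - Rop (br X Y) Z W - Rop (br Y Z) X W - Rop (br Z X) Y W"
    using assms by (simp add: dRop_def br_def Rop_diff_left Rop_antisym[of "nab _ _" X] 
      Rop_antisym[of "nab _ _" Y] Rop_antisym[of "nab _ _" Z])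
  \<comment> \<open>The nested brackets left after unfolding add up to the derivative along the zero
    field, by Jacobi.\<close>
  have b: "nab (br (br X Y) Z) W + nab (br (br Y Z) X) W + nab (br (br Z X) Y) W = 0"
  proof -
    have "br (br X Y) Z + br (br Y Z) X + br (br Z X) Y = 0"
      using jacobi[OF assms(1-3)] by (simp add: br_def algebra_simps)
    then have "nab (br (br X Y) Z + br (br Y Z) X + br (br Z X) Y) W = nab 0 W"
      by simp
    moreover have "nab 0 W = 0"
      using nab_diff_left[of 0 0 W] assms by simp
    ultimately show ?thesis
      using assms by (simp add: nab_add_left)
  qed
  show ?thesis
    unfolding a using b assms
    by (simp add: Rop_def nab_diff nab_add algebra_simps)
qed

definition Rm :: "'v list \<Rightarrow> 'f" where
  "Rm Xs = ip (Xs ! 0) (Rop (Xs ! 2) (Xs ! 3) (Xs ! 1))"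

lemma Rm_simp [simp]: "Rm [X, Y, Z, W] = ip X (Rop Z W Y)"
  by (simp add: Rm_def eval_nat_numeral)

text \<open>The classical argument: four first Bianchi identities, one for each choice of the
  distinguished field, are added with signs. The skew symmetries cancel everything except twice the
  difference of the two sides.\<close>

lemma Rm_pair:
  assumes "X \<in> Vf" "Y \<in> Vf" "Z \<in> Vf" "W \<in> Vf"
  shows "Rm [X, Y, Z, W] = Rm [Z, W, X, Y]"
proof -
  have c: "ip D (Rop A B C) + ip D (Rop B C A) + ip D (Rop C A B) = 0"
    if "A \<in> Vf" "B \<in> Vf" "C \<in> Vf" "D \<in> Vf" for A B C D
  proof -
    have "ip D (Rop A B C + Rop B C A + Rop C A B) = 0"
      using Rop_bianchi1[of A B C] that ip_diff[of D 0 0] by simp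
    then show ?thesis using that by (simp add: ip_add)
  qed
  note skew = Rop_skew
  have anti: "ip D (Rop B A C) = - ip D (Rop A B C)"
    if "A \<in> Vf" "B \<in> Vf" "C \<in> Vf" "D \<in> Vf" for A B C D
    using that Rop_antisym[of A B C] ip_diff[of D 0 "Rop A B C"] ip_diff[of D 0 0] by simp
  define a where "a = ip X (Rop Z W Y)"
  define b where "b = ip X (Rop W Y Z)"
  define d where "d = ip X (Rop Y Z W)"
  define a' where "a' = ip Z (Rop X Y W)"
  define b' where "b' = ip Z (Rop Y W X)"
  define f where "f = ip W (Rop Y Z X)"
  define p where "p = ip Y (Rop W X Z)"
  define q where "q = ip Y (Rop X Z W)"
  have "a + b + d = 0" using c[of Z W Y X] assms by (simp add: a_def b_def d_def)
  moreover have "ip Y (Rop Z W X) + ip Y (Rop W X Z) + ip Y (Rop X Z W) = 0" using c[of Z W X Y] assms by simp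
  moreover have "a' + b' + ip Z (Rop W X Y) = 0" using c[of X Y W Z] assms by (simp add: a'_def b'_def)
  moreover have "ip W (Rop X Y Z) + f + ip W (Rop Z X Y) = 0" using c[of X Y Z W] assms by (simp add: f_def)
  moreover have "ip Y (Rop Z W X) = - a" using skew[of Z W X Y] assms by (simp add: a_def)
  moreover have "ip W (Rop X Y Z) = - a'" using skew[of X Y Z W] assms by (simp add: a'_def)
  moreover have "b' = b" using skew[of Y W X Z] anti[of Y W Z X] assms by (simp add: b_def b'_def)
  moreover have "f = - d" using skew[of Y Z X W] assms by (simp add: f_def d_def)
  moreover have "ip Z (Rop W X Y) = - p" using skew[of W X Y Z] assms by (simp add: p_def)
  moreover have "ip W (Rop Z X Y) = q" using skew[of Z X Y W] anti[of X Z W Y] assms by (simp add: q_def)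
  ultimately have "a + b + d = 0" "- a + p + q = 0" "a' + b - p = 0" "- a' - d + q = 0"
    by (simp_all add: p_def q_def)
  moreover have "(a - a') + (a - a') = (a + b + d) - (- a + p + q) - (a' + b - p) + (- a' - d + q)"
    by (simp add: algebra_simps)
  ultimately have "(a - a') + (a - a') = 0"
    by simp
  \<comment> \<open>The ring need not contain 1/2; \<open>two_torsion_free\<close> takes its
    place.\<close>
  then have "a - a' = 0"
    by (rule two_torsion_free)
  then show ?thesis
    using assms by (simp add: a_def a'_def)
qed

section \<open>Tensors, covariant derivatives and the Ricci identity\<close>

definition vfs :: "nat \<Rightarrow> 'v list set" where
  "vfs k = {Xs. length Xs = k \<and> set Xs \<subseteq> Vf}"

lemma vfs_length: "Xs \<in> vfs k \<Longrightarrow> length Xs = k"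
  by (simp add: vfs_def)

lemma vfs_nth [simp]: "Xs \<in> vfs k \<Longrightarrow> i < k \<Longrightarrow> Xs ! i \<in> Vf"
  by (auto simp: vfs_def)

lemma vfs_update [simp]: "Xs \<in> vfs k \<Longrightarrow> X \<in> Vf \<Longrightarrow> Xs[i := X] \<in> vfs k"
  using set_update_subset_insert[of Xs i X] by (auto simp: vfs_def)

lemma vfs_snoc [simp]: "Xs @ [Y] \<in> vfs (Suc k) \<longleftrightarrow> Xs \<in> vfs k \<and> Y \<in> Vf"
  by (auto simp: vfs_def)

lemma vfs_snoc2 [simp]: "Xs @ [Y, Z] \<in> vfs (Suc (Suc k)) \<longleftrightarrow> Xs \<in> vfs k \<and> Y \<in> Vf \<and> Z \<in> Vf"
  by (auto simp: vfs_def)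

lemma vfs_frame [simp]: "length is = k \<Longrightarrow> map E is \<in> vfs k"
  by (auto simp: vfs_def)

lemma vfs_SucE:
  assumes "Zs \<in> vfs (Suc k)"
  obtains Xs Y where "Zs = Xs @ [Y]" "Xs \<in> vfs k" "Y \<in> Vf"
  using assms by (cases Zs rule: rev_cases) (auto simp: vfs_def)

definition tensor :: "nat \<Rightarrow> ('v list \<Rightarrow> 'f) \<Rightarrow> bool" where
  "tensor k T \<longleftrightarrow> (\<forall>Xs\<in>vfs k. T Xs \<in> Fn \<and> (\<forall>a<k. \<forall>X\<in>Vf.
     (\<forall>Y\<in>Vf. T (Xs[a := X + Y]) = T (Xs[a := X]) + T (Xs[a := Y])) \<and>
     (\<forall>u\<in>Fn. T (Xs[a := smul u X]) = u * T (Xs[a := X]))))"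

lemma tensor_Fn [simp]: "tensor k T \<Longrightarrow> Xs \<in> vfs k \<Longrightarrow> T Xs \<in> Fn"
  by (simp add: tensor_def)

lemma tensor_add:
  "tensor k T \<Longrightarrow> Xs \<in> vfs k \<Longrightarrow> a < k \<Longrightarrow> X \<in> Vf \<Longrightarrow> Y \<in> Vf \<Longrightarrow>
    T (Xs[a := X + Y]) = T (Xs[a := X]) + T (Xs[a := Y])"
  by (simp add: tensor_def)

lemma tensor_smul:
  "tensor k T \<Longrightarrow> Xs \<in> vfs k \<Longrightarrow> a < k \<Longrightarrow> X \<in> Vf \<Longrightarrow> u \<in> Fn \<Longrightarrow>
    T (Xs[a := smul u X]) = u * T (Xs[a := X])"
  by (simp add: tensor_def)

lemma tensor_diff:
  "tensor k T \<Longrightarrow> Xs \<in> vfs k \<Longrightarrow> a < k \<Longrightarrow> X \<in> Vf \<Longrightarrow> Y \<in> Vf \<Longrightarrow>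
    T (Xs[a := X - Y]) = T (Xs[a := X]) - T (Xs[a := Y])"
  by (rule additive_on_diff[where S = Vf and F = "\<lambda>X. T (Xs[a := X])"]) (auto simp: tensor_add)

lemma tensor_zero:
  "tensor k T \<Longrightarrow> Xs \<in> vfs k \<Longrightarrow> a < k \<Longrightarrow> T (Xs[a := 0]) = 0"
  using tensor_diff[of k T Xs a 0 0] by simp

lemma tensor_sum:
  assumes "tensor k T" "Xs \<in> vfs k" "a < k" "\<And>i. i \<in> I \<Longrightarrow> X i \<in> Vf"
  shows "T (Xs[a := sum X I]) = (\<Sum>i\<in>I. T (Xs[a := X i]))"
  using assms(4)
  by (induction I rule: infinite_finite_induct) (use assms in \<open>auto simp: tensor_add tensor_zero\<close>)

lemma tensor_expand:
  assumes "tensor k T" "Xs \<in> vfs k" "a < k" "X \<in> Vf"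
  shows "T (Xs[a := X]) = (\<Sum>p\<in>UNIV. ip X (E p) * T (Xs[a := E p]))"
proof -
  have "T (Xs[a := X]) = T (Xs[a := \<Sum>p\<in>UNIV. smul (ip X (E p)) (E p)])"
    using E_expand[OF assms(4)] by simp
  also have "\<dots> = (\<Sum>p\<in>UNIV. T (Xs[a := smul (ip X (E p)) (E p)]))"
    using assms by (intro tensor_sum[of k]) auto
  finally show ?thesis
    using assms by (simp add: tensor_smul[of k])
qed

definition cov :: "('v list \<Rightarrow> 'f) \<Rightarrow> 'v list \<Rightarrow> 'f" where
  "cov T Zs = (let Xs = butlast Zs; Y = last Zs
     in act Y (T Xs) - (\<Sum>i<length Xs. T (Xs[i := nab Y (Xs ! i)])))"

lemma cov_snoc: "cov T (Xs @ [Y]) = act Y (T Xs) - (\<Sum>i<length Xs. T (Xs[i := nab Y (Xs ! i)]))"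
  by (simp add: cov_def)

text \<open>Separates the terms in which \<open>X\<close> itself is differentiated from those that
  merely carry it along, so that linearity in slot \<open>a\<close> can be checked termwise.\<close>

lemma cov_slot:
  assumes "Xs \<in> vfs k" "a < k"
  shows "cov T (Xs[a := X] @ [Y]) = act Y (T (Xs[a := X])) - T (Xs[a := nab Y X])
    - (\<Sum>i\<in>{..<k} - {a}. T (Xs[i := nab Y (Xs ! i), a := X]))"
proof -
  have "(\<Sum>i<k. T (Xs[a := X, i := nab Y (Xs[a := X] ! i)])) =
      T (Xs[a := X, a := nab Y (Xs[a := X] ! a)])
      + (\<Sum>i\<in>{..<k} - {a}. T (Xs[a := X, i := nab Y (Xs[a := X] ! i)]))"
    using assms by (intro sum.remove) auto
  moreover have "T (Xs[a := X, i := nab Y (Xs[a := X] ! i)]) = T (Xs[i := nab Y (Xs ! i), a := X])"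
    if "i \<noteq> a" for i
    using that by (simp add: list_update_swap)
  ultimately show ?thesis
    using assms by (simp add: cov_snoc vfs_length algebra_simps)
qed

text \<open>In an old slot the derivative of the factor \<open>u\<close> appears once from
  \<open>act\<close> and once, with opposite sign, from \<open>nab_smul\<close>. In the new last
  slot both \<open>act\<close> and \<open>nab\<close> are linear over functions.\<close>

lemma tensor_cov:
  assumes T: "tensor k T"
  shows "tensor (Suc k) (cov T)"
  unfolding tensor_def
proof (intro ballI conjI allI impI)
  fix Zs assume "Zs \<in> vfs (Suc k)"
  then obtain Xs V where Z: "Zs = Xs @ [V]" "Xs \<in> vfs k" "V \<in> Vf"
    by (rule vfs_SucE)
  show "cov T Zs \<in> Fn"
    using T Z by (auto simp: cov_snoc vfs_length intro!: Fn_diff Fn_sum tensor_Fn[of k T] act_Fn)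
  fix a X assume a: "a < Suc k" and X: "X \<in> Vf"
  have m: "T (Xs[i := nab V (Xs ! i), a := Z]) \<in> Fn" if "i < k" "Z \<in> Vf" for i Z
    using that Z T by (auto intro!: tensor_Fn[of k T])
  show "cov T (Zs[a := X + Y]) = cov T (Zs[a := X]) + cov T (Zs[a := Y])" if Y: "Y \<in> Vf" for Y
  proof (cases "a < k")
    case True
    have "(\<Sum>i\<in>{..<k} - {a}. T (Xs[i := nab V (Xs ! i), a := X + Y])) =
       (\<Sum>i\<in>{..<k} - {a}. T (Xs[i := nab V (Xs ! i), a := X]))
       + (\<Sum>i\<in>{..<k} - {a}. T (Xs[i := nab V (Xs ! i), a := Y]))"
      unfolding sum.distrib[symmetric]
      using True X Y Z T by (intro sum.cong refl tensor_add[of k]) auto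
    moreover have "T (Xs[a := X]) \<in> Fn" "T (Xs[a := Y]) \<in> Fn"
      using Z T X Y by (auto intro!: tensor_Fn[of k T])
    ultimately show ?thesis
      using True X Y Z T
      by (simp add: list_update_append vfs_length cov_slot[of _ k] tensor_add[of k] nab_add act_add)
  next
    case False
    then have "a = length Xs" using a Z by (auto simp: vfs_length)
    then have Zu: "Zs[a := W] = Xs @ [W]" for W unfolding Z(1) by simp
    moreover have "(\<Sum>i<k. T (Xs[i := nab X (Xs ! i) + nab Y (Xs ! i)])) =
       (\<Sum>i<k. T (Xs[i := nab X (Xs ! i)])) + (\<Sum>i<k. T (Xs[i := nab Y (Xs ! i)]))"
      unfolding sum.distrib[symmetric]
      using X Y Z T by (intro sum.cong refl tensor_add[of k]) auto
    ultimately show ?thesis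
      using X Y Z T unfolding Zu by (simp add: cov_snoc vfs_length act_add_left nab_add_left)
  qed
  show "cov T (Zs[a := smul u X]) = u * cov T (Zs[a := X])" if u: "u \<in> Fn" for u
  proof (cases "a < k")
    case True
    have "(\<Sum>i\<in>{..<k} - {a}. T (Xs[i := nab V (Xs ! i), a := smul u X])) =
       u * (\<Sum>i\<in>{..<k} - {a}. T (Xs[i := nab V (Xs ! i), a := X]))"
      unfolding sum_distrib_left
      using True X u Z T by (intro sum.cong refl tensor_smul[of k]) auto
    moreover have "T (Xs[a := X]) \<in> Fn"
      using Z T X by (auto intro!: tensor_Fn[of k T])
    ultimately show ?thesis
      using True X u Z T
      by (simp add: list_update_append vfs_length cov_slot[of _ k] tensor_add[of k] tensor_smul[of k]
        nab_smul act_mult algebra_simps)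
  next
    case False
    then have "a = length Xs" using a Z by (auto simp: vfs_length)
    then have Zu: "Zs[a := W] = Xs @ [W]" for W unfolding Z(1) by simp
    moreover have "(\<Sum>i<k. T (Xs[i := smul u (nab X (Xs ! i))])) = u * (\<Sum>i<k. T (Xs[i := nab X (Xs ! i)]))"
      unfolding sum_distrib_left
      using X u Z T by (intro sum.cong refl tensor_smul[of k]) auto
    ultimately show ?thesis
      using X u Z T unfolding Zu by (simp add: cov_snoc vfs_length act_smul nab_smul_left algebra_simps)
  qed
qed

lemma cov_snoc_snoc:
  assumes T: "tensor k T" and Xs: "Xs \<in> vfs k" and Y: "Y \<in> Vf" and Z: "Z \<in> Vf"
  shows "cov S (Xs @ [Y, Z]) = act Z (S (Xs @ [Y])) - (\<Sum>i<k. S (Xs[i := nab Z (Xs ! i)] @ [Y]))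
     - S (Xs @ [nab Z Y])"
proof -
  have "cov S ((Xs @ [Y]) @ [Z]) = act Z (S (Xs @ [Y])) - (\<Sum>i<k. S (Xs[i := nab Z (Xs ! i)] @ [Y]))
     - S (Xs @ [nab Z Y])"
    unfolding cov_snoc using Xs by (simp add: vfs_length list_update_append nth_append algebra_simps)
  then show ?thesis by simp
qed

text \<open>On the sign: \<open>[Y, Z]\<close> differentiates along \<open>Y\<close> first, so the
  left side is R(Z, Y) applied to \<open>T\<close>, and R acts on covariant slots with a minus
  sign.\<close>

lemma ricci_identity:
  assumes T: "tensor k T" and Xs: "Xs \<in> vfs k" and Y: "Y \<in> Vf" and Z: "Z \<in> Vf"
  shows "cov (cov T) (Xs @ [Y, Z]) - cov (cov T) (Xs @ [Z, Y]) = (\<Sum>i<k. T (Xs[i := Rop Y Z (Xs ! i)]))"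
proof -
  define P where "P Y Z = (\<Sum>i<k. \<Sum>j<k. T (Xs[i := nab Z (Xs ! i), j := nab Y (Xs[i := nab Z (Xs ! i)] ! j)]))" for Y Z
  define Q where "Q i j Y Z = (if i = j then T (Xs[i := nab Y (nab Z (Xs ! i))])
     else T (Xs[i := nab Z (Xs ! i), j := nab Y (Xs ! j)]))" for i j Y Z
  have e: "cov (cov T) (Xs @ [Y, Z]) =
      act Z (act Y (T Xs)) - (\<Sum>i<k. act Z (T (Xs[i := nab Y (Xs ! i)])))
      - (\<Sum>i<k. act Y (T (Xs[i := nab Z (Xs ! i)]))) + P Y Z
      - act (nab Z Y) (T Xs) + (\<Sum>i<k. T (Xs[i := nab (nab Z Y) (Xs ! i)]))"
    if Y: "Y \<in> Vf" and Z: "Z \<in> Vf" for Y Z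
  proof -
    have "T (Xs[i := nab Y (Xs ! i)]) \<in> Fn" if "i < k" for i
      using T Xs Y that by (auto intro!: tensor_Fn[of k T])
    moreover from this have "(\<Sum>i<k. T (Xs[i := nab Y (Xs ! i)])) \<in> Fn"
        "act Z (\<Sum>i<k. T (Xs[i := nab Y (Xs ! i)])) = (\<Sum>i<k. act Z (T (Xs[i := nab Y (Xs ! i)])))"
      using Z by (auto intro!: Fn_sum act_sum)
    moreover have "T Xs \<in> Fn"
      using T Xs by simp
    ultimately show ?thesis
      using T Xs Y Z
      by (simp add: cov_snoc_snoc[OF T] cov_snoc vfs_length act_diff act_sum P_def sum_subtractf algebra_simps)
  qed
  have PQ: "P Y Z = (\<Sum>i<k. \<Sum>j<k. Q i j Y Z)" for Y Z
    unfolding P_def Q_def using Xs by (intro sum.cong refl) (auto simp: vfs_length)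
  \<comment> \<open>Exchanging \<open>i\<close> with \<open>j\<close> and \<open>Y\<close> with
    \<open>Z\<close> fixes the terms that differentiate two different slots, so only second
    derivatives in a single slot survive.\<close>
  have sw: "Q i j Y Z - Q j i Z Y = (if i = j then T (Xs[i := nab Y (nab Z (Xs ! i)) - nab Z (nab Y (Xs ! i))]) else 0)"
    if "i < k" for i j
    using T Xs Y Z that by (auto simp: Q_def list_update_swap tensor_diff[of k])
  have "P Y Z - P Z Y = (\<Sum>i<k. \<Sum>j<k. Q i j Y Z) - (\<Sum>i<k. \<Sum>j<k. Q j i Z Y)"
    unfolding PQ by (simp add: sum.swap[of "\<lambda>i j. Q j i Z Y"])
  also have "\<dots> = (\<Sum>i<k. \<Sum>j<k. Q i j Y Z - Q j i Z Y)"
    by (simp add: sum_subtractf)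
  also have "\<dots> = (\<Sum>i<k. T (Xs[i := nab Y (nab Z (Xs ! i)) - nab Z (nab Y (Xs ! i))]))"
    by (intro sum.cong refl) (simp add: sw)
  finally have P: "P Y Z - P Z Y = (\<Sum>i<k. T (Xs[i := nab Y (nab Z (Xs ! i)) - nab Z (nab Y (Xs ! i))]))" .
  have "T (Xs[i := Rop Y Z (Xs ! i)]) = T (Xs[i := nab Y (nab Z (Xs ! i)) - nab Z (nab Y (Xs ! i))])
     + T (Xs[i := nab (nab Z Y) (Xs ! i)]) - T (Xs[i := nab (nab Y Z) (Xs ! i)])" if "i < k" for i
    using T Xs Y Z that
    by (simp add: Rop_def br_def nab_diff_left tensor_diff[of k])
  then have R: "(\<Sum>i<k. T (Xs[i := Rop Y Z (Xs ! i)])) = P Y Z - P Z Y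
     + (\<Sum>i<k. T (Xs[i := nab (nab Z Y) (Xs ! i)])) - (\<Sum>i<k. T (Xs[i := nab (nab Y Z) (Xs ! i)]))"
    unfolding P by (simp add: sum.distrib sum_subtractf)
  have "T Xs \<in> Fn" using T Xs by simp
  then have "act (nab Z Y) (T Xs) - act (nab Y Z) (T Xs) = act Z (act Y (T Xs)) - act Y (act Z (T Xs))"
    using Y Z torsion[of Z Y "T Xs"] by (simp add: act_diff_left)
  then show ?thesis
    unfolding e[OF Y Z] e[OF Z Y] R by (simp add: algebra_simps)
qed

text \<open>The derivative of \<open>ricci_identity\<close> along \<open>V\<close>: by the product
  rule it falls on the curvature, giving \<open>dRop\<close>, or on \<open>T\<close>.\<close>

lemma cov_ricci_identity:
  assumes T: "tensor k T" and Xs: "Xs \<in> vfs k" and Y: "Y \<in> Vf" and Z: "Z \<in> Vf" and V: "V \<in> Vf"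
  shows "cov (cov (cov T)) (Xs @ [Y, Z, V]) - cov (cov (cov T)) (Xs @ [Z, Y, V]) =
    (\<Sum>i<k. T (Xs[i := dRop V Y Z (Xs ! i)]) + cov T (Xs[i := Rop Y Z (Xs ! i)] @ [V]))"
proof -
  define Q where "Q Xs Y Z = (\<Sum>i<k. T (Xs[i := Rop Y Z (Xs ! i)]))" for Xs Y Z
  have H: "tensor (Suc (Suc k)) (cov (cov T))"
    using T by (intro tensor_cov)
  have e: "cov S (Xs @ [Y, Z, V]) = act V (S (Xs @ [Y, Z])) - (\<Sum>i<k. S (Xs[i := nab V (Xs ! i)] @ [Y, Z]))
      - S (Xs @ [nab V Y, Z]) - S (Xs @ [Y, nab V Z])" for S Y Z
  proof -
    have "cov S ((Xs @ [Y, Z]) @ [V]) = act V (S (Xs @ [Y, Z])) - (\<Sum>i<k. S (Xs[i := nab V (Xs ! i)] @ [Y, Z]))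
      - S (Xs @ [nab V Y, Z]) - S (Xs @ [Y, nab V Z])"
      unfolding cov_snoc using Xs by (simp add: vfs_length list_update_append nth_append algebra_simps)
    then show ?thesis by simp
  qed
  have q: "cov (cov T) (Xs @ [Y, Z]) - cov (cov T) (Xs @ [Z, Y]) = Q Xs Y Z"
    if "Xs \<in> vfs k" "Y \<in> Vf" "Z \<in> Vf" for Xs Y Z
    unfolding Q_def by (rule ricci_identity[OF T that])
  have Fn: "cov (cov T) (Xs @ [Y, Z]) \<in> Fn" "cov (cov T) (Xs @ [Z, Y]) \<in> Fn"
    using H Xs Y Z by auto
  have "cov (cov (cov T)) (Xs @ [Y, Z, V]) - cov (cov (cov T)) (Xs @ [Z, Y, V]) =
     act V (cov (cov T) (Xs @ [Y, Z]) - cov (cov T) (Xs @ [Z, Y]))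
     - (\<Sum>i<k. cov (cov T) (Xs[i := nab V (Xs ! i)] @ [Y, Z]) - cov (cov T) (Xs[i := nab V (Xs ! i)] @ [Z, Y]))
     - (cov (cov T) (Xs @ [nab V Y, Z]) - cov (cov T) (Xs @ [Z, nab V Y]))
     - (cov (cov T) (Xs @ [Y, nab V Z]) - cov (cov T) (Xs @ [nab V Z, Y]))"
    using Fn V by (simp add: e act_diff sum_subtractf algebra_simps)
  also have "\<dots> = act V (Q Xs Y Z) - (\<Sum>j<k. Q (Xs[j := nab V (Xs ! j)]) Y Z)
      - Q Xs (nab V Y) Z - Q Xs Y (nab V Z)"
    using Xs Y Z V by (simp add: q cong: sum.cong_simp)
  also have "\<dots> = (\<Sum>i<k. act V (T (Xs[i := Rop Y Z (Xs ! i)]))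
      - (\<Sum>j<k. T (Xs[j := nab V (Xs ! j), i := Rop Y Z (Xs[j := nab V (Xs ! j)] ! i)]))
      - T (Xs[i := Rop (nab V Y) Z (Xs ! i)]) - T (Xs[i := Rop Y (nab V Z) (Xs ! i)]))"
  proof -
    have "act V (Q Xs Y Z) = (\<Sum>i<k. act V (T (Xs[i := Rop Y Z (Xs ! i)])))"
      unfolding Q_def using T Xs Y Z V by (intro act_sum) (auto intro!: tensor_Fn[of k T])
    then show ?thesis
      unfolding sum_subtractf Q_def by (subst (2) sum.swap) simp
  qed
  also have "\<dots> = (\<Sum>i<k. T (Xs[i := dRop V Y Z (Xs ! i)]) + cov T (Xs[i := Rop Y Z (Xs ! i)] @ [V]))"
  proof (intro sum.cong refl)
    fix i assume i: "i \<in> {..<k}"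
    \<comment> \<open>The summand \<open>j = i\<close> differentiates the argument inside
      \<open>Rop\<close> and is the last correction of \<open>dRop\<close>; the others belong to
      \<open>cov T\<close>.\<close>
    have "(\<Sum>j<k. T (Xs[j := nab V (Xs ! j), i := Rop Y Z (Xs[j := nab V (Xs ! j)] ! i)])) =
       T (Xs[i := Rop Y Z (nab V (Xs ! i))])
       + (\<Sum>j\<in>{..<k} - {i}. T (Xs[j := nab V (Xs ! j), i := Rop Y Z (Xs ! i)]))"
      using i Xs by (subst sum.remove[of _ i]) (auto simp: vfs_length)
    then show "act V (T (Xs[i := Rop Y Z (Xs ! i)]))
      - (\<Sum>j<k. T (Xs[j := nab V (Xs ! j), i := Rop Y Z (Xs[j := nab V (Xs ! j)] ! i)]))
      - T (Xs[i := Rop (nab V Y) Z (Xs ! i)]) - T (Xs[i := Rop Y (nab V Z) (Xs ! i)]) =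
      T (Xs[i := dRop V Y Z (Xs ! i)]) + cov T (Xs[i := Rop Y Z (Xs ! i)] @ [V])"
      using i T Xs Y Z V by (simp add: cov_slot[of _ k] dRop_def tensor_diff[of k] tensor_add[of k] algebra_simps)
  qed
  finally show ?thesis .
qed

section \<open>Contractions in the frame and the Bochner formula\<close>

lemma nab_E_skew: "X \<in> Vf \<Longrightarrow> ip (nab X (E i)) (E p) = - ip (nab X (E p)) (E i)"
  using metric[of X "E i" "E p"] ip_sym[of "E i" "nab X (E p)"]
  by (simp add: E_orthonormal eq_neg_iff_add_eq_0 split: if_split_asm)

text \<open>Traces commute with covariant differentiation: the connection coefficients of an
  orthonormal frame are skew (\<open>nab_E_skew\<close>), so the two corrections are negatives of
  each other. Linearity of \<open>B\<close> enters only as expansion in the frame.\<close>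

lemma contraction_parallel:
  assumes B: "\<And>X Y. X \<in> Vf \<Longrightarrow> Y \<in> Vf \<Longrightarrow> B X Y = (\<Sum>p\<in>UNIV. ip X (E p) * B (E p) Y)"
    "\<And>X Y. X \<in> Vf \<Longrightarrow> Y \<in> Vf \<Longrightarrow> B X Y = (\<Sum>p\<in>UNIV. ip Y (E p) * B X (E p))"
    and X: "X \<in> Vf"
  shows "(\<Sum>s\<in>UNIV. B (nab X (E s)) (E s) + B (E s) (nab X (E s))) = 0"
proof -
  have "(\<Sum>s\<in>UNIV. B (E s) (nab X (E s))) = (\<Sum>s\<in>UNIV. \<Sum>p\<in>UNIV. ip (nab X (E s)) (E p) * B (E s) (E p))"
    using X by (simp add: B(2)[of _ "nab _ _"])
  also have "\<dots> = (\<Sum>p\<in>UNIV. \<Sum>s\<in>UNIV. - (ip (nab X (E p)) (E s) * B (E s) (E p)))"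
    by (subst sum.swap, intro sum.cong refl, subst nab_E_skew[OF X]) simp
  also have "\<dots> = - (\<Sum>s\<in>UNIV. B (nab X (E s)) (E s))"
    using X by (simp add: B(1)[of "nab _ _"] sum_negf)
  finally show ?thesis by (simp add: sum.distrib)
qed

text \<open>The product rule for a full contraction. In each slot the corrections for
  \<open>S\<close> and for \<open>T\<close> cancel, because the coefficients \<open>\<gamma>\<close>
  are skew.\<close>

lemma act_inner_product:
  assumes S: "tensor k S" and T: "tensor k T" and X: "X \<in> Vf"
  shows "act X (\<Sum>is | length is = k. S (map E is) * T (map E is)) =
    (\<Sum>is | length is = k. cov S (map E is @ [X]) * T (map E is) + S (map E is) * cov T (map E is @ [X]))"
proof -
  define \<gamma> where "\<gamma> a p = ip (nab X (E a)) (E p)" for a p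
  have skew: "\<gamma> a p = - \<gamma> p a" for a p
    unfolding \<gamma>_def by (rule nab_E_skew[OF X])
  have Fn: "S (map E is) \<in> Fn" "T (map E is) \<in> Fn" if "length is = k" for "is"
    using S T that by auto
  have upd: "S' ((map E is)[i := nab X (E (is ! i))]) = (\<Sum>p\<in>UNIV. \<gamma> (is ! i) p * S' (map E (is[i := p])))"
    if "tensor k S'" "length is = k" "i < k" for S' "is" i
    using that X by (subst tensor_expand[of k]) (auto simp: \<gamma>_def map_update)
  have i0: "(\<Sum>is | length is = k. \<Sum>p\<in>UNIV. \<gamma> (is ! i) p * S (map E (is[i := p])) * T (map E is)) =
      - (\<Sum>is | length is = k. \<Sum>p\<in>UNIV. \<gamma> (is ! i) p * S (map E is) * T (map E (is[i := p])))"
    if "i < k" for i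
  proof -
    have "(\<Sum>is | length is = k. \<Sum>p\<in>UNIV. \<gamma> (is ! i) p * S (map E (is[i := p])) * T (map E is)) =
      (\<Sum>(is, p)\<in>{is. length is = k} \<times> UNIV. \<gamma> (is ! i) p * S (map E (is[i := p])) * T (map E is))"
      by (rule sum.cartesian_product)
    \<comment> \<open>Exchanging the entry \<open>is ! i\<close> with the summed index
      \<open>p\<close> is an involution; it moves the modified slot from \<open>S\<close> to
      \<open>T\<close>.\<close>
    also have "\<dots> = (\<Sum>(is, p)\<in>{is. length is = k} \<times> UNIV. \<gamma> p (is ! i) * S (map E is) * T (map E (is[i := p])))"
      by (rule sum.reindex_bij_witness[of _ "\<lambda>(is, p). (is[i := p], is ! i)" "\<lambda>(is, p). (is[i := p], is ! i)"])
         (use that in auto)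
    also have "\<dots> = (\<Sum>(is, p)\<in>{is. length is = k} \<times> UNIV. - (\<gamma> (is ! i) p * S (map E is) * T (map E (is[i := p]))))"
      by (intro sum.cong refl, clarsimp, subst skew, simp)
    also have "\<dots> = - (\<Sum>is | length is = k. \<Sum>p\<in>UNIV. \<gamma> (is ! i) p * S (map E is) * T (map E (is[i := p])))"
      unfolding sum.cartesian_product by (simp add: sum_negf case_prod_unfold)
    finally show ?thesis .
  qed
  have "(\<Sum>is | length is = k. \<Sum>i<k. S ((map E is)[i := nab X (map E is ! i)]) * T (map E is)
       + S (map E is) * T ((map E is)[i := nab X (map E is ! i)])) =
     (\<Sum>i<k. (\<Sum>is | length is = k. \<Sum>p\<in>UNIV. \<gamma> (is ! i) p * S (map E (is[i := p])) * T (map E is))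
       + (\<Sum>is | length is = k. \<Sum>p\<in>UNIV. \<gamma> (is ! i) p * S (map E is) * T (map E (is[i := p]))))"
    unfolding sum.distrib[symmetric]
    apply (subst sum.swap)
    apply (intro sum.cong refl)
    apply (simp add: upd[OF S] upd[OF T] sum.distrib sum_distrib_left sum_distrib_right)
    apply (simp add: mult.assoc mult.left_commute)
    done
  also have "\<dots> = 0"
    by (rule sum.neutral) (simp add: i0)
  finally have z: "(\<Sum>is | length is = k. \<Sum>i<k. S ((map E is)[i := nab X (map E is ! i)]) * T (map E is)
       + S (map E is) * T ((map E is)[i := nab X (map E is ! i)])) = 0" .
  have "act X (\<Sum>is | length is = k. S (map E is) * T (map E is)) =
    (\<Sum>is | length is = k. act X (S (map E is)) * T (map E is) + S (map E is) * act X (T (map E is)))"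
    using Fn X by (subst act_sum) (auto simp: act_mult)
  also have "\<dots> = (\<Sum>is | length is = k. (cov S (map E is @ [X]) * T (map E is) + S (map E is) * cov T (map E is @ [X]))
       + (\<Sum>i<k. S ((map E is)[i := nab X (map E is ! i)]) * T (map E is)
       + S (map E is) * T ((map E is)[i := nab X (map E is ! i)])))"
    by (intro sum.cong refl)
       (simp add: cov_snoc sum.distrib algebra_simps sum_distrib_left)
  finally show ?thesis
    unfolding sum.distrib[of _ "\<lambda>is. \<Sum>i<k. _ is i"] z by simp
qed

text \<open>Freezing the direction of differentiation leaves a \<open>k\<close>-tensor, so that
  \<open>act_inner_product\<close> applies to \<nabla>_X T.\<close>

lemma tensor_partial:
  assumes T: "tensor (Suc k) T" and X: "X \<in> Vf"
  shows "tensor k (\<lambda>Xs. T (Xs @ [X]))"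
  unfolding tensor_def
proof (intro ballI conjI allI impI)
  fix Xs assume Xs: "Xs \<in> vfs k"
  then show "T (Xs @ [X]) \<in> Fn" using T X by simp
  fix a Y assume a: "a < k" and Y: "Y \<in> Vf"
  have u: "Xs[a := Z] @ [X] = (Xs @ [X])[a := Z]" for Z
    using a Xs by (simp add: list_update_append vfs_length)
  show "T (Xs[a := Y + Z] @ [X]) = T (Xs[a := Y] @ [X]) + T (Xs[a := Z] @ [X])" if "Z \<in> Vf" for Z
    unfolding u using that T Xs X Y a by (intro tensor_add[of "Suc k"]) auto
  show "T (Xs[a := smul v Y] @ [X]) = v * T (Xs[a := Y] @ [X])" if "v \<in> Fn" for v
    unfolding u using that T Xs X Y a by (intro tensor_smul[of "Suc k"]) auto
qed

text \<open>One direction of the Laplacian of |T|^2; the sum over the frame is taken only in the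
  final theorem. The ring type provides no numeral 2, hence the repeated sum.\<close>

lemma bochner:
  fixes T k
  defines "F \<equiv> (\<Sum>is | length is = k. T (map E is) * T (map E is))"
  assumes T: "tensor k T" and X: "X \<in> Vf"
  shows "cov (cov (\<lambda>_. F)) [X, X] =
    (\<Sum>is | length is = k. cov T (map E is @ [X]) * cov T (map E is @ [X])
        + T (map E is) * cov (cov T) (map E is @ [X, X]))
    + (\<Sum>is | length is = k. cov T (map E is @ [X]) * cov T (map E is @ [X])
        + T (map E is) * cov (cov T) (map E is @ [X, X]))"
proof -
  have c: "cov S [Z] = act Z (S [])" "cov S [Y, Z] = act Z (S [Y]) - S [nab Z Y]" for S Y Z
    using cov_snoc[of S "[]" Z] cov_snoc[of S "[Y]" Z] by simp_all
  define G where "G Z = (\<Sum>is | length is = k. T (map E is) * cov T (map E is @ [Z]))" for Z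
  have G: "act Z F = G Z + G Z" if "Z \<in> Vf" for Z
    unfolding F_def act_inner_product[OF T T that] G_def sum.distrib
    by (simp add: mult.commute)
  have GFn: "G Z \<in> Fn" if "Z \<in> Vf" for Z
    unfolding G_def using that T tensor_partial[OF tensor_cov[OF T]] tensor_cov[OF T] by (intro Fn_sum Fn_mult) auto
  have "act X (G X) = (\<Sum>is | length is = k. cov T (map E is @ [X]) * cov T (map E is @ [X])
      + T (map E is) * cov (\<lambda>Xs. cov T (Xs @ [X])) (map E is @ [X]))"
    unfolding G_def by (rule act_inner_product[OF T tensor_partial[OF tensor_cov[OF T] X] X])
  \<comment> \<open>With \<open>X\<close> frozen the correction for the last slot is missing. It is
    \<open>G (nab X X)\<close>, which the Hessian of \<open>F\<close> removes again.\<close>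
  also have "\<dots> = (\<Sum>is | length is = k. cov T (map E is @ [X]) * cov T (map E is @ [X])
      + T (map E is) * cov (cov T) (map E is @ [X, X])) + G (nab X X)"
    unfolding G_def sum.distrib[symmetric]
    by (intro sum.cong refl) (use T X in \<open>simp add: cov_snoc_snoc[of k T] cov_snoc[of "\<lambda>Xs. cov T (Xs @ [X])"] algebra_simps\<close>)
  finally have a: "act X (G X) = (\<Sum>is | length is = k. cov T (map E is @ [X]) * cov T (map E is @ [X])
      + T (map E is) * cov (cov T) (map E is @ [X, X])) + G (nab X X)" .
  have "cov (cov (\<lambda>_. F)) [X, X] = act X (G X) + act X (G X) - (G (nab X X) + G (nab X X))"
    using X GFn by (simp add: c G act_add)
  then show ?thesis unfolding a by (simp add: algebra_simps)
qed

section \<open>The Riemann tensor and its derivative\<close>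

lemma cov_four:
  "cov T [A, B, C, D, V] = act V (T [A, B, C, D]) - T [nab V A, B, C, D] - T [A, nab V B, C, D]
     - T [A, B, nab V C, D] - T [A, B, C, nab V D]"
  using cov_snoc[of T "[A, B, C, D]" V] by (simp add: eval_nat_numeral algebra_simps)

lemma cov_five:
  "cov T [A, B, C, D, F, V] = act V (T [A, B, C, D, F]) - T [nab V A, B, C, D, F] - T [A, nab V B, C, D, F]
     - T [A, B, nab V C, D, F] - T [A, B, C, nab V D, F] - T [A, B, C, D, nab V F]"
  using cov_snoc[of T "[A, B, C, D, F]" V] by (simp add: eval_nat_numeral algebra_simps)

lemma cov_six:
  "cov T [A, B, C, D, F, G, V] = act V (T [A, B, C, D, F, G]) - T [nab V A, B, C, D, F, G]
     - T [A, nab V B, C, D, F, G] - T [A, B, nab V C, D, F, G] - T [A, B, C, nab V D, F, G]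
     - T [A, B, C, D, nab V F, G] - T [A, B, C, D, F, nab V G]"
  using cov_snoc[of T "[A, B, C, D, F, G]" V] by (simp add: eval_nat_numeral algebra_simps)

lemma vfs_four: "Xs \<in> vfs 4 \<longleftrightarrow> (\<exists>A B C D. Xs = [A, B, C, D] \<and> A \<in> Vf \<and> B \<in> Vf \<and> C \<in> Vf \<and> D \<in> Vf)"
  by (auto simp: vfs_def eval_nat_numeral length_Suc_conv)

lemma less_four: "a < 4 \<longleftrightarrow> a = 0 \<or> a = 1 \<or> a = 2 \<or> a = (3::nat)"
  by auto

lemma tensor_four:
  assumes "\<And>A B C D. A \<in> Vf \<Longrightarrow> B \<in> Vf \<Longrightarrow> C \<in> Vf \<Longrightarrow> D \<in> Vf \<Longrightarrow> T [A, B, C, D] \<in> Fn"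
    and "\<And>A B C D X. A \<in> Vf \<Longrightarrow> B \<in> Vf \<Longrightarrow> C \<in> Vf \<Longrightarrow> D \<in> Vf \<Longrightarrow> X \<in> Vf \<Longrightarrow>
      T [A + X, B, C, D] = T [A, B, C, D] + T [X, B, C, D] \<and>
      T [A, B + X, C, D] = T [A, B, C, D] + T [A, X, C, D] \<and>
      T [A, B, C + X, D] = T [A, B, C, D] + T [A, B, X, D] \<and>
      T [A, B, C, D + X] = T [A, B, C, D] + T [A, B, C, X]"
    and "\<And>A B C D u. A \<in> Vf \<Longrightarrow> B \<in> Vf \<Longrightarrow> C \<in> Vf \<Longrightarrow> D \<in> Vf \<Longrightarrow> u \<in> Fn \<Longrightarrow>
      T [smul u A, B, C, D] = u * T [A, B, C, D] \<and>
      T [A, smul u B, C, D] = u * T [A, B, C, D] \<and>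
      T [A, B, smul u C, D] = u * T [A, B, C, D] \<and>
      T [A, B, C, smul u D] = u * T [A, B, C, D]"
  shows "tensor 4 T"
  unfolding tensor_def Ball_def vfs_four less_four
  using assms by (safe) (auto simp: numeral_2_eq_2 numeral_3_eq_3)

lemma tensor_Rm: "tensor 4 Rm"
  by (rule tensor_four)
     (simp_all add: ip_add ip_add_left ip_smul ip_smul_left Rop_add Rop_add_left Rop_add_mid
        Rop_smul Rop_smul_left Rop_smul_mid)

text \<open>The correction in the first slot cancels one term of the product rule for
  \<open>ip\<close>, as the metric is parallel.\<close>

lemma cov_Rm:
  assumes "A \<in> Vf" "B \<in> Vf" "C \<in> Vf" "D \<in> Vf" "V \<in> Vf"
  shows "cov Rm [A, B, C, D, V] = ip A (dRop V C D B)"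
  using assms by (simp add: cov_four metric dRop_def ip_diff)

lemma Rm_symmetries:
  assumes "A \<in> Vf" "B \<in> Vf" "C \<in> Vf" "D \<in> Vf"
  shows "Rm [B, A, C, D] = - Rm [A, B, C, D]" "Rm [A, B, D, C] = - Rm [A, B, C, D]"
    "Rm [A, B, C, D] + Rm [A, C, D, B] + Rm [A, D, B, C] = 0"
proof -
  show "Rm [B, A, C, D] = - Rm [A, B, C, D]"
    using assms Rop_skew[of C D B A] by simp
  show "Rm [A, B, D, C] = - Rm [A, B, C, D]"
    using assms Rop_antisym[of C D B] ip_diff[of A 0 "Rop C D B"] ip_diff[of A 0 0] by simp
  have "ip A (Rop C D B + Rop D B C + Rop B C D) = 0"
    using assms Rop_bianchi1[of C D B] ip_diff[of A 0 0] by simp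
  then show "Rm [A, B, C, D] + Rm [A, C, D, B] + Rm [A, D, B, C] = 0"
    using assms by (simp add: ip_add)
qed

text \<open>The formula for the derivative is linear in \<open>Rm\<close>, so the four algebraic
  symmetries are inherited. The last identity is the second Bianchi identity, from
  \<open>dRop_bianchi2\<close>.\<close>

lemma cov_Rm_symmetries:
  assumes "A \<in> Vf" "B \<in> Vf" "C \<in> Vf" "D \<in> Vf" "V \<in> Vf"
  shows "cov Rm [B, A, C, D, V] = - cov Rm [A, B, C, D, V]"
    "cov Rm [A, B, D, C, V] = - cov Rm [A, B, C, D, V]"
    "cov Rm [C, D, A, B, V] = cov Rm [A, B, C, D, V]"
    "cov Rm [A, B, C, D, V] + cov Rm [A, C, D, B, V] + cov Rm [A, D, B, C, V] = 0"
    "cov Rm [A, B, C, D, V] + cov Rm [A, B, D, V, C] + cov Rm [A, B, V, C, D] = 0"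
proof -
  have Fn: "Rm [A, B, C, D] \<in> Fn" if "A \<in> Vf" "B \<in> Vf" "C \<in> Vf" "D \<in> Vf" for A B C D
    using that by simp
  have m: "act V (- f) = - act V f" if "f \<in> Fn" for f
    using act_diff[of V 0 f] that assms by simp
  show "cov Rm [B, A, C, D, V] = - cov Rm [A, B, C, D, V]"
    unfolding cov_four using assms
    by (simp del: Rm_simp add: Rm_symmetries(1)[of A B] Rm_symmetries(1)[of "nab V A" B] Rm_symmetries(1)[of A "nab V B"] m Fn algebra_simps)
  show "cov Rm [A, B, D, C, V] = - cov Rm [A, B, C, D, V]"
    unfolding cov_four using assms
    by (simp del: Rm_simp add: Rm_symmetries(2)[of _ _ C D] Rm_symmetries(2)[of _ _ "nab V C" D] Rm_symmetries(2)[of _ _ C "nab V D"] m Fn algebra_simps)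
  show "cov Rm [C, D, A, B, V] = cov Rm [A, B, C, D, V]"
    unfolding cov_four using assms
    by (simp del: Rm_simp add: Rm_pair[of C] Rm_pair[of "nab V C"])
  have b: "Rm [A, D, B, C] = - Rm [A, B, C, D] - Rm [A, C, D, B]"
    if "A \<in> Vf" "B \<in> Vf" "C \<in> Vf" "D \<in> Vf" for A B C D
    using Rm_symmetries(3)[OF that] by (simp add: algebra_simps del: Rm_simp) (metis add.commute add.left_commute add_eq_0_iff minus_add_distrib)
  show "cov Rm [A, B, C, D, V] + cov Rm [A, C, D, B, V] + cov Rm [A, D, B, C, V] = 0"
    unfolding cov_four using assms
    by (simp del: Rm_simp add: b[of A B] b[of "nab V A" B] b[of A "nab V B"] b[of A B "nab V C"] b[of A B C "nab V D"] act_diff m Fn algebra_simps)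
  have "ip A (dRop V C D B + dRop C D V B + dRop D V C B) = ip A 0"
    using assms by (simp add: dRop_bianchi2)
  then show "cov Rm [A, B, C, D, V] + cov Rm [A, B, D, V, C] + cov Rm [A, B, V, C, D] = 0"
    using assms ip_diff[of A 0 0] by (simp add: cov_Rm ip_add algebra_simps)
qed

lemma contraction_tensor:
  assumes S: "tensor k S" and Xs: "Xs \<in> vfs k" and a: "a < k" and b: "b < k" and ne: "a \<noteq> b" and X: "X \<in> Vf"
  shows "(\<Sum>s\<in>UNIV. S (Xs[a := nab X (E s), b := E s]) + S (Xs[a := E s, b := nab X (E s)])) = 0"
proof (rule contraction_parallel[OF _ _ X, of "\<lambda>P Q. S (Xs[a := P, b := Q])"])
  fix P Q assume P: "P \<in> Vf" and Q: "Q \<in> Vf"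
  show "S (Xs[a := P, b := Q]) = (\<Sum>p\<in>UNIV. ip P (E p) * S (Xs[a := E p, b := Q]))"
    using tensor_expand[OF S _ a P, of "Xs[b := Q]"] Xs Q ne
    by (simp add: list_update_swap[OF ne])
  show "S (Xs[a := P, b := Q]) = (\<Sum>p\<in>UNIV. ip Q (E p) * S (Xs[a := P, b := E p]))"
    using tensor_expand[OF S _ b Q, of "Xs[a := P]"] Xs P by simp
qed

end

section \<open>The Weyl tensor of an Einstein metric\<close>

text \<open>\<open>kap\<close> is R/12: in dimension four Ric = (R/4)g = 3(R/12)g. The factor 3 is a
  sum because the ring type has no numerals.\<close>

locale einstein_calculus = frame_calculus Fn Vf act smul ip nab E un
  for Fn :: "'f::comm_ring set" and Vf :: "'v::ab_group_add set"
    and act :: "'v \<Rightarrow> 'f \<Rightarrow> 'f" and smul :: "'f \<Rightarrow> 'v \<Rightarrow> 'v" and ip :: "'v \<Rightarrow> 'v \<Rightarrow> 'f"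
    and nab :: "'v \<Rightarrow> 'v \<Rightarrow> 'v" and E :: "'n::finite \<Rightarrow> 'v" and un :: 'f +
  fixes kap :: 'f
  assumes kap_Fn [simp]: "kap \<in> Fn"
    and act_kap [simp]: "X \<in> Vf \<Longrightarrow> act X kap = 0"
    and ricci_einstein: "X \<in> Vf \<Longrightarrow> Y \<in> Vf \<Longrightarrow> (\<Sum>j\<in>UNIV. Rm [X, E j, Y, E j]) = (kap + kap + kap) * ip X Y"
begin

text \<open>For Ric = 3 \<open>kap\<close> g and R = 12 \<open>kap\<close> the Ricci part of the
  Weyl tensor contributes -3 \<open>kap\<close> and the scalar part 2 \<open>kap\<close>, which
  leaves - \<open>kap\<close> times the constant-curvature tensor.\<close>

definition W :: "'v list \<Rightarrow> 'f" where
  "W Xs = Rm Xs - kap * (ip (Xs ! 0) (Xs ! 2) * ip (Xs ! 1) (Xs ! 3) - ip (Xs ! 0) (Xs ! 3) * ip (Xs ! 1) (Xs ! 2))"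

lemma W_simp: "W [A, B, C, D] = Rm [A, B, C, D] - kap * (ip A C * ip B D - ip A D * ip B C)"
  by (simp add: W_def eval_nat_numeral)

lemma tensor_W: "tensor 4 W"
  by (rule tensor_four)
     (simp_all add: W_simp ip_add ip_add_left ip_smul ip_smul_left Rop_add Rop_add_left Rop_add_mid
        Rop_smul Rop_smul_left Rop_smul_mid algebra_simps)

lemma tensor_cov_W: "tensor 5 (cov W)" "tensor 6 (cov (cov W))" "tensor 7 (cov (cov (cov W)))"
  using tensor_cov[OF tensor_W] tensor_cov[OF tensor_cov[OF tensor_W]]
    tensor_cov[OF tensor_cov[OF tensor_cov[OF tensor_W]]] by simp_all

text \<open>\<open>kap\<close> is constant and the metric parallel, so the subtracted term has
  derivative zero.\<close>

lemma cov_W: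
  assumes "A \<in> Vf" "B \<in> Vf" "C \<in> Vf" "D \<in> Vf" "V \<in> Vf"
  shows "cov W [A, B, C, D, V] = cov Rm [A, B, C, D, V]"
  unfolding cov_four W_simp using assms
  by (simp add: act_diff act_mult metric) (simp add: algebra_simps)

lemma cov_W_symmetries:
  assumes "A \<in> Vf" "B \<in> Vf" "C \<in> Vf" "D \<in> Vf" "V \<in> Vf"
  shows "cov W [B, A, C, D, V] = - cov W [A, B, C, D, V]"
    "cov W [A, B, D, C, V] = - cov W [A, B, C, D, V]"
    "cov W [C, D, A, B, V] = cov W [A, B, C, D, V]"
    "cov W [A, B, C, D, V] + cov W [A, C, D, B, V] + cov W [A, D, B, C, V] = 0"
    "cov W [A, B, C, D, V] + cov W [A, B, D, V, C] + cov W [A, B, V, C, D] = 0"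
  using cov_Rm_symmetries[OF assms] assms by (simp_all add: cov_W)

text \<open>The trace of \<nabla>W = \<nabla>Rm is the derivative of Ric = 3 \<open>kap\<close> g,
  which is parallel.\<close>

lemma cov_W_trace:
  assumes X: "X \<in> Vf" and Y: "Y \<in> Vf" and V: "V \<in> Vf"
  shows "(\<Sum>j\<in>UNIV. cov W [X, E j, Y, E j, V]) = 0"
proof -
  have "(\<Sum>j\<in>UNIV. cov W [X, E j, Y, E j, V]) =
     act V (\<Sum>j\<in>UNIV. Rm [X, E j, Y, E j]) - (\<Sum>j\<in>UNIV. Rm [nab V X, E j, Y, E j])
     - (\<Sum>j\<in>UNIV. Rm [X, E j, nab V Y, E j])
     - (\<Sum>j\<in>UNIV. Rm [X, nab V (E j), Y, E j] + Rm [X, E j, Y, nab V (E j)])"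
    using assms by (simp add: cov_W) (simp add: cov_four act_sum sum_subtractf sum.distrib algebra_simps)
  \<comment> \<open>The entries at positions 1 and 3 of the list given to
    \<open>contraction_tensor\<close> are placeholders that the contraction overwrites.\<close>
  also have "(\<Sum>j\<in>UNIV. Rm [X, nab V (E j), Y, E j] + Rm [X, E j, Y, nab V (E j)]) = 0"
    using contraction_tensor[OF tensor_Rm, of "[X, X, Y, Y]" 1 3 V] assms
    by (simp add: vfs_four numeral_3_eq_3)
  also have "act V (\<Sum>j\<in>UNIV. Rm [X, E j, Y, E j]) = (kap + kap + kap) * act V (ip X Y)"
    using assms by (simp add: ricci_einstein act_mult act_add del: Rm_simp)
  finally show ?thesis
    using assms by (simp add: ricci_einstein metric algebra_simps del: Rm_simp)
qed

text \<open>The contracted second Bianchi identity: the divergence is a difference of two traces of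
  \<nabla>W, and these vanish by \<open>cov_W_trace\<close>.\<close>

lemma cov_W_divergence:
  assumes X: "X \<in> Vf" and Y: "Y \<in> Vf" and Z: "Z \<in> Vf"
  shows "(\<Sum>s\<in>UNIV. cov W [X, Y, E s, Z, E s]) = 0"
proof -
  have "cov W [X, Y, E s, Z, E s] = cov W [Z, E s, Y, E s, X] - cov W [Z, E s, X, E s, Y]" for s
  proof -
    have "cov W [X, Y, E s, Z, E s] = cov W [E s, Z, X, Y, E s]"
      using cov_W_symmetries(3)[of "E s" Z X Y "E s"] assms by simp
    moreover have "cov W [E s, Z, X, Y, E s] = - cov W [E s, Z, Y, E s, X] - cov W [E s, Z, E s, X, Y]"
      using cov_W_symmetries(5)[of "E s" Z X Y "E s"] assms by (intro sum_three_zeroD) simp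
    moreover have "cov W [E s, Z, Y, E s, X] = - cov W [Z, E s, Y, E s, X]"
      using cov_W_symmetries(1)[of Z "E s" Y "E s" X] assms by simp
    moreover have "cov W [E s, Z, E s, X, Y] = cov W [Z, E s, X, E s, Y]"
      using cov_W_symmetries(1)[of Z "E s" "E s" X Y] cov_W_symmetries(2)[of Z "E s" X "E s" Y] assms by simp
    ultimately show ?thesis
      by simp
  qed
  then show ?thesis
    using assms by (simp add: sum_subtractf cov_W_trace)
qed

text \<open>Differentiates \<open>cov_W_divergence\<close>: the corrections on the contracted slots
  cancel by \<open>contraction_tensor\<close>, those on the free slots are divergences
  again.\<close>

lemma cov_cov_W_divergence:
  assumes X: "X \<in> Vf" and Y: "Y \<in> Vf" and Z: "Z \<in> Vf" and A: "A \<in> Vf"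
  shows "(\<Sum>s\<in>UNIV. cov (cov W) [X, Y, E s, Z, E s, A]) = 0"
proof -
  have Fn: "cov W [X, Y, E s, Z, E s] \<in> Fn" for s
    using tensor_cov_W(1) assms by (intro tensor_Fn[of 5]) (auto simp: vfs_def)
  have "(\<Sum>s\<in>UNIV. cov (cov W) [X, Y, E s, Z, E s, A]) =
     act A (\<Sum>s\<in>UNIV. cov W [X, Y, E s, Z, E s]) - (\<Sum>s\<in>UNIV. cov W [nab A X, Y, E s, Z, E s])
     - (\<Sum>s\<in>UNIV. cov W [X, nab A Y, E s, Z, E s]) - (\<Sum>s\<in>UNIV. cov W [X, Y, E s, nab A Z, E s])
     - (\<Sum>s\<in>UNIV. cov W [X, Y, nab A (E s), Z, E s] + cov W [X, Y, E s, Z, nab A (E s)])"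
    using assms Fn unfolding cov_five[of "cov W"]
    by (simp add: act_sum sum_subtractf sum.distrib algebra_simps)
  also have "(\<Sum>s\<in>UNIV. cov W [X, Y, nab A (E s), Z, E s] + cov W [X, Y, E s, Z, nab A (E s)]) = 0"
    using contraction_tensor[OF tensor_cov_W(1), of "[X, Y, X, Z, X]" 2 4 A] assms
    by (simp add: vfs_def eval_nat_numeral)
  finally show ?thesis
    using assms by (simp add: cov_W_divergence)
qed

lemma cov_cov_cov_W_divergence:
  assumes X: "X \<in> Vf" and Y: "Y \<in> Vf" and Z: "Z \<in> Vf" and A: "A \<in> Vf" and B: "B \<in> Vf"
  shows "(\<Sum>s\<in>UNIV. cov (cov (cov W)) [X, Y, E s, Z, E s, A, B]) = 0"
proof -
  have Fn: "cov (cov W) [X, Y, E s, Z, E s, A] \<in> Fn" for s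
    using tensor_cov_W(2) assms by (intro tensor_Fn[of 6]) (auto simp: vfs_def)
  have "(\<Sum>s\<in>UNIV. cov (cov (cov W)) [X, Y, E s, Z, E s, A, B]) =
     act B (\<Sum>s\<in>UNIV. cov (cov W) [X, Y, E s, Z, E s, A]) - (\<Sum>s\<in>UNIV. cov (cov W) [nab B X, Y, E s, Z, E s, A])
     - (\<Sum>s\<in>UNIV. cov (cov W) [X, nab B Y, E s, Z, E s, A]) - (\<Sum>s\<in>UNIV. cov (cov W) [X, Y, E s, nab B Z, E s, A])
     - (\<Sum>s\<in>UNIV. cov (cov W) [X, Y, E s, Z, E s, nab B A])
     - (\<Sum>s\<in>UNIV. cov (cov W) [X, Y, nab B (E s), Z, E s, A] + cov (cov W) [X, Y, E s, Z, nab B (E s), A])"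
    using assms Fn unfolding cov_six[of "cov (cov W)"]
    by (simp add: act_sum sum_subtractf sum.distrib algebra_simps)
  also have "(\<Sum>s\<in>UNIV. cov (cov W) [X, Y, nab B (E s), Z, E s, A] + cov (cov W) [X, Y, E s, Z, nab B (E s), A]) = 0"
    using contraction_tensor[OF tensor_cov_W(2), of "[X, Y, X, Z, X, A]" 2 4 B] assms
    by (simp add: vfs_def eval_nat_numeral)
  finally show ?thesis
    using assms by (simp add: cov_cov_W_divergence)
qed

text \<open>The second Bianchi identity solved so that the derivative index moves into the third
  slot. One further exchange of derivatives then turns a trace over two derivative indices into
  divergences.\<close>

lemma cov_W_swap:
  assumes "A \<in> Vf" "B \<in> Vf" "C \<in> Vf" "D \<in> Vf" "V \<in> Vf"
  shows "cov W [A, B, C, D, V] = cov W [A, B, V, D, C] - cov W [A, B, V, C, D]"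
  using sum_three_zeroD[OF cov_W_symmetries(5)[of A B C D V]] cov_W_symmetries(2)[of A B D V C] assms
  by simp

lemma cov_cov_W_swap:
  assumes "A \<in> Vf" "B \<in> Vf" "C \<in> Vf" "D \<in> Vf" "V \<in> Vf" "X \<in> Vf"
  shows "cov (cov W) [A, B, C, D, V, X] = cov (cov W) [A, B, V, D, C, X] - cov (cov W) [A, B, V, C, D, X]"
proof -
  have Fn: "cov W [A, B, C, D, F] \<in> Fn" if "A \<in> Vf" "B \<in> Vf" "C \<in> Vf" "D \<in> Vf" "F \<in> Vf" for A B C D F
    using tensor_cov_W(1) that by (intro tensor_Fn[of 5]) (auto simp: vfs_def)
  show ?thesis
    using assms unfolding cov_five[of "cov W"]
    by (simp add: cov_W_swap[of _ _ C D V] cov_W_swap[of _ _ "nab X C" D V] cov_W_swap[of _ _ C "nab X D" V]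
       cov_W_swap[of _ _ C D "nab X V"] act_diff Fn algebra_simps)
qed

lemma cov_cov_cov_W_swap:
  assumes "A \<in> Vf" "B \<in> Vf" "C \<in> Vf" "D \<in> Vf" "V \<in> Vf" "X \<in> Vf" "Y \<in> Vf"
  shows "cov (cov (cov W)) [A, B, C, D, V, X, Y] =
    cov (cov (cov W)) [A, B, V, D, C, X, Y] - cov (cov (cov W)) [A, B, V, C, D, X, Y]"
proof -
  have Fn: "cov (cov W) [A, B, C, D, F, G] \<in> Fn"
    if "A \<in> Vf" "B \<in> Vf" "C \<in> Vf" "D \<in> Vf" "F \<in> Vf" "G \<in> Vf" for A B C D F G
    using tensor_cov_W(2) that by (intro tensor_Fn[of 6]) (auto simp: vfs_def)
  show ?thesis
    using assms unfolding cov_six[of "cov (cov W)"]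
    by (simp add: cov_cov_W_swap[of _ _ C D V] cov_cov_W_swap[of _ _ "nab Y C" D V] cov_cov_W_swap[of _ _ C "nab Y D" V]
       cov_cov_W_swap[of _ _ C D "nab Y V"] act_diff Fn algebra_simps)
qed

text \<open>Exchange of the outer two derivatives: the Ricci identity for the 5-tensor \<nabla>W,
  hence a term for the derivative slot \<open>F\<close> as well.\<close>

lemma cov_W_commute:
  assumes "A \<in> Vf" "B \<in> Vf" "C \<in> Vf" "D \<in> Vf" "F \<in> Vf" "Y \<in> Vf" "Z \<in> Vf"
  shows "cov (cov (cov W)) [A, B, C, D, F, Y, Z] - cov (cov (cov W)) [A, B, C, D, F, Z, Y] =
    (\<Sum>p\<in>UNIV. Rm [E p, A, Y, Z] * cov W [E p, B, C, D, F] + Rm [E p, B, Y, Z] * cov W [A, E p, C, D, F]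
      + Rm [E p, C, Y, Z] * cov W [A, B, E p, D, F] + Rm [E p, D, Y, Z] * cov W [A, B, C, E p, F]
      + Rm [E p, F, Y, Z] * cov W [A, B, C, D, E p])"
proof -
  let ?Xs = "[A, B, C, D, F]"
  have v: "?Xs \<in> vfs 5" using assms by (simp add: vfs_def)
  have x: "cov W (?Xs[i := Rop Y Z (?Xs ! i)]) = (\<Sum>p\<in>UNIV. Rm [E p, ?Xs ! i, Y, Z] * cov W (?Xs[i := E p]))" if "i < 5" for i
    using that assms v vfs_nth[OF v, of i]
    by (subst tensor_expand[OF tensor_cov_W(1) v]) (auto simp: ip_sym[of "Rop _ _ _"])
  have "cov (cov (cov W)) (?Xs @ [Y, Z]) - cov (cov (cov W)) (?Xs @ [Z, Y]) = (\<Sum>i<5. cov W (?Xs[i := Rop Y Z (?Xs ! i)]))"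
    using ricci_identity[OF tensor_cov_W(1) v] assms by simp
  also have "\<dots> = (\<Sum>i<5. \<Sum>p\<in>UNIV. Rm [E p, ?Xs ! i, Y, Z] * cov W (?Xs[i := E p]))"
    by (intro sum.cong refl x) simp
  finally show ?thesis
    by (simp add: eval_nat_numeral sum.distrib algebra_simps del: Rm_simp)
qed

text \<open>Exchange of the inner two derivatives: the differentiated Ricci identity for
  \<open>W\<close>. The derivative of the curvature is written \<open>cov W\<close>, which equals
  \<open>cov Rm\<close>.\<close>

lemma cov_cov_W_commute:
  assumes "A \<in> Vf" "B \<in> Vf" "C \<in> Vf" "D \<in> Vf" "Y \<in> Vf" "Z \<in> Vf" "V \<in> Vf"
  shows "cov (cov (cov W)) [A, B, C, D, Y, Z, V] - cov (cov (cov W)) [A, B, C, D, Z, Y, V] =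
    (\<Sum>p\<in>UNIV. cov W [E p, A, Y, Z, V] * W [E p, B, C, D] + Rm [E p, A, Y, Z] * cov W [E p, B, C, D, V]
      + cov W [E p, B, Y, Z, V] * W [A, E p, C, D] + Rm [E p, B, Y, Z] * cov W [A, E p, C, D, V]
      + cov W [E p, C, Y, Z, V] * W [A, B, E p, D] + Rm [E p, C, Y, Z] * cov W [A, B, E p, D, V]
      + cov W [E p, D, Y, Z, V] * W [A, B, C, E p] + Rm [E p, D, Y, Z] * cov W [A, B, C, E p, V])"
proof -
  let ?Xs = "[A, B, C, D]"
  have v: "?Xs \<in> vfs 4" using assms by (simp add: vfs_def)
  have x: "W (?Xs[i := dRop V Y Z (?Xs ! i)]) = (\<Sum>p\<in>UNIV. cov W [E p, ?Xs ! i, Y, Z, V] * W (?Xs[i := E p]))" if "i < 4" for i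
    using that assms v vfs_nth[OF v, of i]
    by (subst tensor_expand[OF tensor_W v]) (auto simp: ip_sym[of "dRop _ _ _ _"] cov_W cov_Rm)
  have y: "cov W (?Xs[i := Rop Y Z (?Xs ! i)] @ [V]) = (\<Sum>p\<in>UNIV. Rm [E p, ?Xs ! i, Y, Z] * cov W (?Xs[i := E p] @ [V]))" if "i < 4" for i
    using that assms v vfs_nth[OF v, of i] tensor_partial[of 4 "cov W" V] tensor_cov_W(1)
    by (subst tensor_expand[of 4 "\<lambda>Xs. cov W (Xs @ [V])"]) (auto simp: ip_sym[of "Rop _ _ _"])
  have "cov (cov (cov W)) (?Xs @ [Y, Z, V]) - cov (cov (cov W)) (?Xs @ [Z, Y, V]) =
      (\<Sum>i<4. W (?Xs[i := dRop V Y Z (?Xs ! i)]) + cov W (?Xs[i := Rop Y Z (?Xs ! i)] @ [V]))"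
    using cov_ricci_identity[OF tensor_W v] assms by simp
  also have "\<dots> = (\<Sum>i<4. (\<Sum>p\<in>UNIV. cov W [E p, ?Xs ! i, Y, Z, V] * W (?Xs[i := E p]))
      + (\<Sum>p\<in>UNIV. Rm [E p, ?Xs ! i, Y, Z] * cov W (?Xs[i := E p] @ [V])))"
    by (intro sum.cong refl) (simp only: x y lessThan_iff)
  finally show ?thesis
    by (simp add: eval_nat_numeral sum.distrib algebra_simps del: Rm_simp)
qed

end

section \<open>Contractions in dimension four\<close>

definition kron :: "'n \<Rightarrow> 'n \<Rightarrow> real" where
  "kron i j = (if i = j then 1 else 0)"

lemma kron_same [simp]: "kron i i = 1"
  by (simp add: kron_def)

lemma kron_sum [simp]:
  fixes f :: "'n::finite \<Rightarrow> real"
  shows "(\<Sum>j\<in>UNIV. kron i j * f j) = f i" "(\<Sum>j\<in>UNIV. kron j i * f j) = f i"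
proof -
  have "(\<Sum>j\<in>UNIV. kron i j * f j) = (\<Sum>j\<in>UNIV. if i = j then f j else 0)"
    "(\<Sum>j\<in>UNIV. kron j i * f j) = (\<Sum>j\<in>UNIV. if j = i then f j else 0)"
    by (intro sum.cong refl, simp add: kron_def)+
  then show "(\<Sum>j\<in>UNIV. kron i j * f j) = f i" "(\<Sum>j\<in>UNIV. kron j i * f j) = f i"
    by simp_all
qed

locale weyl_tensor =
  fixes w :: "'n::finite \<Rightarrow> 'n \<Rightarrow> 'n \<Rightarrow> 'n \<Rightarrow> real"
  assumes anti12: "w j i k l = - w i j k l"
    and anti34: "w i j l k = - w i j k l"
    and pair: "w k l i j = w i j k l"
    and bianchi1: "w i j k l + w i k l j + w i l j k = 0"
    and trace: "(\<Sum>j\<in>UNIV. w i j k j) = 0"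
begin

lemma diag [simp]: "w i i k l = 0" "w i j k k = 0"
  using anti12[of i i k l] anti34[of i j k k] by simp_all

text \<open>A multiple of \<open>W\<^bsub>ij\<^esub>\<^bsup>kl\<^esup> \<delta>\<^bsub>m\<^esub>\<^bsup>n\<^esup>\<close> antisymmetrised over \<open>i j m\<close> and over \<open>k l n\<close>. It vanishes because
  \<open>W\<close> is trace-free and the dimension is four.\<close>
definition dim4_tensor :: "'n \<Rightarrow> 'n \<Rightarrow> 'n \<Rightarrow> 'n \<Rightarrow> 'n \<Rightarrow> 'n \<Rightarrow> real" where
  "dim4_tensor i j m k l n =
     kron m n * w i j k l + kron m k * w i j l n + kron m l * w i j n k
   + kron i n * w j m k l + kron i k * w j m l n + kron i l * w j m n k
   + kron j n * w m i k l + kron j k * w m i l n + kron j l * w m i n k"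

text \<open>If \<open>k\<close>, \<open>l\<close>, \<open>n\<close> repeat an index, the sum cancels
  by skewness. If they are distinct and \<open>a\<close> is among them, it is up to sign an
  off-diagonal trace of \<open>w\<close>. Otherwise it is up to sign half of the combination tr(i) +
  tr(j) + tr(m) - tr(a) of the diagonal traces.\<close>

lemma dim4_tensor_distinct:
  assumes U: "UNIV = {i, j, m, a}" and d: "i \<noteq> j" "i \<noteq> m" "i \<noteq> a" "j \<noteq> m" "j \<noteq> a" "m \<noteq> a"
  shows "dim4_tensor i j m k l n = 0"
proof -
  have tr: "w x i y i + w x j y j + w x m y m + w x a y a = 0" for x y
    using trace[of x y] d unfolding U by (simp add: add.assoc)
  note first = anti12[of i j] anti12[of i m] anti12[of i a] anti12[of j m] anti12[of j a] anti12[of m a]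
  note second = anti34[of _ _ i j] anti34[of _ _ i m] anti34[of _ _ i a] anti34[of _ _ j m] anti34[of _ _ j a] anti34[of _ _ m a]
  note pairs = pair[of i m i j] pair[of i a i j] pair[of j m i j] pair[of j a i j] pair[of m a i j]
    pair[of i a i m] pair[of j m i m] pair[of j a i m] pair[of m a i m]
    pair[of j m i a] pair[of j a i a] pair[of m a i a] pair[of j a j m] pair[of m a j m] pair[of m a j a]
  \<comment> \<open>These rules order each index pair and then the two pairs, so that the trace
    conditions become linear equations between normalised components.\<close>
  note rules = first second pairs[symmetric]
  note trs = tr[of i i] tr[of j j] tr[of m m] tr[of a a] tr[of i j] tr[of i m] tr[of i a] tr[of j m] tr[of j a] tr[of m a]
  note trs' = trs[simplified rules diag, simplified]
  have kr: "kron i j = 0" "kron i m = 0" "kron i a = 0" "kron j i = 0" "kron j m = 0" "kron j a = 0"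
     "kron m i = 0" "kron m j = 0" "kron m a = 0"
    using d by (simp_all add: kron_def)
  have c: "x = i \<or> x = j \<or> x = m \<or> x = a" for x
    using U by blast
  show ?thesis
    using c[of k] c[of l] c[of n]
    unfolding dim4_tensor_def
    by (elim disjE; hypsubst; simp only: kr kron_same rules diag; (insert trs'; linarith)?)
qed

lemma dim4_tensor_zero:
  assumes "CARD('n) = 4"
  shows "dim4_tensor i j m k l n = 0"
proof (cases "i \<noteq> j \<and> i \<noteq> m \<and> j \<noteq> m")
  case True
  then have "card {i, j, m} = 3" by simp
  then have "{i, j, m} \<noteq> UNIV" using assms by force
  then obtain a where a: "a \<notin> {i, j, m}" by blast
  then have "card {i, j, m, a} = 4" using True by auto
  then have "UNIV = {i, j, m, a}" using assms card_subset_eq[of UNIV "{i, j, m, a}"] by simp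
  then show ?thesis using True a by (intro dim4_tensor_distinct) auto
next
  case False
  then consider "i = j" | "i = m" | "j = m" by blast
  then show ?thesis
  proof cases
    case 1
    then show ?thesis
      by (simp add: dim4_tensor_def anti12[of j m])
  next
    case 2
    then show ?thesis
      by (simp add: dim4_tensor_def anti12[of j m])
  next
    case 3
    then show ?thesis
      by (simp add: dim4_tensor_def anti12[of i m])
  qed
qed

text \<open>Contracts the vanishing tensor with \<open>G i j n * G k l m\<close>. Of its nine terms
  one gives the left side, four contain a trace of \<open>G\<close> and vanish, and the other four
  all equal the sum on the right after relabelling.\<close>

lemma dim4_contraction:
  fixes G :: "'n \<Rightarrow> 'n \<Rightarrow> 'n \<Rightarrow> real"
  assumes card: "CARD('n) = 4" and G: "\<And>i j k. G j i k = - G i j k" and tr: "\<And>j. (\<Sum>i\<in>UNIV. G i j i) = 0"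
  shows "(\<Sum>i\<in>UNIV. \<Sum>j\<in>UNIV. \<Sum>m\<in>UNIV. \<Sum>k\<in>UNIV. \<Sum>l\<in>UNIV. w i j k l * (G i j m * G k l m)) =
    - 4 * (\<Sum>i\<in>UNIV. \<Sum>j\<in>UNIV. \<Sum>m\<in>UNIV. \<Sum>l\<in>UNIV. \<Sum>n\<in>UNIV. w j m l n * (G i j n * G i l m))"
    (is "?A = - 4 * ?B")
proof -
  have tr': "(\<Sum>i\<in>UNIV. G j i i) = 0" for j
    using tr[of j] by (simp add: G[of _ j] sum_negf)
  define S where "S f = (\<Sum>i\<in>UNIV. \<Sum>j\<in>UNIV. \<Sum>m\<in>UNIV. \<Sum>k\<in>UNIV. \<Sum>l\<in>UNIV. \<Sum>n\<in>UNIV. f i j m k l n * (G i j n * G k l m))"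
    for f :: "'n \<Rightarrow> 'n \<Rightarrow> 'n \<Rightarrow> 'n \<Rightarrow> 'n \<Rightarrow> 'n \<Rightarrow> real"
  note S_simps = S_def mult.assoc sum_distrib_left[symmetric] kron_sum
  note tuple = sum.cartesian_product UNIV_Times_UNIV
  have mn: "S (\<lambda>i j m k l n. kron m n * w i j k l) = ?A"
    by (simp only: S_simps)
  have mk: "S (\<lambda>i j m k l n. kron m k * w i j l n) = 0"
  proof -
    have "S (\<lambda>i j m k l n. kron m k * w i j l n) =
       (\<Sum>i\<in>UNIV. \<Sum>j\<in>UNIV. \<Sum>m\<in>UNIV. \<Sum>l\<in>UNIV. \<Sum>n\<in>UNIV. w i j l n * (G i j n * G m l m))"
      by (simp only: S_simps)
    also have "\<dots> = (\<Sum>i\<in>UNIV. \<Sum>j\<in>UNIV. \<Sum>l\<in>UNIV. \<Sum>n\<in>UNIV. \<Sum>m\<in>UNIV. w i j l n * (G i j n * G m l m))"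
      unfolding tuple
      by (rule sum.reindex_bij_witness[of _ "\<lambda>(i, j, l, n, m). (i, j, m, l, n)" "\<lambda>(i, j, m, l, n). (i, j, l, n, m)"]) auto
    finally show ?thesis
      by (simp add: sum_distrib_left[symmetric] tr)
  qed
  have ml: "S (\<lambda>i j m k l n. kron m l * w i j n k) = 0"
  proof -
    have "S (\<lambda>i j m k l n. kron m l * w i j n k) =
       (\<Sum>i\<in>UNIV. \<Sum>j\<in>UNIV. \<Sum>m\<in>UNIV. \<Sum>k\<in>UNIV. \<Sum>n\<in>UNIV. w i j n k * (G i j n * G k m m))"
      by (simp only: S_simps)
    also have "\<dots> = (\<Sum>i\<in>UNIV. \<Sum>j\<in>UNIV. \<Sum>k\<in>UNIV. \<Sum>n\<in>UNIV. \<Sum>m\<in>UNIV. w i j n k * (G i j n * G k m m))"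
      unfolding tuple
      by (rule sum.reindex_bij_witness[of _ "\<lambda>(i, j, k, n, m). (i, j, m, k, n)" "\<lambda>(i, j, m, k, n). (i, j, k, n, m)"]) auto
    finally show ?thesis
      by (simp add: sum_distrib_left[symmetric] tr')
  qed
  have ni: "S (\<lambda>i j m k l n. kron i n * w j m k l) = 0"
  proof -
    have "S (\<lambda>i j m k l n. kron i n * w j m k l) =
       (\<Sum>i\<in>UNIV. \<Sum>j\<in>UNIV. \<Sum>m\<in>UNIV. \<Sum>k\<in>UNIV. \<Sum>l\<in>UNIV. w j m k l * (G k l m * G i j i))"
      by (simp only: S_simps) (simp only: mult_ac)
    also have "\<dots> = (\<Sum>j\<in>UNIV. \<Sum>m\<in>UNIV. \<Sum>k\<in>UNIV. \<Sum>l\<in>UNIV. \<Sum>i\<in>UNIV. w j m k l * (G k l m * G i j i))"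
      unfolding tuple
      by (rule sum.reindex_bij_witness[of _ "\<lambda>(j, m, k, l, i). (i, j, m, k, l)" "\<lambda>(i, j, m, k, l). (j, m, k, l, i)"]) auto
    finally show ?thesis
      by (simp add: sum_distrib_left[symmetric] tr)
  qed
  have jn: "S (\<lambda>i j m k l n. kron j n * w m i k l) = 0"
  proof -
    have "S (\<lambda>i j m k l n. kron j n * w m i k l) =
       (\<Sum>i\<in>UNIV. \<Sum>j\<in>UNIV. \<Sum>m\<in>UNIV. \<Sum>k\<in>UNIV. \<Sum>l\<in>UNIV. w m i k l * (G k l m * G i j j))"
      by (simp only: S_simps) (simp only: mult_ac)
    also have "\<dots> = (\<Sum>i\<in>UNIV. \<Sum>m\<in>UNIV. \<Sum>k\<in>UNIV. \<Sum>l\<in>UNIV. \<Sum>j\<in>UNIV. w m i k l * (G k l m * G i j j))"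
      unfolding tuple
      by (rule sum.reindex_bij_witness[of _ "\<lambda>(i, m, k, l, j). (i, j, m, k, l)" "\<lambda>(i, j, m, k, l). (i, m, k, l, j)"]) auto
    finally show ?thesis
      by (simp add: sum_distrib_left[symmetric] tr')
  qed
  have ik: "S (\<lambda>i j m k l n. kron i k * w j m l n) = ?B"
    by (simp only: S_simps)
  have il: "S (\<lambda>i j m k l n. kron i l * w j m n k) = ?B"
  proof -
    have "S (\<lambda>i j m k l n. kron i l * w j m n k) =
       (\<Sum>i\<in>UNIV. \<Sum>j\<in>UNIV. \<Sum>m\<in>UNIV. \<Sum>k\<in>UNIV. \<Sum>n\<in>UNIV. w j m n k * (G i j n * G k i m))"
      by (simp only: S_simps)
    also have "\<dots> = ?B"
    proof -
      have "w j m n k * (G i j n * G k i m) = w j m k n * (G i j n * G i k m)" for i j m k n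
        using anti34[of j m k n] G[of k i m] by simp
      then show ?thesis by (simp only:)
    qed
    finally show ?thesis .
  qed
  have jk: "S (\<lambda>i j m k l n. kron j k * w m i l n) = ?B"
  proof -
    have "S (\<lambda>i j m k l n. kron j k * w m i l n) =
       (\<Sum>i\<in>UNIV. \<Sum>j\<in>UNIV. \<Sum>m\<in>UNIV. \<Sum>l\<in>UNIV. \<Sum>n\<in>UNIV. w m i l n * (G i j n * G j l m))"
      by (simp only: S_simps)
    also have "\<dots> = ?B"
    proof -
      have "w m i l n * (G i j n * G j l m) = w i m l n * (G j i n * G j l m)" for i j m l n
        using anti12[of i m l n] G[of j i n] by simp
      then show ?thesis by (simp only:) (rule sum.swap)
    qed
    finally show ?thesis .
  qed
  have jl: "S (\<lambda>i j m k l n. kron j l * w m i n k) = ?B"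
  proof -
    have "S (\<lambda>i j m k l n. kron j l * w m i n k) =
       (\<Sum>i\<in>UNIV. \<Sum>j\<in>UNIV. \<Sum>m\<in>UNIV. \<Sum>k\<in>UNIV. \<Sum>n\<in>UNIV. w m i n k * (G i j n * G k j m))"
      by (simp only: S_simps)
    also have "\<dots> = ?B"
    proof -
      have "w m i n k * (G i j n * G k j m) = w i m k n * (G j i n * G j k m)" for i j m k n
        using anti12[of i m k n] anti34[of m i k n] G[of j i n] G[of k j m] by simp
      then show ?thesis by (simp only:) (rule sum.swap)
    qed
    finally show ?thesis .
  qed
  have "S dim4_tensor = 0"
    by (simp add: S_def dim4_tensor_zero[OF card])
  moreover have "S dim4_tensor = ?A + 4 * ?B"
    unfolding dim4_tensor_def[abs_def] 
    using mn mk ml ni jn ik il jk jl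
    by (simp add: S_def distrib_right sum.distrib)
  ultimately show ?thesis by simp
qed

end

text \<open>One sum over tuples, so that a renaming of indices is a single bijection for
  \<open>sum.reindex_bij_witness\<close>.\<close>

definition sum7 :: "('n::finite \<Rightarrow> 'n \<Rightarrow> 'n \<Rightarrow> 'n \<Rightarrow> 'n \<Rightarrow> 'n \<Rightarrow> 'n \<Rightarrow> real) \<Rightarrow> real" where
  "sum7 f = (\<Sum>(i, j, k, l, p, q, t)\<in>UNIV. f i j k l p q t)"

lemma sum7_nested:
  "sum7 f = (\<Sum>i\<in>UNIV. \<Sum>j\<in>UNIV. \<Sum>k\<in>UNIV. \<Sum>l\<in>UNIV. \<Sum>p\<in>UNIV. \<Sum>q\<in>UNIV. \<Sum>t\<in>UNIV. f i j k l p q t)"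
  by (simp add: sum7_def sum.cartesian_product)

lemma sum7_cong: "(\<And>i j k l p q t. f i j k l p q t = g i j k l p q t) \<Longrightarrow> sum7 f = sum7 g"
  by (simp add: sum7_def)

lemma sum7_add: "sum7 (\<lambda>i j k l p q t. f i j k l p q t + g i j k l p q t) = sum7 f + sum7 g"
  by (simp add: sum7_nested sum.distrib)

lemma sum7_diff: "sum7 (\<lambda>i j k l p q t. f i j k l p q t - g i j k l p q t) = sum7 f - sum7 g"
  by (simp add: sum7_nested sum_subtractf)

lemma sum7_minus: "sum7 (\<lambda>i j k l p q t. - f i j k l p q t) = - sum7 f"
  by (simp add: sum7_nested sum_negf)

section \<open>Cubic contractions of W with two copies of its derivative\<close>

locale weyl_derivative = weyl_tensor w for w :: "'n::finite \<Rightarrow> 'n \<Rightarrow> 'n \<Rightarrow> 'n \<Rightarrow> real" +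
  fixes T :: "'n \<Rightarrow> 'n \<Rightarrow> 'n \<Rightarrow> 'n \<Rightarrow> 'n \<Rightarrow> real"
  assumes card4: "CARD('n) = 4"
    and T_anti12: "T j i k l t = - T i j k l t"
    and T_anti34: "T i j l k t = - T i j k l t"
    and T_pair: "T k l i j t = T i j k l t"
    and T_bianchi1: "T i j k l t + T i k l j t + T i l j k t = 0"
    and T_bianchi2: "T i j k l t + T i j l t k + T i j t k l = 0"
    and T_trace: "(\<Sum>j\<in>UNIV. T i j k j t) = 0"
    and T_div: "(\<Sum>t\<in>UNIV. T i j t k t) = 0"
begin

lemma T_diag [simp]: "T i i k l t = 0" "T i j k k t = 0"
  using T_anti12[of i i k l t] T_anti34[of i j k k t] by simp_all

definition A :: real where
  "A = sum7 (\<lambda>i j k l p q t. w i j k l * T i j p q t * T k l p q t)"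

text \<open>\<open>dim4_contraction\<close> with \<open>G i j m = T i j m x t\<close> for fixed
  \<open>x\<close> and \<open>t\<close>; the trace of \<open>G\<close> is a trace of
  \<nabla>W.\<close>

lemma contraction1: "sum7 (\<lambda>i j m l n x t. w j m l n * T i j n x t * T i l m x t) = - A / 4"
proof -
  have tr: "(\<Sum>i\<in>UNIV. T i j i x t) = 0" for j x t
    using T_trace[of j x t] by (simp add: T_anti12[of j] T_anti34[of _ j _ x] sum_negf)
  have "A = (\<Sum>x\<in>UNIV. \<Sum>t\<in>UNIV. \<Sum>i\<in>UNIV. \<Sum>j\<in>UNIV. \<Sum>m\<in>UNIV. \<Sum>k\<in>UNIV. \<Sum>l\<in>UNIV.
      w i j k l * (T i j m x t * T k l m x t))"
    unfolding A_def sum7_nested sum.cartesian_product UNIV_Times_UNIV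
    by (rule sum.reindex_bij_witness[of _ "\<lambda>(x, t, i, j, m, k, l). (i, j, k, l, m, x, t)" "\<lambda>(i, j, k, l, m, x, t). (x, t, i, j, m, k, l)"]) auto
  also have "\<dots> = (\<Sum>x\<in>UNIV. \<Sum>t\<in>UNIV. - 4 * (\<Sum>i\<in>UNIV. \<Sum>j\<in>UNIV. \<Sum>m\<in>UNIV. \<Sum>l\<in>UNIV. \<Sum>n\<in>UNIV.
      w j m l n * (T i j n x t * T i l m x t)))"
    by (intro sum.cong refl, rule dim4_contraction[OF card4]) (rule T_anti12 tr)+
  also have "\<dots> = - 4 * sum7 (\<lambda>i j m l n x t. w j m l n * T i j n x t * T i l m x t)"
    unfolding sum7_nested sum_distrib_left[symmetric] sum.cartesian_product UNIV_Times_UNIV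
    by (intro arg_cong[of _ _ "\<lambda>x. - 4 * x"] sum.reindex_bij_witness[of _ "\<lambda>(i, j, m, l, n, x, t). (x, t, i, j, m, l, n)" "\<lambda>(x, t, i, j, m, l, n). (i, j, m, l, n, x, t)"]) auto
  finally show ?thesis by simp
qed

text \<open>\<open>dim4_contraction\<close> with \<open>G i j m = T i j u v m\<close>: the last slot
  of \<open>G\<close> is the derivative index, and its trace is a divergence.\<close>

lemma contraction2: "sum7 (\<lambda>i j m l n u v. w j m l n * T i j u v n * T i l u v m) = - A / 4"
proof -
  have tr: "(\<Sum>i\<in>UNIV. T i j u v i) = 0" for j u v
    using T_div[of u v j] by (simp add: T_pair[of u v])
  have "A = (\<Sum>u\<in>UNIV. \<Sum>v\<in>UNIV. \<Sum>i\<in>UNIV. \<Sum>j\<in>UNIV. \<Sum>m\<in>UNIV. \<Sum>k\<in>UNIV. \<Sum>l\<in>UNIV.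
      w i j k l * (T i j u v m * T k l u v m))"
    unfolding A_def sum7_nested sum.cartesian_product UNIV_Times_UNIV
    by (rule sum.reindex_bij_witness[of _ "\<lambda>(u, v, i, j, m, k, l). (i, j, k, l, u, v, m)" "\<lambda>(i, j, k, l, u, v, m). (u, v, i, j, m, k, l)"]) auto
  also have "\<dots> = (\<Sum>u\<in>UNIV. \<Sum>v\<in>UNIV. - 4 * (\<Sum>i\<in>UNIV. \<Sum>j\<in>UNIV. \<Sum>m\<in>UNIV. \<Sum>l\<in>UNIV. \<Sum>n\<in>UNIV.
      w j m l n * (T i j u v n * T i l u v m)))"
    by (intro sum.cong refl, rule dim4_contraction[OF card4]) (rule T_anti12 tr)+
  also have "\<dots> = - 4 * sum7 (\<lambda>i j m l n u v. w j m l n * T i j u v n * T i l u v m)"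
    unfolding sum7_nested sum_distrib_left[symmetric] sum.cartesian_product UNIV_Times_UNIV
    by (intro arg_cong[of _ _ "\<lambda>x. - 4 * x"] sum.reindex_bij_witness[of _ "\<lambda>(i, j, m, l, n, u, v). (u, v, i, j, m, l, n)" "\<lambda>(u, v, i, j, m, l, n). (i, j, m, l, n, u, v)"]) auto
  finally show ?thesis by simp
qed

text \<open>\<open>w j n m l\<close> is skew in \<open>j\<close>, \<open>n\<close> and in
  \<open>m\<close>, \<open>l\<close>, so only the skew parts of the two factors \<open>T\<close>
  count. The first Bianchi identity makes each skew part a single component of \<open>T\<close>, and
  the two halvings leave \<open>- A / 4\<close>.\<close>

lemma contraction3: "sum7 (\<lambda>i j m l n x t. w j n m l * T i j n x t * T i l m x t) = - A / 4"
    (is "?E = _")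
proof -
  have s1: "sum7 (\<lambda>i j m l n x t. w n j m l * T i n j x t * T i l m x t) = ?E"
    unfolding sum7_def
    by (rule sum.reindex_bij_witness[of _ "\<lambda>(i, n, m, l, j, x, t). (i, j, m, l, n, x, t)" "\<lambda>(i, n, m, l, j, x, t). (i, j, m, l, n, x, t)"]) auto
  have "2 * ?E = sum7 (\<lambda>i j m l n x t. w j n m l * T i j n x t * T i l m x t + w n j m l * T i n j x t * T i l m x t)"
    using s1 by (simp add: sum7_add)
  also have "\<dots> = sum7 (\<lambda>i j m l n x t. w j n m l * T x i j n t * T i l m x t)" (is "_ = ?F")
  proof (rule sum7_cong)
    fix i j m l n x t
    have "T i j n x t - T i n j x t = T x i j n t"
      using T_bianchi1[of x i j n t] T_pair[of i j n x t] T_pair[of i n j x t] T_anti12[of x n i j t] T_anti34[of x j n i t] T_anti12[of n x i j t] T_anti12[of j x i n t]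
        T_anti34[of x n i j t] T_anti12[of i j n x t] by linarith
    then have a: "T i j n x t = T i n j x t + T x i j n t"
      by simp
    show "w j n m l * T i j n x t * T i l m x t + w n j m l * T i n j x t * T i l m x t = w j n m l * T x i j n t * T i l m x t"
      using anti12[of j n m l] by (simp add: a algebra_simps)
  qed
  finally have E: "2 * ?E = ?F" .
  have s2: "sum7 (\<lambda>i j m l n x t. w j n l m * T x i j n t * T i m l x t) = ?F"
    unfolding sum7_def
    by (rule sum.reindex_bij_witness[of _ "\<lambda>(i, j, l, m, n, x, t). (i, j, m, l, n, x, t)" "\<lambda>(i, j, l, m, n, x, t). (i, j, m, l, n, x, t)"]) auto
  have "2 * ?F = sum7 (\<lambda>i j m l n x t. w j n m l * T x i j n t * T i l m x t + w j n l m * T x i j n t * T i m l x t)"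
    using s2 by (simp add: sum7_add)
  also have "\<dots> = sum7 (\<lambda>i j m l n x t. - (w j n l m * T j n x i t * T l m x i t))"
  proof (rule sum7_cong)
    fix i j m l n x t
    have "T i l m x t - T i m l x t = T x i l m t"
      using T_bianchi1[of x i l m t] T_pair[of i l m x t] T_pair[of i m l x t] T_anti12[of x m i l t] T_anti34[of x l m i t] T_anti12[of m x i l t] T_anti12[of l x i m t]
        T_anti34[of x m i l t] T_anti12[of i l m x t] by linarith
    then have a: "T i l m x t = T i m l x t + T l m x i t"
      using T_pair[of x i l m t] by simp
    show "w j n m l * T x i j n t * T i l m x t + w j n l m * T x i j n t * T i m l x t = - (w j n l m * T j n x i t * T l m x i t)"
      using anti34[of j n m l] T_pair[of x i j n t] by (simp add: a algebra_simps)
  qed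
  also have "\<dots> = - A"
    unfolding sum7_minus A_def sum7_def
    by (intro arg_cong[of _ _ uminus] sum.reindex_bij_witness[of _ "\<lambda>(j, n, l, m, x, i, t). (i, j, m, l, n, x, t)" "\<lambda>(i, j, m, l, n, x, t). (j, n, l, m, x, i, t)"]) auto
  finally show ?thesis using E by simp
qed

text \<open>The first Bianchi identity for \<open>w\<close> splits this into
  \<open>contraction1\<close> and \<open>contraction3\<close>, giving A/4 + A/4.\<close>

lemma cubic_B: "sum7 (\<lambda>i j m l n x t. w j l n m * T i j n x t * T i l m x t) = A / 2"
proof -
  have "sum7 (\<lambda>i j m l n x t. w j l n m * T i j n x t * T i l m x t) =
    sum7 (\<lambda>i j m l n x t. - (w j m l n * T i j n x t * T i l m x t) - w j n m l * T i j n x t * T i l m x t)"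
  proof (rule sum7_cong)
    fix i j m l n x t
    have "w j l n m = - w j m l n - w j n m l"
      using bianchi1[of j l n m] by simp
    then show "w j l n m * T i j n x t * T i l m x t = - (w j m l n * T i j n x t * T i l m x t) - w j n m l * T i j n x t * T i l m x t"
      by (simp only:) (simp add: algebra_simps)
  qed
  then show ?thesis
    by (simp add: sum7_diff sum7_minus contraction1 contraction3)
qed

text \<open>The device of \<open>contraction3\<close>, but the derivative index takes part in the
  skew pairs, so the second Bianchi identity evaluates the skew parts of \<open>T\<close>. The sum
  \<open>?E\<close> is A/4, and splitting \<open>w\<close> as before gives -A/4 - A/4.\<close>

lemma cubic_C: "sum7 (\<lambda>i j m l n u v. w l j n m * T i j u v n * T i l u v m) = - A / 2"
proof -
  let ?E = "sum7 (\<lambda>i j m l n u v. w l m j n * T i j u v n * T i l u v m)"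
  have b2: "T i j u v n - T i n u v j = - T j n u v i" for i j u v n
    using T_bianchi2[of u v i j n] T_pair[of i j u v n] T_pair[of i n u v j] T_pair[of j n u v i] T_anti34[of u v n i j]
    by linarith
  have s1: "sum7 (\<lambda>i j m l n u v. w l m n j * T i n u v j * T i l u v m) = ?E"
    unfolding sum7_def
    by (rule sum.reindex_bij_witness[of _ "\<lambda>(i, n, m, l, j, x, t). (i, j, m, l, n, x, t)" "\<lambda>(i, n, m, l, j, x, t). (i, j, m, l, n, x, t)"]) auto
  have "2 * ?E = sum7 (\<lambda>i j m l n u v. w l m j n * T i j u v n * T i l u v m + w l m n j * T i n u v j * T i l u v m)"
    using s1 by (simp add: sum7_add)
  also have "\<dots> = sum7 (\<lambda>i j m l n u v. - (w l m j n * T j n u v i * T i l u v m))" (is "_ = ?F")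
  proof (rule sum7_cong)
    fix i j m l n u v
    have a: "T i j u v n = T i n u v j - T j n u v i"
      using b2[of i j u v n] by simp
    show "w l m j n * T i j u v n * T i l u v m + w l m n j * T i n u v j * T i l u v m = - (w l m j n * T j n u v i * T i l u v m)"
      using anti34[of l m n j] by (simp add: a algebra_simps)
  qed
  finally have E: "2 * ?E = ?F" .
  have s2: "sum7 (\<lambda>i j m l n u v. - (w m l j n * T j n u v i * T i m u v l)) = ?F"
    unfolding sum7_def
    by (rule sum.reindex_bij_witness[of _ "\<lambda>(i, j, l, m, n, x, t). (i, j, m, l, n, x, t)" "\<lambda>(i, j, l, m, n, x, t). (i, j, m, l, n, x, t)"]) auto
  have "2 * ?F = sum7 (\<lambda>i j m l n u v. - (w l m j n * T j n u v i * T i l u v m) + - (w m l j n * T j n u v i * T i m u v l))"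
    using s2 by (simp only: sum7_add)
  also have "\<dots> = sum7 (\<lambda>i j m l n u v. w l m j n * T l m u v i * T j n u v i)"
  proof (rule sum7_cong)
    fix i j m l n u v
    have a: "T i l u v m = T i m u v l - T l m u v i"
      using b2[of i l u v m] by simp
    show "- (w l m j n * T j n u v i * T i l u v m) + - (w m l j n * T j n u v i * T i m u v l) = w l m j n * T l m u v i * T j n u v i"
      using anti12[of l m j n] by (simp add: a algebra_simps)
  qed
  also have "\<dots> = A"
    unfolding A_def sum7_def
    by (intro sum.reindex_bij_witness[of _ "\<lambda>(l, m, j, n, u, v, i). (i, j, m, l, n, u, v)" "\<lambda>(i, j, m, l, n, u, v). (l, m, j, n, u, v, i)"]) auto
  finally have EA: "?E = A / 4" using E by simp
  have "sum7 (\<lambda>i j m l n u v. w l j n m * T i j u v n * T i l u v m) =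
    sum7 (\<lambda>i j m l n u v. w j m l n * T i j u v n * T i l u v m - w l m j n * T i j u v n * T i l u v m)"
  proof (rule sum7_cong)
    fix i j m l n u v
    have "w l j n m = w j m l n - w l m j n"
      using bianchi1[of l j n m] pair[of l n j m] anti34[of l n j m] by simp
    then show "w l j n m * T i j u v n * T i l u v m = w j m l n * T i j u v n * T i l u v m - w l m j n * T i j u v n * T i l u v m"
      by (simp only:) (simp add: algebra_simps)
  qed
  then show ?thesis
    by (simp add: sum7_diff contraction2 EA)
qed

end

section \<open>The Laplacian of the derivative of W\<close>

locale weyl_third_derivative = weyl_derivative w T
  for w :: "'n::finite \<Rightarrow> 'n \<Rightarrow> 'n \<Rightarrow> 'n \<Rightarrow> real" and T :: "'n \<Rightarrow> 'n \<Rightarrow> 'n \<Rightarrow> 'n \<Rightarrow> 'n \<Rightarrow> real" +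
  fixes \<kappa> :: real and rm :: "'n \<Rightarrow> 'n \<Rightarrow> 'n \<Rightarrow> 'n \<Rightarrow> real"
    and K :: "'n \<Rightarrow> 'n \<Rightarrow> 'n \<Rightarrow> 'n \<Rightarrow> 'n \<Rightarrow> 'n \<Rightarrow> 'n \<Rightarrow> real"
  assumes rm: "rm a b c d = w a b c d + \<kappa> * (kron a c * kron b d - kron a d * kron b c)"
    and K_commute: "K a b c d f y z - K a b c d f z y =
      (\<Sum>p\<in>UNIV. rm p a y z * T p b c d f + rm p b y z * T a p c d f + rm p c y z * T a b p d f
        + rm p d y z * T a b c p f + rm p f y z * T a b c d p)"
    and K_commute': "K a b c d y z v - K a b c d z y v =
      (\<Sum>p\<in>UNIV. T p a y z v * w p b c d + rm p a y z * T p b c d v + T p b y z v * w a p c d + rm p b y z * T a p c d v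
        + T p c y z v * w a b p d + rm p c y z * T a b p d v + T p d y z v * w a b c p + rm p d y z * T a b c p v)"
    and K_div: "(\<Sum>s\<in>UNIV. K i j s k s a b) = 0"
    and K_swap: "K a b c d v x y = K a b v d c x y - K a b v c d x y"
begin

lemma T_div': "(\<Sum>s\<in>UNIV. T i j k s s) = 0"
  using T_div[of i j k] by (simp add: T_anti34[of i j k] sum_negf)

lemma T_div12: "(\<Sum>s\<in>UNIV. T s i j k s) = 0" "(\<Sum>s\<in>UNIV. T i s j k s) = 0"
  using T_div[of j k i] T_div'[of j k i] by (simp_all add: T_pair)

lemma T_trace': "(\<Sum>s\<in>UNIV. T s i s j t) = 0" "(\<Sum>s\<in>UNIV. T i s s j t) = 0" "(\<Sum>s\<in>UNIV. T s i j s t) = 0"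
proof -
  have "T i s s j t = - T i s j s t" "T s i j s t = - T i s j s t" "T s i s j t = T i s j s t" for s
    using T_anti34[of i s j s t] T_anti12[of i s j s t] T_anti12[of i s s j t] by simp_all
  then show "(\<Sum>s\<in>UNIV. T s i s j t) = 0" "(\<Sum>s\<in>UNIV. T i s s j t) = 0" "(\<Sum>s\<in>UNIV. T s i j s t) = 0"
    using T_trace[of i j t] by (simp_all add: sum_negf)
qed

lemma sum_rm:
  "(\<Sum>p\<in>UNIV. rm p a y z * X p) = (\<Sum>p\<in>UNIV. w p a y z * X p) + \<kappa> * (kron a z * X y - kron a y * X z)"
proof -
  have "(\<Sum>p\<in>UNIV. rm p a y z * X p) = (\<Sum>p\<in>UNIV. w p a y z * X p)
     + (\<kappa> * kron a z * (\<Sum>p\<in>UNIV. kron p y * X p) - \<kappa> * kron a y * (\<Sum>p\<in>UNIV. kron p z * X p))"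
    unfolding sum_distrib_left sum.distrib[symmetric] sum_subtractf[symmetric]
    by (intro sum.cong refl) (simp add: rm algebra_simps)
  then show ?thesis
    by (simp only: kron_sum right_diff_distrib mult.assoc)
qed

text \<open>The Weyl part is trace-free, and the constant-curvature part contributes 4 - 1, the
  dimension less one.\<close>

lemma ricci_rm: "(\<Sum>s\<in>UNIV. \<Sum>p\<in>UNIV. rm p s y s * X p) = 3 * \<kappa> * X y"
proof -
  have "(\<Sum>s\<in>UNIV. \<Sum>p\<in>UNIV. w p s y s * X p) = (\<Sum>p\<in>UNIV. (\<Sum>s\<in>UNIV. w p s y s) * X p)"
    by (subst sum.swap) (simp add: sum_distrib_right)
  then have z: "(\<Sum>s\<in>UNIV. \<Sum>p\<in>UNIV. w p s y s * X p) = 0"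
    by (simp add: trace)
  have "(\<Sum>s\<in>UNIV. \<kappa> * (kron s s * X y - kron s y * X s)) = \<kappa> * (4 * X y - X y)"
    by (simp add: sum_distrib_left[symmetric] sum_subtractf card4)
  then show ?thesis
    by (simp add: sum_rm sum.distrib z)
qed

definition sum5 :: "('n \<Rightarrow> 'n \<Rightarrow> 'n \<Rightarrow> 'n \<Rightarrow> 'n \<Rightarrow> real) \<Rightarrow> real" where
  "sum5 f = (\<Sum>(i, j, k, l, t)\<in>UNIV. f i j k l t)"

lemma sum5_nested: "sum5 f = (\<Sum>i\<in>UNIV. \<Sum>j\<in>UNIV. \<Sum>k\<in>UNIV. \<Sum>l\<in>UNIV. \<Sum>t\<in>UNIV. f i j k l t)"
  by (simp add: sum5_def sum.cartesian_product)

text \<open>The inner product with \<nabla>W. It sees only the part of \<open>X\<close> with the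
  symmetries of \<nabla>W, and \<open>pairing T\<close> is |\<nabla>W|^2.\<close>

definition pairing :: "('n \<Rightarrow> 'n \<Rightarrow> 'n \<Rightarrow> 'n \<Rightarrow> 'n \<Rightarrow> real) \<Rightarrow> real" where
  "pairing X = sum5 (\<lambda>i j k l t. T i j k l t * X i j k l t)"

lemma pairing_add: "pairing (\<lambda>i j k l t. X i j k l t + Y i j k l t) = pairing X + pairing Y"
  by (simp add: pairing_def sum5_nested distrib_left sum.distrib)

lemma pairing_diff: "pairing (\<lambda>i j k l t. X i j k l t - Y i j k l t) = pairing X - pairing Y"
  by (simp add: pairing_def sum5_nested right_diff_distrib sum_subtractf)

lemma pairing_scale: "pairing (\<lambda>i j k l t. c * X i j k l t) = c * pairing X"
  by (simp add: pairing_def sum5_nested sum_distrib_left mult.left_commute)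

lemma pairing_double_sum:
  "pairing (\<lambda>i j k l t. \<Sum>s\<in>UNIV. \<Sum>p\<in>UNIV. X i j k l t s p) = sum7 (\<lambda>i j k l t s p. T i j k l t * X i j k l t s p)"
  by (simp add: pairing_def sum5_nested sum7_nested sum_distrib_left)

text \<open>Renaming \<open>i\<close> and \<open>j\<close> changes the sign of both factors.\<close>

lemma pairing_swap12:
  assumes "\<And>i j k l t. Y j i k l t = - X i j k l t"
  shows "pairing Y = pairing X"
proof -
  have "sum5 (\<lambda>i j k l t. T i j k l t * Y i j k l t) = sum5 (\<lambda>i j k l t. T j i k l t * Y j i k l t)"
    unfolding sum5_def
    by (rule sum.reindex_bij_witness[of _ "\<lambda>(i, j, k, l, t). (j, i, k, l, t)" "\<lambda>(i, j, k, l, t). (j, i, k, l, t)"]) auto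
  also have "\<dots> = sum5 (\<lambda>i j k l t. T i j k l t * X i j k l t)"
  proof -
    have "T j i k l t * Y j i k l t = T i j k l t * X i j k l t" for i j k l t
      using T_anti12[of j i k l t] assms[where i = i and j = j and k = k and l = l and t = t] by simp
    then show ?thesis by simp
  qed
  finally show ?thesis by (simp add: pairing_def)
qed

lemma pairing_swap34: "pairing (\<lambda>i j k l t. X i j l k t) = - pairing X"
proof -
  have "sum5 (\<lambda>i j k l t. T i j k l t * X i j l k t) = sum5 (\<lambda>i j k l t. T i j l k t * X i j k l t)"
    unfolding sum5_def
    by (rule sum.reindex_bij_witness[of _ "\<lambda>(i, j, k, l, t). (i, j, l, k, t)" "\<lambda>(i, j, k, l, t). (i, j, l, k, t)"]) auto
  also have "\<dots> = sum5 (\<lambda>i j k l t. - (T i j k l t * X i j k l t))"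
  proof -
    have "T i j l k t * X i j k l t = - (T i j k l t * X i j k l t)" for i j k l t
      using T_anti34[of i j l k t] by simp
    then show ?thesis by (simp only:)
  qed
  finally show ?thesis by (simp add: pairing_def sum5_nested sum_negf)
qed

lemma pairing_pair:
  assumes "\<And>i j k l t. Y k l i j t = X i j k l t"
  shows "pairing Y = pairing X"
proof -
  have "sum5 (\<lambda>i j k l t. T i j k l t * Y i j k l t) = sum5 (\<lambda>i j k l t. T k l i j t * Y k l i j t)"
    unfolding sum5_def
    by (rule sum.reindex_bij_witness[of _ "\<lambda>(i, j, k, l, t). (k, l, i, j, t)" "\<lambda>(i, j, k, l, t). (k, l, i, j, t)"]) auto
  then show ?thesis by (simp add: pairing_def assms T_pair[of _ _ _ _])
qed

abbreviation norm2 :: real where "norm2 \<equiv> pairing T"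

text \<open>\<nabla>W is skew in \<open>i\<close>, \<open>j\<close>, so only the skew part of
  \<open>T t j k l i\<close> counts; by the second Bianchi identity that is half of
  \<open>T i j k l t\<close>.\<close>

lemma pairing_T_deriv: "pairing (\<lambda>i j k l t. T t j k l i) = norm2 / 2"
proof -
  have b: "T t j k l i - T t i k l j = T i j k l t" for i j k l t
    using T_bianchi2[of k l i j t] T_pair[of i j k l t] T_pair[of j t k l i] T_pair[of t i k l j] T_anti12[of j t k l i] by linarith
  have "pairing (\<lambda>i j k l t. - T t i k l j) = pairing (\<lambda>i j k l t. T t j k l i)"
    by (rule pairing_swap12) simp
  then have "2 * pairing (\<lambda>i j k l t. T t j k l i) = pairing (\<lambda>i j k l t. T t j k l i + - T t i k l j)"
    by (simp only: pairing_add)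
  also have "\<dots> = norm2"
    using b by (simp add: pairing_def)
  finally show ?thesis by simp
qed

text \<open>The argument of \<open>pairing_T_deriv\<close>, with the skew part now given by the
  first Bianchi identity.\<close>

lemma pairing_T_swap13: "pairing (\<lambda>i j k l t. T k j i l t) = norm2 / 2"
proof -
  have b: "T k j i l t - T k i j l t = T i j k l t" for i j k l t
    using T_bianchi1[of k j i l t] T_anti34[of k i j l t] T_pair[of j i k l t] T_anti12[of i j k l t]
    by linarith
  have "pairing (\<lambda>i j k l t. - T k i j l t) = pairing (\<lambda>i j k l t. T k j i l t)"
    by (rule pairing_swap12) simp
  then have "2 * pairing (\<lambda>i j k l t. T k j i l t) = pairing (\<lambda>i j k l t. T k j i l t + - T k i j l t)"
    by (simp only: pairing_add)
  also have "\<dots> = norm2"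
    using b by (simp add: pairing_def)
  finally show ?thesis by simp
qed

text \<open>The curvature acting on the first slot when the derivative indices \<open>t\<close> and
  \<open>s\<close> are exchanged; the other three slots of W follow from the symmetries of
  \<nabla>W.\<close>

definition commutator1 :: "'n \<Rightarrow> 'n \<Rightarrow> 'n \<Rightarrow> 'n \<Rightarrow> 'n \<Rightarrow> real" where
  "commutator1 i j k l t = (\<Sum>s\<in>UNIV. \<Sum>p\<in>UNIV. rm p i t s * T p j k l s)"

text \<open>The action on the first slot in the exchange from W_{ijsl,kst} to the divergence
  W_{ijsl,skt}. The third slot is contracted and yields a Ricci term instead.\<close>

definition commutator2 :: "'n \<Rightarrow> 'n \<Rightarrow> 'n \<Rightarrow> 'n \<Rightarrow> 'n \<Rightarrow> real" where
  "commutator2 i j k l t = (\<Sum>s\<in>UNIV. \<Sum>p\<in>UNIV. T p i k s t * w p j s l + rm p i k s * T p j s l t)"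

text \<open>The action on the fourth slot in the exchange of \<open>commutator2\<close>.\<close>

definition commutator3 :: "'n \<Rightarrow> 'n \<Rightarrow> 'n \<Rightarrow> 'n \<Rightarrow> 'n \<Rightarrow> real" where
  "commutator3 i j k l t = (\<Sum>s\<in>UNIV. \<Sum>p\<in>UNIV. T p l k s t * w i j s p + rm p l k s * T i j s p t)"

text \<open>The Weyl part is \<open>cubic_C\<close>. Of the two terms with \<kappa> one is a
  divergence and the other is \<open>pairing_T_deriv\<close>.\<close>

lemma pairing_commutator1: "pairing commutator1 = - A / 2 + \<kappa> * norm2 / 2"
proof -
  have "commutator1 i j k l t = (\<Sum>s\<in>UNIV. \<Sum>p\<in>UNIV. w p i t s * T p j k l s) + \<kappa> * T t j k l i" for i j k l t
  proof -
    have "(\<Sum>s\<in>UNIV. \<kappa> * (kron i s * T t j k l s - kron i t * T s j k l s)) = \<kappa> * T t j k l i"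
      by (simp add: sum_distrib_left[symmetric] sum_subtractf T_div12)
    then show ?thesis
      by (simp add: commutator1_def sum_rm sum.distrib)
  qed
  then have "pairing commutator1 = pairing (\<lambda>i j k l t. (\<Sum>s\<in>UNIV. \<Sum>p\<in>UNIV. w p i t s * T p j k l s) + \<kappa> * T t j k l i)"
    by (simp add: pairing_def)
  also have "\<dots> = sum7 (\<lambda>i j k l t s p. T i j k l t * (w p i t s * T p j k l s)) + \<kappa> * (norm2 / 2)"
    by (simp only: pairing_add pairing_scale pairing_double_sum pairing_T_deriv)
  also have "sum7 (\<lambda>i j k l t s p. T i j k l t * (w p i t s * T p j k l s)) =
      sum7 (\<lambda>i j k l t s p. w p i t s * T j i k l t * T j p k l s)"
  proof (rule sum7_cong)
    fix i j k l t s p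
    show "T i j k l t * (w p i t s * T p j k l s) = w p i t s * T j i k l t * T j p k l s"
      using T_anti12[of j i k l t] T_anti12[of j p k l s] by simp
  qed
  also have "\<dots> = sum7 (\<lambda>i j m l n u v. w l j n m * T i j u v n * T i l u v m)"
    unfolding sum7_def
    by (rule sum.reindex_bij_witness[of _ "\<lambda>(i, j, m, l, n, u, v). (j, i, u, v, n, m, l)" "\<lambda>(i, j, k, l, t, s, p). (j, i, s, p, t, k, l)"]) auto
  finally show ?thesis by (simp add: cubic_C)
qed

text \<open>Each of the two cubic parts is minus the sum of \<open>cubic_B\<close>. Of the two terms
  with \<kappa> one is a trace and the other is \<open>pairing_T_swap13\<close>.\<close>

lemma pairing_commutator2: "pairing commutator2 = - A + \<kappa> * norm2 / 2"
proof -
  have "commutator2 i j k l t = (\<Sum>s\<in>UNIV. \<Sum>p\<in>UNIV. T p i k s t * w p j s l)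
      + (\<Sum>s\<in>UNIV. \<Sum>p\<in>UNIV. w p i k s * T p j s l t) + \<kappa> * T k j i l t" for i j k l t
  proof -
    have "(\<Sum>s\<in>UNIV. \<kappa> * (kron i s * T k j s l t - kron i k * T s j s l t)) = \<kappa> * T k j i l t"
      by (simp add: sum_distrib_left[symmetric] sum_subtractf T_trace')
    then show ?thesis
      by (simp add: commutator2_def sum_rm sum.distrib)
  qed
  then have "pairing commutator2 = pairing (\<lambda>i j k l t. (\<Sum>s\<in>UNIV. \<Sum>p\<in>UNIV. T p i k s t * w p j s l)
      + (\<Sum>s\<in>UNIV. \<Sum>p\<in>UNIV. w p i k s * T p j s l t) + \<kappa> * T k j i l t)"
    by (simp add: pairing_def)
  also have "\<dots> = sum7 (\<lambda>i j k l t s p. T i j k l t * (T p i k s t * w p j s l))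
      + sum7 (\<lambda>i j k l t s p. T i j k l t * (w p i k s * T p j s l t)) + \<kappa> * (norm2 / 2)"
    by (simp only: pairing_add pairing_scale pairing_double_sum pairing_T_swap13)
  also have "sum7 (\<lambda>i j k l t s p. T i j k l t * (T p i k s t * w p j s l)) =
      sum7 (\<lambda>i j k l t s p. - (w j p l s * T i j l k t * T i p s k t))"
  proof (rule sum7_cong)
    fix i j k l t s p
    have "w p j s l = w j p l s" using anti12[of j p s l] anti34[of j p s l] by simp
    then show "T i j k l t * (T p i k s t * w p j s l) = - (w j p l s * T i j l k t * T i p s k t)"
      using T_anti34[of i j k l t] T_anti12[of i p k s t] T_anti34[of i p k s t] by simp
  qed
  also have "\<dots> = - sum7 (\<lambda>i j m l n x t. w j l n m * T i j n x t * T i l m x t)"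
    unfolding sum7_minus sum7_def
    by (intro arg_cong[of _ _ uminus] sum.reindex_bij_witness[of _ "\<lambda>(i, j, m, l, n, x, t). (i, j, x, n, t, m, l)" "\<lambda>(i, j, k, l, t, s, p). (i, j, s, p, l, k, t)"]) auto
  also have "sum7 (\<lambda>i j k l t s p. T i j k l t * (w p i k s * T p j s l t)) =
      sum7 (\<lambda>i j k l t s p. - (w i p k s * T j i k l t * T j p s l t))"
  proof (rule sum7_cong)
    fix i j k l t s p
    show "T i j k l t * (w p i k s * T p j s l t) = - (w i p k s * T j i k l t * T j p s l t)"
      using T_anti12[of j i k l t] anti12[of i p k s] T_anti12[of j p s l t] by simp
  qed
  also have "\<dots> = - sum7 (\<lambda>i j m l n x t. w j l n m * T i j n x t * T i l m x t)"
    unfolding sum7_minus sum7_def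
    by (intro arg_cong[of _ _ uminus] sum.reindex_bij_witness[of _ "\<lambda>(i, j, m, l, n, x, t). (j, i, n, x, t, m, l)" "\<lambda>(i, j, k, l, t, s, p). (j, i, s, p, k, l, t)"]) auto
  finally show ?thesis by (simp add: cubic_B)
qed

text \<open>In each cubic part one factor is skew in \<open>s\<close>, \<open>p\<close>, and a first
  Bianchi identity evaluates the skew part of the other: -A/2 twice.\<close>

lemma pairing_commutator3: "pairing commutator3 = - A - \<kappa> * norm2"
proof -
  have "commutator3 i j k l t = (\<Sum>s\<in>UNIV. \<Sum>p\<in>UNIV. T p l k s t * w i j s p)
      + (\<Sum>s\<in>UNIV. \<Sum>p\<in>UNIV. w p l k s * T i j s p t) + (- \<kappa>) * T i j k l t" for i j k l t
  proof -
    have "(\<Sum>s\<in>UNIV. \<kappa> * (kron l s * T i j s k t - kron l k * T i j s s t)) = (- \<kappa>) * T i j k l t"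
      by (simp add: sum_distrib_left[symmetric] T_anti34[of i j l k])
    then show ?thesis
      by (simp add: commutator3_def sum_rm sum.distrib)
  qed
  then have "pairing commutator3 = pairing (\<lambda>i j k l t. (\<Sum>s\<in>UNIV. \<Sum>p\<in>UNIV. T p l k s t * w i j s p)
      + (\<Sum>s\<in>UNIV. \<Sum>p\<in>UNIV. w p l k s * T i j s p t) + (- \<kappa>) * T i j k l t)"
    by (simp add: pairing_def)
  also have "\<dots> = sum7 (\<lambda>i j k l t s p. T i j k l t * (T p l k s t * w i j s p))
      + sum7 (\<lambda>i j k l t s p. T i j k l t * (w p l k s * T i j s p t)) + (- \<kappa>) * norm2" (is "_ = ?P + ?Q + _")
    by (simp only: pairing_add pairing_scale pairing_double_sum)
  also have "?P = - A / 2"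
  proof -
    have "sum7 (\<lambda>i j k l t s p. T i j k l t * (T s l k p t * w i j p s)) = ?P"
      unfolding sum7_def
      by (rule sum.reindex_bij_witness[of _ "\<lambda>(i, j, k, l, t, s, p). (i, j, k, l, t, p, s)" "\<lambda>(i, j, k, l, t, s, p). (i, j, k, l, t, p, s)"]) auto
    then have "2 * ?P = sum7 (\<lambda>i j k l t s p. T i j k l t * (T p l k s t * w i j s p) + T i j k l t * (T s l k p t * w i j p s))"
      by (simp add: sum7_add)
    also have "\<dots> = sum7 (\<lambda>i j k l t s p. - (w i j s p * T i j k l t * T s p k l t))"
    proof (rule sum7_cong)
      fix i j k l t s p
      have a: "T p l k s t = T s l k p t - T s p k l t"
        using T_bianchi1[of k s p l t] T_pair[of k s p l t] T_pair[of k p s l t] T_anti34[of k p s l t] T_pair[of k l s p t] by linarith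
      show "T i j k l t * (T p l k s t * w i j s p) + T i j k l t * (T s l k p t * w i j p s) = - (w i j s p * T i j k l t * T s p k l t)"
        using anti34[of i j s p] by (simp add: a algebra_simps)
    qed
    also have "\<dots> = - A"
      unfolding sum7_minus A_def sum7_def
      by (intro arg_cong[of _ _ uminus] sum.reindex_bij_witness[of _ "\<lambda>(i, j, s, p, k, l, t). (i, j, k, l, t, s, p)" "\<lambda>(i, j, k, l, t, s, p). (i, j, s, p, k, l, t)"]) auto
    finally show ?thesis by simp
  qed
  also have "?Q = - A / 2"
  proof -
    have "sum7 (\<lambda>i j k l t s p. T i j k l t * (w s l k p * T i j p s t)) = ?Q"
      unfolding sum7_def
      by (rule sum.reindex_bij_witness[of _ "\<lambda>(i, j, k, l, t, s, p). (i, j, k, l, t, p, s)" "\<lambda>(i, j, k, l, t, s, p). (i, j, k, l, t, p, s)"]) auto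
    then have "2 * ?Q = sum7 (\<lambda>i j k l t s p. T i j k l t * (w p l k s * T i j s p t) + T i j k l t * (w s l k p * T i j p s t))"
      by (simp add: sum7_add)
    also have "\<dots> = sum7 (\<lambda>i j k l t s p. - (w k l s p * T k l i j t * T s p i j t))"
    proof (rule sum7_cong)
      fix i j k l t s p
      have a: "w p l k s = w s l k p - w k l s p"
        using bianchi1[of k s p l] pair[of k s p l] pair[of k p s l] anti34[of k p s l] by linarith
      have "T k l i j t = T i j k l t" "T s p i j t = T i j s p t" "T i j p s t = - T i j s p t"
        by (rule T_pair, rule T_pair, rule T_anti34)
      then show "T i j k l t * (w p l k s * T i j s p t) + T i j k l t * (w s l k p * T i j p s t) = - (w k l s p * T k l i j t * T s p i j t)"
        by (simp only: a) (simp add: algebra_simps)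
    qed
    also have "\<dots> = - A"
      unfolding sum7_minus A_def sum7_def
      by (intro arg_cong[of _ _ uminus] sum.reindex_bij_witness[of _ "\<lambda>(k, l, s, p, i, j, t). (i, j, k, l, t, s, p)" "\<lambda>(i, j, k, l, t, s, p). (k, l, s, p, i, j, t)"]) auto
    finally show ?thesis by simp
  qed
  finally show ?thesis by simp
qed

text \<open>In indices: W_{ijkl,tss} goes to W_{ijkl,sts} and on to W_{ijkl,sst}, which by the
  second Bianchi identity is W_{ijsl,kst} - W_{ijsk,lst}; each of these is a divergence up to one
  more exchange. The first two exchanges produce the same \<open>commutator1\<close> terms, hence
  the 2, and each \<open>3 * \<kappa>\<close> comes from a Ricci contraction.\<close>

lemma K_trace:
  "(\<Sum>s\<in>UNIV. K i j k l t s s) =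
    2 * (commutator1 i j k l t - commutator1 j i k l t + commutator1 k l i j t - commutator1 l k i j t)
    + 3 * \<kappa> * T i j k l t
    + (commutator2 i j k l t - commutator2 j i k l t + commutator3 i j k l t + 3 * \<kappa> * T i j k l t)
    - (commutator2 i j l k t - commutator2 j i l k t + commutator3 i j l k t + 3 * \<kappa> * T i j l k t)"
proof -
  define M where "M = (\<Sum>s\<in>UNIV. \<Sum>p\<in>UNIV. rm p i t s * T p j k l s + rm p j t s * T i p k l s
     + rm p k t s * T i j p l s + rm p l t s * T i j k p s)"
  have M: "M = commutator1 i j k l t - commutator1 j i k l t + commutator1 k l i j t - commutator1 l k i j t"
  proof -
    have "rm p i t s * T p j k l s + rm p j t s * T i p k l s + rm p k t s * T i j p l s + rm p l t s * T i j k p s =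
      rm p i t s * T p j k l s - rm p j t s * T p i k l s + rm p k t s * T p l i j s - rm p l t s * T p k i j s" for p s
      using T_anti12[of p i k l s] T_pair[of p l i j s] T_pair[of p k i j s] T_anti34[of i j p k s] by simp
    then show ?thesis
      unfolding M_def commutator1_def by (simp only:) (simp only: sum.distrib sum_subtractf)
  qed
  have q: "(\<Sum>s\<in>UNIV. K i j s l k s t) = commutator2 i j k l t - commutator2 j i k l t + commutator3 i j k l t + 3 * \<kappa> * T i j k l t"
    for i j k l t
  proof -
    have "(\<Sum>s\<in>UNIV. K i j s l k s t) = (\<Sum>s\<in>UNIV. K i j s l k s t - K i j s l s k t)"
      by (simp add: sum_subtractf K_div)
    also have "\<dots> = (\<Sum>s\<in>UNIV. \<Sum>p\<in>UNIV. (T p i k s t * w p j s l + rm p i k s * T p j s l t)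
        - (T p j k s t * w p i s l + rm p j k s * T p i s l t)
        + T p s k s t * w i j p l + rm p s k s * T i j p l t + (T p l k s t * w i j s p + rm p l k s * T i j s p t))"
    proof (unfold K_commute', intro sum.cong refl)
      fix s p
      have "w i p s l = - w p i s l" "T i p s l t = - T p i s l t"
        by (rule anti12, rule T_anti12)
      then show "T p i k s t * w p j s l + rm p i k s * T p j s l t + T p j k s t * w i p s l + rm p j k s * T i p s l t
          + T p s k s t * w i j p l + rm p s k s * T i j p l t + T p l k s t * w i j s p + rm p l k s * T i j s p t =
         (T p i k s t * w p j s l + rm p i k s * T p j s l t)
        - (T p j k s t * w p i s l + rm p j k s * T p i s l t)
        + T p s k s t * w i j p l + rm p s k s * T i j p l t + (T p l k s t * w i j s p + rm p l k s * T i j s p t)"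
        by simp
    qed
    also have "\<dots> = commutator2 i j k l t - commutator2 j i k l t
        + (\<Sum>s\<in>UNIV. \<Sum>p\<in>UNIV. T p s k s t * w i j p l) + (\<Sum>s\<in>UNIV. \<Sum>p\<in>UNIV. rm p s k s * T i j p l t)
        + commutator3 i j k l t"
      unfolding commutator2_def commutator3_def sum.distrib[symmetric] sum_subtractf[symmetric] by (rule refl)
    also have "(\<Sum>s\<in>UNIV. \<Sum>p\<in>UNIV. T p s k s t * w i j p l) = 0"
      by (subst sum.swap) (simp add: sum_distrib_right[symmetric] T_trace)
    also have "(\<Sum>s\<in>UNIV. \<Sum>p\<in>UNIV. rm p s k s * T i j p l t) = 3 * \<kappa> * T i j k l t"
      by (rule ricci_rm)
    finally show ?thesis by simp
  qed
  have "(\<Sum>s\<in>UNIV. K i j k l t s s - K i j k l s t s) = M"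
  proof -
    \<comment> \<open>In this exchange the differentiated curvature occurs only through a divergence
      of W.\<close>
    have z: "(\<Sum>s\<in>UNIV. \<Sum>p\<in>UNIV. T p x t s s * f p) = 0" for x f
      by (subst sum.swap) (simp add: sum_distrib_right[symmetric] T_div')
    have "(\<Sum>s\<in>UNIV. K i j k l t s s - K i j k l s t s) = M
       + (\<Sum>s\<in>UNIV. \<Sum>p\<in>UNIV. T p i t s s * w p j k l) + (\<Sum>s\<in>UNIV. \<Sum>p\<in>UNIV. T p j t s s * w i p k l)
       + (\<Sum>s\<in>UNIV. \<Sum>p\<in>UNIV. T p k t s s * w i j p l) + (\<Sum>s\<in>UNIV. \<Sum>p\<in>UNIV. T p l t s s * w i j k p)"
      unfolding K_commute' M_def sum.distrib[symmetric]
      by (intro sum.cong refl) (simp only: add_ac)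
    then show ?thesis by (simp add: z)
  qed
  \<comment> \<open>Here the curvature also acts on the derivative slot \<open>s\<close>, whence the
    additional Ricci term.\<close>
  moreover have "(\<Sum>s\<in>UNIV. K i j k l s t s - K i j k l s s t) = M + 3 * \<kappa> * T i j k l t"
    unfolding K_commute sum.distrib[of _ "\<lambda>p. rm p _ _ _ * T i j k l p"] M_def
    by (simp only: sum.distrib ricci_rm)
  moreover have "(\<Sum>s\<in>UNIV. K i j k l s s t) = (\<Sum>s\<in>UNIV. K i j s l k s t - K i j s k l s t)"
    by (intro sum.cong refl) (rule K_swap)
  ultimately show ?thesis
    unfolding M[symmetric] sum_subtractf q by simp
qed

text \<open>The symmetries of \<nabla>W make the four \<open>commutator1\<close> terms contribute
  equally, and likewise the two halves related by \<open>k\<close>, \<open>l\<close>. The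
  coefficients are 13 = 8/2 + 3 + 2 * 3 and 10 = 8/2 + 2 * 3.\<close>

theorem pairing_K_trace:
  "pairing (\<lambda>i j k l t. \<Sum>s\<in>UNIV. K i j k l t s s) = 13 * \<kappa> * norm2 - 10 * A"
proof -
  have c1: "pairing (\<lambda>i j k l t. commutator1 j i k l t) = - pairing commutator1"
    using pairing_swap12[of "\<lambda>i j k l t. - commutator1 j i k l t" commutator1] pairing_scale[of "-1"] by simp
  have c2: "pairing (\<lambda>i j k l t. commutator1 k l i j t) = pairing commutator1"
    by (rule pairing_pair) simp
  have c3: "pairing (\<lambda>i j k l t. commutator1 l k i j t) = - pairing commutator1"
    using pairing_pair[of "\<lambda>i j k l t. commutator1 l k i j t" "\<lambda>i j k l t. commutator1 j i k l t"] c1 by simp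
  have c4: "pairing (\<lambda>i j k l t. commutator2 j i k l t) = - pairing commutator2"
    using pairing_swap12[of "\<lambda>i j k l t. - commutator2 j i k l t" commutator2] pairing_scale[of "-1"] by simp
  note lin = pairing_add pairing_diff pairing_scale mult.assoc
  define Q where "Q i j k l t = commutator2 i j k l t - commutator2 j i k l t + commutator3 i j k l t + 3 * (\<kappa> * T i j k l t)"
    for i j k l t
  have Q: "pairing Q = - 3 * A + 3 * \<kappa> * norm2"
    unfolding Q_def[abs_def] lin c4 pairing_commutator2 pairing_commutator3 by (simp add: algebra_simps)
  have "pairing (\<lambda>i j k l t. \<Sum>s\<in>UNIV. K i j k l t s s) =
    pairing (\<lambda>i j k l t. 2 * (commutator1 i j k l t - commutator1 j i k l t + commutator1 k l i j t - commutator1 l k i j t)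
      + 3 * (\<kappa> * T i j k l t) + Q i j k l t - Q i j l k t)"
    unfolding K_trace Q_def by (simp only: mult.assoc)
  also have "\<dots> = 2 * (4 * pairing commutator1) + 3 * (\<kappa> * norm2) + 2 * pairing Q"
    unfolding lin c1 c2 c3 pairing_swap34[of Q] by simp
  finally show ?thesis
    unfolding Q pairing_commutator1 by (simp add: algebra_simps)
qed

end

section \<open>Smooth functions and vector fields\<close>

text \<open>A derivative at \<open>x\<close> depends only on values near \<open>x\<close>, so on an
  open set the derivatives agree too and the induction goes through.\<close>

lemma Ck_on_cong:
  assumes "open S" "\<And>x. x \<in> S \<Longrightarrow> f x = g x" "Ck_on k S f"
  shows "Ck_on k S g"
  using assms(2,3)
proof (induction k arbitrary: f g)
  case 0
  then show ?case using continuous_on_cong[of S S f g] by simp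
next
  case (Suc k)
  have d: "(g has_derivative frechet_derivative f (at x)) (at x)" if "x \<in> S" for x
    by (rule has_derivative_transform_within_open[of f _ x UNIV S])
       (use Suc.prems assms(1) that in \<open>auto simp: frechet_derivative_works[symmetric]\<close>)
  then have "frechet_derivative g (at x) = frechet_derivative f (at x)" if "x \<in> S" for x
    using frechet_derivative_at[OF d[OF that]] by simp
  then have "Ck_on k S (\<lambda>x. frechet_derivative g (at x) v)" for v
    using Suc.prems(2) by (rule_tac Suc.IH[of "\<lambda>x. frechet_derivative f (at x) v"]) auto
  moreover have "\<forall>x\<in>S. g differentiable (at x)"
    using d by (auto simp: differentiable_def)
  ultimately show ?case by simp
qed

lemma Ck_on_subset: "Ck_on k S f \<Longrightarrow> S' \<subseteq> S \<Longrightarrow> Ck_on k S' f"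
  by (induction k arbitrary: f) (auto intro: continuous_on_subset)

text \<open>\<open>Ck_on (Suc k)\<close> does not contain \<open>Ck_on k\<close> by definition.
  Differentiability gives continuity in the base case, and the step passes to the
  derivatives.\<close>

lemma Ck_on_Suc_D: "Ck_on (Suc k) S f \<Longrightarrow> Ck_on k S f"
proof (induction k arbitrary: f)
  case 0
  then have "\<forall>x\<in>S. f differentiable (at x)" by simp
  then have "f differentiable_on S"
    by (simp add: differentiable_on_def differentiable_at_withinI)
  then show ?case by (simp add: differentiable_imp_continuous_on)
next
  case (Suc k)
  have "Ck_on (Suc k) S (\<lambda>x. frechet_derivative f (at x) v)" for v
    using Suc.prems by (subst (asm) Ck_on.simps(2)) blast
  then have "\<forall>v. Ck_on k S (\<lambda>x. frechet_derivative f (at x) v)"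
    using Suc.IH by blast
  moreover have "\<forall>x\<in>S. f differentiable (at x)"
    using Suc.prems by (subst (asm) Ck_on.simps(2)) blast
  ultimately show ?case by (subst Ck_on.simps(2)) blast
qed

lemma Ck_on_const: "Ck_on k S (\<lambda>_. c)"
  by (induction k arbitrary: c) auto

lemma Ck_on_add:
  fixes f g :: "'b::real_normed_vector \<Rightarrow> 'c::real_normed_vector"
  assumes "open S" "Ck_on k S f" "Ck_on k S g"
  shows "Ck_on k S (\<lambda>x. f x + g x)"
  using assms(2,3)
proof (induction k arbitrary: f g)
  case 0
  then show ?case by (simp add: continuous_on_add)
next
  case (Suc k)
  have d: "((\<lambda>x. f x + g x) has_derivative (\<lambda>v. frechet_derivative f (at x) v + frechet_derivative g (at x) v)) (at x)"
    if "x \<in> S" for x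
    using Suc.prems that by (intro has_derivative_add) (auto simp: frechet_derivative_works[symmetric])
  have "frechet_derivative (\<lambda>x. f x + g x) (at x) = (\<lambda>v. frechet_derivative f (at x) v + frechet_derivative g (at x) v)"
    if "x \<in> S" for x
    using frechet_derivative_at[OF d[OF that]] by simp
  then have e: "frechet_derivative (\<lambda>x. f x + g x) (at x) v = frechet_derivative f (at x) v + frechet_derivative g (at x) v" if "x \<in> S" for x v
    using that by simp
  have c: "Ck_on k S (\<lambda>x. frechet_derivative f (at x) v + frechet_derivative g (at x) v)" for v
    using Suc.prems by (rule_tac Suc.IH) auto
  have "Ck_on k S (\<lambda>x. frechet_derivative (\<lambda>x. f x + g x) (at x) v)" for v
    by (rule Ck_on_cong[OF assms(1) e[symmetric] c])
  then show ?case
    using d by (auto simp: differentiable_def)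
qed

text \<open>Each summand of the product rule keeps one undifferentiated factor;
  \<open>Ck_on_Suc_D\<close> lowers its order to fit the induction hypothesis.\<close>

lemma Ck_on_mult:
  fixes f g :: "'b::real_normed_vector \<Rightarrow> real"
  assumes "open S" "Ck_on k S f" "Ck_on k S g"
  shows "Ck_on k S (\<lambda>x. f x * g x)"
  using assms(2,3)
proof (induction k arbitrary: f g)
  case 0
  then show ?case by (simp add: continuous_on_mult)
next
  case (Suc k)
  have d: "((\<lambda>x. f x * g x) has_derivative (\<lambda>v. f x * frechet_derivative g (at x) v + frechet_derivative f (at x) v * g x)) (at x)"
    if "x \<in> S" for x
    using Suc.prems that by (intro has_derivative_mult) (auto simp: frechet_derivative_works[symmetric])
  have "frechet_derivative (\<lambda>x. f x * g x) (at x) = (\<lambda>v. f x * frechet_derivative g (at x) v + frechet_derivative f (at x) v * g x)"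
    if "x \<in> S" for x
    using frechet_derivative_at[OF d[OF that]] by simp
  then have e: "frechet_derivative (\<lambda>x. f x * g x) (at x) v = f x * frechet_derivative g (at x) v + frechet_derivative f (at x) v * g x" if "x \<in> S" for x v
    using that by simp
  have c: "Ck_on k S (\<lambda>x. f x * frechet_derivative g (at x) v + frechet_derivative f (at x) v * g x)" for v
  proof (rule Ck_on_add[OF assms(1)])
    show "Ck_on k S (\<lambda>x. f x * frechet_derivative g (at x) v)"
      using Suc.prems(2) by (intro Suc.IH[OF Ck_on_Suc_D[OF Suc.prems(1)]]) simp
    show "Ck_on k S (\<lambda>x. frechet_derivative f (at x) v * g x)"
      using Suc.prems(1) by (intro Suc.IH[OF _ Ck_on_Suc_D[OF Suc.prems(2)]]) simp
  qed
  have "Ck_on k S (\<lambda>x. frechet_derivative (\<lambda>x. f x * g x) (at x) v)" for v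
    by (rule Ck_on_cong[OF assms(1) e[symmetric] c])
  then show ?case
    using d by (auto simp: differentiable_def)
qed

section \<open>Smooth functions in charts\<close>

lemma chart_image_open:
  assumes M: "smooth_manifold M A" and c: "(V, \<phi>) \<in> A" and U: "openin M U"
  shows "open (\<phi> ` (U \<inter> V))"
proof -
  have V: "openin M V" "open (\<phi> ` V)" and h: "homeomorphic_map (subtopology M V) (top_of_set (\<phi> ` V)) \<phi>"
    using M c unfolding smooth_manifold_def by auto
  have "openin (subtopology M V) (U \<inter> V)"
    using U by (auto simp: openin_subtopology)
  then have "openin (top_of_set (\<phi> ` V)) (\<phi> ` (U \<inter> V))"
    using homeomorphic_imp_open_map[OF h] by (auto simp: open_map_def)
  then show ?thesis
    using V(2) openin_open_trans by blast
qed

lemma chart_inv: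
  assumes M: "smooth_manifold M A" and c: "(V, \<phi>) \<in> A" and x: "x \<in> \<phi> ` (U \<inter> V)"
  shows "inv_into V \<phi> x \<in> U \<inter> V"
proof -
  have V: "openin M V" and h: "homeomorphic_map (subtopology M V) (top_of_set (\<phi> ` V)) \<phi>"
    using M c unfolding smooth_manifold_def by auto
  have "inj_on \<phi> V"
    using homeomorphic_imp_injective_map[OF h] openin_subset[OF V] by (simp add: topspace_subtopology Int_absorb1)
  then show ?thesis using x by auto
qed

lemma smooth_fun_on_I:
  assumes "openin M U" "\<And>V \<phi> k. (V, \<phi>) \<in> A \<Longrightarrow> Ck_on k (\<phi> ` (U \<inter> V)) (f \<circ> inv_into V \<phi>)"
  shows "smooth_fun_on M A U f"
  using assms by (auto simp: smooth_fun_on_def smooth_on_def)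

lemma smooth_fun_on_D:
  assumes "smooth_fun_on M A U f"
  shows "openin M U" "(V, \<phi>) \<in> A \<Longrightarrow> Ck_on k (\<phi> ` (U \<inter> V)) (f \<circ> inv_into V \<phi>)"
  using assms by (auto simp: smooth_fun_on_def smooth_on_def)

lemma smooth_fun_on_cong:
  assumes M: "smooth_manifold M A" and f: "smooth_fun_on M A U f" and e: "\<And>x. x \<in> U \<Longrightarrow> f x = h x"
  shows "smooth_fun_on M A U h"
proof (rule smooth_fun_on_I)
  show "openin M U" using f by (rule smooth_fun_on_D)
  fix V \<phi> k assume c: "(V, \<phi>) \<in> A"
  show "Ck_on k (\<phi> ` (U \<inter> V)) (h \<circ> inv_into V \<phi>)"
    by (rule Ck_on_cong[OF chart_image_open[OF M c smooth_fun_on_D(1)[OF f]] _ smooth_fun_on_D(2)[OF f c]])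
       (use chart_inv[OF M c] e in auto)
qed

lemma smooth_fun_on_subset:
  "smooth_fun_on M A U f \<Longrightarrow> openin M V \<Longrightarrow> V \<subseteq> U \<Longrightarrow> smooth_fun_on M A V f"
  by (rule smooth_fun_on_I, assumption, rule Ck_on_subset, erule smooth_fun_on_D(2)) auto

lemma smooth_fun_on_const: "openin M U \<Longrightarrow> smooth_fun_on M A U (\<lambda>_. c)"
  by (rule smooth_fun_on_I) (auto simp: o_def Ck_on_const)

lemma smooth_fun_on_add:
  assumes M: "smooth_manifold M A" and f: "smooth_fun_on M A U f" and h: "smooth_fun_on M A U h"
  shows "smooth_fun_on M A U (\<lambda>x. f x + h x)"
proof (rule smooth_fun_on_I)
  show "openin M U" using f by (rule smooth_fun_on_D)
  fix V \<phi> k assume c: "(V, \<phi>) \<in> A"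
  show "Ck_on k (\<phi> ` (U \<inter> V)) ((\<lambda>x. f x + h x) \<circ> inv_into V \<phi>)"
    using Ck_on_add[OF chart_image_open[OF M c smooth_fun_on_D(1)[OF f]] smooth_fun_on_D(2)[OF f c] smooth_fun_on_D(2)[OF h c]]
    by (simp add: o_def)
qed

lemma smooth_fun_on_mult:
  assumes M: "smooth_manifold M A" and f: "smooth_fun_on M A U f" and h: "smooth_fun_on M A U h"
  shows "smooth_fun_on M A U (\<lambda>x. f x * h x)"
proof (rule smooth_fun_on_I)
  show "openin M U" using f by (rule smooth_fun_on_D)
  fix V \<phi> k assume c: "(V, \<phi>) \<in> A"
  show "Ck_on k (\<phi> ` (U \<inter> V)) ((\<lambda>x. f x * h x) \<circ> inv_into V \<phi>)"
    using Ck_on_mult[OF chart_image_open[OF M c smooth_fun_on_D(1)[OF f]] smooth_fun_on_D(2)[OF f c] smooth_fun_on_D(2)[OF h c]]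
    by (simp add: o_def)
qed

lemma smooth_nearI: "smooth_fun_on M A U f \<Longrightarrow> x \<in> U \<Longrightarrow> smooth_near M A x f"
  by (auto simp: smooth_near_def)

lemma smooth_near_scale:
  assumes M: "smooth_manifold M A" and f: "smooth_near M A x f"
  shows "smooth_near M A x (\<lambda>y. c * f y)"
proof -
  obtain U where U: "x \<in> U" "smooth_fun_on M A U f"
    using f unfolding smooth_near_def by blast
  have "smooth_fun_on M A U (\<lambda>y. c * f y)"
    by (rule smooth_fun_on_mult[OF M smooth_fun_on_const U(2)]) (rule smooth_fun_on_D(1)[OF U(2)])
  then show ?thesis using U(1) by (rule smooth_nearI)
qed

section \<open>Tangent vectors and vector fields\<close>

lemma tangent_spaceD:
  assumes "v \<in> tangent_space M A x"
  shows "smooth_near M A x f \<Longrightarrow> smooth_near M A x h \<Longrightarrow> v (\<lambda>y. f y + h y) = v f + v h"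
    "smooth_near M A x f \<Longrightarrow> smooth_near M A x h \<Longrightarrow> v (\<lambda>y. f y * h y) = v f * h x + f x * v h"
    "smooth_near M A x f \<Longrightarrow> v (\<lambda>y. c * f y) = c * v f"
    "smooth_near M A x f \<Longrightarrow> openin M U \<Longrightarrow> x \<in> U \<Longrightarrow> (\<And>y. y \<in> U \<Longrightarrow> f y = h y) \<Longrightarrow> v f = v h"
    "\<not> smooth_near M A x f \<Longrightarrow> v f = 0"
  using assms unfolding tangent_space_def mem_Collect_eq by meson+

lemma tangent_space_add:
  assumes u: "u \<in> tangent_space M A x" and v: "v \<in> tangent_space M A x"
  shows "(\<lambda>f. u f + v f) \<in> tangent_space M A x"
  unfolding tangent_space_def mem_Collect_eq
proof (intro conjI allI impI; (elim conjE)?)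
  fix f h assume "smooth_near M A x f" "smooth_near M A x h"
  then show "u (\<lambda>y. f y + h y) + v (\<lambda>y. f y + h y) = u f + v f + (u h + v h)"
    "u (\<lambda>y. f y * h y) + v (\<lambda>y. f y * h y) = (u f + v f) * h x + f x * (u h + v h)"
    by (simp_all add: tangent_spaceD(1,2)[OF u] tangent_spaceD(1,2)[OF v] algebra_simps)
next
  fix f c assume "smooth_near M A x f"
  then show "u (\<lambda>y. c * f y) + v (\<lambda>y. c * f y) = c * (u f + v f)"
    by (simp add: tangent_spaceD(3)[OF u] tangent_spaceD(3)[OF v] algebra_simps)
next
  fix f h U assume "smooth_near M A x f" "openin M U" "x \<in> U" "\<forall>y\<in>U. f y = h y"
  then show "u f + v f = u h + v h"
    using tangent_spaceD(4)[OF u, of f U h] tangent_spaceD(4)[OF v, of f U h] by simp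
next
  fix f assume "\<not> smooth_near M A x f"
  then show "u f + v f = 0"
    by (simp add: tangent_spaceD(5)[OF u] tangent_spaceD(5)[OF v])
qed

lemma tangent_space_scale:
  assumes u: "u \<in> tangent_space M A x"
  shows "(\<lambda>f. c * u f) \<in> tangent_space M A x"
  unfolding tangent_space_def mem_Collect_eq
proof (intro conjI allI impI; (elim conjE)?)
  fix f h assume "smooth_near M A x f" "smooth_near M A x h"
  then show "c * u (\<lambda>y. f y + h y) = c * u f + c * u h"
    "c * u (\<lambda>y. f y * h y) = c * u f * h x + f x * (c * u h)"
    by (simp_all add: tangent_spaceD(1,2)[OF u] algebra_simps)
next
  fix f d assume "smooth_near M A x f"
  then show "c * u (\<lambda>y. d * f y) = d * (c * u f)"
    by (simp add: tangent_spaceD(3)[OF u])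
next
  fix f h U assume "smooth_near M A x f" "openin M U" "x \<in> U" "\<forall>y\<in>U. f y = h y"
  then show "c * u f = c * u h"
    using tangent_spaceD(4)[OF u, of f U h] by simp
next
  fix f assume "\<not> smooth_near M A x f"
  then show "c * u f = 0"
    by (simp add: tangent_spaceD(5)[OF u])
qed

lemma tangent_space_zero: "(\<lambda>f. 0) \<in> tangent_space M A x"
  by (simp add: tangent_space_def)

lemma vector_field_on_add:
  assumes M: "smooth_manifold M A" and X: "vector_field_on M A U X" and Y: "vector_field_on M A U Y"
  shows "vector_field_on M A U (vf_add X Y)"
  using X Y smooth_fun_on_add[OF M]
  by (auto simp: vector_field_on_def vf_add_def intro!: tangent_space_add)

lemma vector_field_on_scale:
  assumes M: "smooth_manifold M A" and X: "vector_field_on M A U X" and u: "smooth_fun_on M A U u"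
  shows "vector_field_on M A U (vf_scale u X)"
  unfolding vector_field_on_def
proof (intro conjI ballI allI impI)
  show "openin M U" using X by (simp add: vector_field_on_def)
  show "vf_scale u X x \<in> tangent_space M A x" if "x \<in> U" for x
    using X that by (auto simp: vector_field_on_def vf_scale_def intro!: tangent_space_scale)
  show "smooth_fun_on M A V (\<lambda>x. vf_scale u X x f)" if "V \<subseteq> U \<and> smooth_fun_on M A V f" for V f
    using X that smooth_fun_on_mult[OF M smooth_fun_on_subset[OF u], of V "\<lambda>x. X x f"]
    by (auto simp: vector_field_on_def vf_scale_def dest: smooth_fun_on_D)
qed

lemma vector_field_on_cong:
  assumes M: "smooth_manifold M A" and X: "vector_field_on M A U X" and e: "\<And>x. x \<in> U \<Longrightarrow> X x = Y x"
  shows "vector_field_on M A U Y"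
  unfolding vector_field_on_def
proof (intro conjI ballI allI impI)
  show "openin M U" using X by (simp add: vector_field_on_def)
  show "Y x \<in> tangent_space M A x" if "x \<in> U" for x
    using X that e by (auto simp: vector_field_on_def)
  show "smooth_fun_on M A V (\<lambda>x. Y x f)" if "V \<subseteq> U \<and> smooth_fun_on M A V f" for V f
    by (rule smooth_fun_on_cong[OF M, of _ "\<lambda>x. X x f"]) (use X that e in \<open>auto simp: vector_field_on_def\<close>)
qed

text \<open>The product rule on 1 = 1 * 1 shows that \<open>v\<close> kills 1 and hence constants;
  \<open>v\<close> depends on the germ only.\<close>

lemma tangent_zero_fun:
  assumes M: "smooth_manifold M A" and v: "v \<in> tangent_space M A x" and U: "openin M U" "x \<in> U" and f: "\<And>y. y \<in> U \<Longrightarrow> f y = c"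
  shows "v f = 0"
proof -
  have s: "smooth_near M A x (\<lambda>_. d)" for d
    using smooth_nearI[OF smooth_fun_on_const[OF U(1)] U(2)] .
  have "v (\<lambda>_. 1 * 1) = v (\<lambda>_. 1) * 1 + 1 * v (\<lambda>_. 1)"
    by (rule tangent_spaceD(2)[OF v s s])
  then have "v (\<lambda>_. 1) = 0" by simp
  moreover have "v (\<lambda>_. c * 1) = c * v (\<lambda>_. 1)"
    by (rule tangent_spaceD(3)[OF v s])
  moreover have "v (\<lambda>_. c) = v f"
    by (rule tangent_spaceD(4)[OF v s U]) (simp add: f)
  ultimately show ?thesis by simp
qed

lemma tangent_diff:
  assumes M: "smooth_manifold M A" and v: "v \<in> tangent_space M A x" and f: "smooth_near M A x f" and h: "smooth_near M A x h"
  shows "v (\<lambda>y. f y - h y) = v f - v h"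
proof -
  have "v (\<lambda>y. f y + (-1) * h y) = v f + v (\<lambda>y. (-1) * h y)"
    by (rule tangent_spaceD(1)[OF v f smooth_near_scale[OF M h]])
  also have "v (\<lambda>y. (-1) * h y) = (-1) * v h"
    by (rule tangent_spaceD(3)[OF v h])
  finally show ?thesis by simp
qed

section \<open>The calculus of an orthonormal frame on a Riemannian manifold\<close>

locale riemannian_frame =
  fixes M :: "'a topology" and A :: "('a, 'n::finite) atlas" and g :: "'a metric_field"
    and D :: "'a connection" and U :: "'a set" and e :: "'n \<Rightarrow> 'a vfield"
  assumes riem: "riemannian_manifold M A g" and lc: "levi_civita M A g D" and frame: "orthonormal_frame_on M A g U e"
begin

lemma mfd: "smooth_manifold M A"
  using riem by (simp add: riemannian_manifold_def)

lemma U_open: "openin M U"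
  using frame by (simp add: orthonormal_frame_on_def)

abbreviation vf :: "'a vfield \<Rightarrow> bool" where "vf \<equiv> vector_field_on M A U"
abbreviation sf :: "('a \<Rightarrow> real) \<Rightarrow> bool" where "sf \<equiv> smooth_fun_on M A U"

lemma vf_tangent: "vf X \<Longrightarrow> x \<in> U \<Longrightarrow> X x \<in> tangent_space M A x"
  by (simp add: vector_field_on_def)

lemma vf_sf: "vf X \<Longrightarrow> sf f \<Longrightarrow> sf (\<lambda>x. X x f)"
  by (auto simp: vector_field_on_def)

lemma sf_near: "sf f \<Longrightarrow> x \<in> U \<Longrightarrow> smooth_near M A x f"
  by (rule smooth_nearI)

lemma vf_germ: "vf X \<Longrightarrow> x \<in> U \<Longrightarrow> sf f \<Longrightarrow> (\<And>y. y \<in> U \<Longrightarrow> f y = h y) \<Longrightarrow> X x f = X x h"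
  by (rule tangent_spaceD(4)[OF vf_tangent sf_near U_open]) auto

lemma vf_constant: "vf X \<Longrightarrow> x \<in> U \<Longrightarrow> (\<And>y. y \<in> U \<Longrightarrow> f y = c) \<Longrightarrow> X x f = 0"
  by (rule tangent_zero_fun[OF mfd vf_tangent U_open]) auto

lemma e_vf: "vf (e i)"
  using frame by (simp add: orthonormal_frame_on_def)

lemma D_vf: "vf X \<Longrightarrow> vf Y \<Longrightarrow> vf (D X Y)"
  using lc[unfolded levi_civita_def, rule_format, of U X Y X "\<lambda>_. 0"] smooth_fun_on_const[OF U_open, of A] by blast

lemma D_axioms:
  assumes "vf X" "vf Y" "vf Z" "sf u" "x \<in> U"
  shows "D (vf_add X Y) Z x = vf_add (D X Z) (D Y Z) x"
    "D (vf_scale u X) Y x = vf_scale u (D X Y) x"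
    "D X (vf_add Y Z) x = vf_add (D X Y) (D X Z) x"
    "D X (vf_scale u Y) x = vf_add (vf_scale u (D X Y)) (vf_scale (\<lambda>y. X y u) Y) x"
    "(\<lambda>f. D X Y x f - D Y X x f) = lie_bracket M A X Y x"
    "X x (\<lambda>y. g y (Y y) (Z y)) = g x (D X Y x) (Z x) + g x (Y x) (D X Z x)"
  using lc[unfolded levi_civita_def, rule_format, of U X Y Z u] assms by blast+

lemma g_axioms:
  assumes "x \<in> U" "u \<in> tangent_space M A x" "v \<in> tangent_space M A x" "w \<in> tangent_space M A x"
  shows "g x u v = g x v u" "g x (\<lambda>f. u f + v f) w = g x u w + g x v w"
    "g x (\<lambda>f. c * u f) v = c * g x u v" "u \<noteq> (\<lambda>f. 0) \<Longrightarrow> g x u u > 0"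
proof -
  have "x \<in> topspace M" using assms(1) openin_subset[OF U_open] by blast
  moreover have "riemannian_metric M A g" using riem by (simp add: riemannian_manifold_def)
  ultimately show "g x u v = g x v u" "g x (\<lambda>f. u f + v f) w = g x u w + g x v w"
    "g x (\<lambda>f. c * u f) v = c * g x u v" "u \<noteq> (\<lambda>f. 0) \<Longrightarrow> g x u u > 0"
    using assms(2-) unfolding riemannian_metric_def by blast+
qed

lemma g_smooth: "vf X \<Longrightarrow> vf Y \<Longrightarrow> sf (\<lambda>x. g x (X x) (Y x))"
  using riem unfolding riemannian_manifold_def riemannian_metric_def by blast

lemma g_zero:
  assumes "x \<in> U" "v \<in> tangent_space M A x"
  shows "g x (\<lambda>f. 0) v = 0"
  using g_axioms(3)[OF assms(1) tangent_space_zero assms(2) assms(2), of 0] by simp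

text \<open>\<open>N\<close> vanishes on \<open>U\<close> only and cannot be identified with the
  zero field. Metric compatibility, tested against \<open>D Y N\<close> itself, shows that
  \<open>D Y N\<close> has length zero; the other order follows from torsion-freeness.\<close>

lemma D_zero:
  assumes N: "vf N" "\<And>x f. x \<in> U \<Longrightarrow> N x f = 0" and Y: "vf Y" and x: "x \<in> U"
  shows "D Y N x = (\<lambda>f. 0)" "D N Y x = (\<lambda>f. 0)"
proof -
  have N0: "N y = (\<lambda>f. 0)" if "y \<in> U" for y using N(2)[OF that] by (rule ext)
  let ?Z = "D Y N"
  have Z: "vf ?Z" using N(1) Y by (simp add: D_vf)
  have t: "?Z y \<in> tangent_space M A y" "D Y ?Z y \<in> tangent_space M A y" if "y \<in> U" for y
    using that Z Y by (auto intro: vf_tangent D_vf)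
  have "Y x (\<lambda>y. g y (N y) (?Z y)) = g x (D Y N x) (?Z x) + g x (N x) (D Y ?Z x)"
    by (rule D_axioms(6)[OF Y N(1) Z smooth_fun_on_const[OF U_open, of A 0] x])
  moreover have "Y x (\<lambda>y. g y (N y) (?Z y)) = 0"
    by (rule vf_constant[OF Y x, of _ 0]) (simp add: N0 g_zero t)
  moreover have "g x (N x) (D Y ?Z x) = 0"
    using x by (simp add: N0 g_zero t)
  ultimately have "g x (D Y N x) (D Y N x) = 0" by simp
  then show z: "D Y N x = (\<lambda>f. 0)"
    using g_axioms(4)[OF x t(1)[OF x] t(1)[OF x] t(1)[OF x]] by fastforce
  have b: "lie_bracket M A N Y x = (\<lambda>f. 0)"
  proof
    fix f
    have "Y x (\<lambda>y. N y f) = 0" by (rule vf_constant[OF Y x, of _ 0]) (simp add: N)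
    then show "lie_bracket M A N Y x f = 0" using x by (simp add: lie_bracket_def N)
  qed
  have "(\<lambda>f. D N Y x f - D Y N x f) = lie_bracket M A N Y x"
    by (rule D_axioms(5)[OF N(1) Y Y smooth_fun_on_const[OF U_open, of A 0] x])
  then show "D N Y x = (\<lambda>f. 0)"
    unfolding b z by (simp add: fun_eq_iff)
qed

text \<open>\<open>X'\<close> equals, as a total function, \<open>X\<close> plus a field that
  vanishes on \<open>U\<close>; additivity and \<open>D_zero\<close> remove the difference.\<close>

lemma D_local:
  assumes X: "vf X" and Y: "vf Y" and eX: "\<And>x. x \<in> U \<Longrightarrow> X x = X' x" and eY: "\<And>x. x \<in> U \<Longrightarrow> Y x = Y' x" and x: "x \<in> U"
  shows "D X Y x = D X' Y' x"
proof -
  note c = smooth_fun_on_const[OF U_open, of A]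
  have X': "vf X'" and Y': "vf Y'"
    using vector_field_on_cong[OF mfd X eX] vector_field_on_cong[OF mfd Y eY] by auto
  have d: "vf (vf_add P (vf_scale (\<lambda>_. -1) Q))" if "vf P" "vf Q" for P Q
    using that c by (intro vector_field_on_add vector_field_on_scale mfd)
  let ?N = "vf_add X' (vf_scale (\<lambda>_. -1) X)" and ?K = "vf_add Y' (vf_scale (\<lambda>_. -1) Y)"
  have N: "vf ?N" "\<And>x f. x \<in> U \<Longrightarrow> ?N x f = 0" and K: "vf ?K" "\<And>x f. x \<in> U \<Longrightarrow> ?K x f = 0"
    using d X X' Y Y' eX eY by (simp_all add: vf_add_def vf_scale_def)
  have "X' = vf_add X ?N" "Y' = vf_add Y ?K"
    by (simp_all add: vf_add_def vf_scale_def fun_eq_iff)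
  then have "D X' Y' x = vf_add (D X Y') (D ?N Y') x"
    using D_axioms(1)[OF X N(1) Y' c[of 0] x] by simp
  also have "\<dots> = D X Y' x"
    using D_zero(2)[OF N Y' x] by (simp add: vf_add_def)
  also have "\<dots> = vf_add (D X Y) (D X ?K) x"
    using D_axioms(3)[OF X Y K(1) c[of 0] x] \<open>Y' = vf_add Y ?K\<close> by simp
  also have "\<dots> = D X Y x"
    using D_zero(1)[OF K X x] by (simp add: vf_add_def)
  finally show ?thesis by simp
qed

definition restr :: "'a vfield \<Rightarrow> 'a vfield" where
  "restr X = (\<lambda>x f. if x \<in> U then X x f else 0)"

lemma restr_in: "x \<in> U \<Longrightarrow> restr X x = X x"
  by (simp add: restr_def)

lemma restr_vf: "vf X \<Longrightarrow> vf (restr X)"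
  by (erule vector_field_on_cong[OF mfd]) (simp add: restr_in)

definition Fn :: "('a \<Rightarrow> real) set" where
  "Fn = {f. sf f \<and> (\<forall>x. x \<notin> U \<longrightarrow> f x = 0)}"

definition Vf :: "'a vfield set" where
  "Vf = {X. vf X \<and> (\<forall>x f. x \<notin> U \<longrightarrow> X x f = 0)}"

definition ip :: "'a vfield \<Rightarrow> 'a vfield \<Rightarrow> 'a \<Rightarrow> real" where
  "ip X Y = (\<lambda>x. if x \<in> U then g x (X x) (Y x) else 0)"

definition nab :: "'a vfield \<Rightarrow> 'a vfield \<Rightarrow> 'a vfield" where
  "nab X Y = restr (D X Y)"

definition const_on :: "real \<Rightarrow> 'a \<Rightarrow> real" where
  "const_on c = (\<lambda>x. if x \<in> U then c else 0)"

lemma const_on_Fn: "const_on c \<in> Fn"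
  using smooth_fun_on_cong[OF mfd smooth_fun_on_const[OF U_open], of c "const_on c"]
  by (simp add: Fn_def const_on_def)

lemma vf_add_eq: "vf_add X Y = X + Y"
  by (simp add: vf_add_def fun_eq_iff)

lemma Vf_restr: "vf X \<Longrightarrow> restr X \<in> Vf"
  using restr_vf by (simp add: Vf_def restr_def)

lemma nab_in_Vf: "X \<in> Vf \<Longrightarrow> Y \<in> Vf \<Longrightarrow> nab X Y \<in> Vf"
  unfolding nab_def by (intro Vf_restr D_vf) (simp_all add: Vf_def)

lemma nab_restr: "vf X \<Longrightarrow> vf Y \<Longrightarrow> nab (restr X) (restr Y) = restr (D X Y)"
  using D_local[of X Y "restr X" "restr Y"]
  by (auto simp: nab_def restr_in fun_eq_iff restr_def[of "D _ _"])

text \<open>Stated for \<open>f\<close> smooth near \<open>x\<close> rather than on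
  \<open>U\<close>, because equality of tangent vectors has to be tested on all germs.\<close>

lemma commutator_apply:
  assumes X: "X \<in> Vf" and Y: "Y \<in> Vf" and x: "x \<in> U" and f: "smooth_near M A x f"
  shows "(nab X Y - nab Y X) x f = X x (\<lambda>y. Y y f) - Y x (\<lambda>y. X y f)"
proof -
  have "(\<lambda>f. D X Y x f - D Y X x f) = lie_bracket M A X Y x"
    using X Y x by (intro D_axioms(5)[OF _ _ _ smooth_fun_on_const[OF U_open, of A 0], of X Y X]) (simp_all add: Vf_def)
  then show ?thesis
    using x f by (simp add: nab_def restr_in lie_bracket_def fun_eq_iff)
qed

text \<open>Equality of fields is tested at every point \<open>x\<close> and every function
  \<open>f\<close>. If \<open>f\<close> is not smooth near \<open>x\<close>, tangent vectors at
  \<open>x\<close> return 0. Otherwise the brackets expand into iterated derivatives, which cancel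
  in the cyclic sum.\<close>

lemma jacobi_identity:
  assumes X: "X \<in> Vf" and Y: "Y \<in> Vf" and Z: "Z \<in> Vf"
  shows "(nab X (nab Y Z - nab Z Y) - nab (nab Y Z - nab Z Y) X)
      + (nab Y (nab Z X - nab X Z) - nab (nab Z X - nab X Z) Y)
      + (nab Z (nab X Y - nab Y X) - nab (nab X Y - nab Y X) Z) = 0"
proof -
  define b where "b P Q = nab P Q - nab Q P" for P Q
  have nout: "nab P Q x f = 0" if "x \<notin> U" for P Q x f
    using that by (simp add: nab_def restr_def)
  have bVf: "b P Q \<in> Vf" if "P \<in> Vf" "Q \<in> Vf" for P Q
  proof -
    have n: "vf (nab P Q)" "vf (nab Q P)"
      using nab_in_Vf that by (auto simp: Vf_def)
    have "vf (vf_add (nab P Q) (vf_scale (\<lambda>_. -1) (nab Q P)))"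
      using n smooth_fun_on_const[OF U_open, of A] by (intro vector_field_on_add vector_field_on_scale mfd)
    moreover have "vf_add (nab P Q) (vf_scale (\<lambda>_. -1) (nab Q P)) = b P Q"
      by (simp add: b_def vf_add_def vf_scale_def fun_eq_iff)
    ultimately show ?thesis by (simp add: Vf_def b_def nout)
  qed
  have "(b X (b Y Z) + b Y (b Z X) + b Z (b X Y)) x f = 0" for x f
  proof (cases "x \<in> U \<and> smooth_near M A x f")
    case False
    show ?thesis
    proof (cases "x \<in> U")
      case True
      then have "v f = 0" if "v \<in> tangent_space M A x" for v
        using False tangent_spaceD(5)[OF that] by blast
      then have "b P Q x f = 0" if "P \<in> Vf" "Q \<in> Vf" for P Q
        using bVf[OF that] True vf_tangent by (simp add: Vf_def)
      then show ?thesis using X Y Z bVf by simp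
    next
      case False
      then show ?thesis by (simp add: b_def nout)
    qed
  next
    case True
    then have x: "x \<in> U" by simp
    obtain V where V: "x \<in> V" "smooth_fun_on M A V f"
      using True unfolding smooth_near_def by blast
    \<comment> \<open>On \<open>V'\<close> both \<open>f\<close> and its derivatives along the
      fields are smooth, so nested brackets can be expanded.\<close>
    define V' where "V' = V \<inter> U"
    have V'o: "openin M V'"
      unfolding V'_def using smooth_fun_on_D(1)[OF V(2)] U_open by (rule openin_Int)
    have V': "x \<in> V'" "V' \<subseteq> U" "smooth_fun_on M A V' f"
      using V x smooth_fun_on_subset[OF V(2) V'o] by (auto simp: V'_def)
    have sm: "smooth_fun_on M A V' (\<lambda>y. P y h)" if "P \<in> Vf" "smooth_fun_on M A V' h" for P h
      using that V'(2) unfolding Vf_def vector_field_on_def by blast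
    have near: "smooth_near M A y h" if "y \<in> V'" "smooth_fun_on M A V' h" for y h
      using that(2,1) by (rule smooth_nearI)
    have t: "P x \<in> tangent_space M A x" if "P \<in> Vf" for P
      using that x vf_tangent by (simp add: Vf_def)
    have bb: "b P (b Q R) x f = P x (\<lambda>y. Q y (\<lambda>z. R z f)) - P x (\<lambda>y. R y (\<lambda>z. Q z f))
       - (Q x (\<lambda>y. R y (\<lambda>z. P z f)) - R x (\<lambda>y. Q y (\<lambda>z. P z f)))"
      if P: "P \<in> Vf" and Q: "Q \<in> Vf" and R: "R \<in> Vf" for P Q R
    proof -
      have "b P (b Q R) x f = P x (\<lambda>y. b Q R y f) - b Q R x (\<lambda>y. P y f)"
        using commutator_apply[OF P bVf[OF Q R] x near[OF V'(1,3)]] by (simp add: b_def)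
      also have "b Q R x (\<lambda>y. P y f) = Q x (\<lambda>y. R y (\<lambda>z. P z f)) - R x (\<lambda>y. Q y (\<lambda>z. P z f))"
        using commutator_apply[OF Q R x near[OF V'(1) sm[OF P V'(3)]]] by (simp add: b_def)
      also have "P x (\<lambda>y. b Q R y f) = P x (\<lambda>y. Q y (\<lambda>z. R z f) - R y (\<lambda>z. Q z f))"
      proof (rule tangent_spaceD(4)[OF t[OF P] near[OF V'(1) sm[OF bVf[OF Q R] V'(3)]] V'o V'(1)])
        fix y assume y: "y \<in> V'"
        then have "y \<in> U" using V'(2) by blast
        then show "b Q R y f = Q y (\<lambda>z. R z f) - R y (\<lambda>z. Q z f)"
          unfolding b_def by (rule commutator_apply[OF Q R _ near[OF y V'(3)]])
      qed
      also have "\<dots> = P x (\<lambda>y. Q y (\<lambda>z. R z f)) - P x (\<lambda>y. R y (\<lambda>z. Q z f))"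
        by (rule tangent_diff[OF mfd t[OF P] near[OF V'(1) sm[OF Q sm[OF R V'(3)]]] near[OF V'(1) sm[OF R sm[OF Q V'(3)]]]])
      finally show ?thesis .
    qed
    show ?thesis
      unfolding plus_fun_apply bb[OF X Y Z] bb[OF Y Z X] bb[OF Z X Y] by simp
  qed
  then have "b X (b Y Z) + b Y (b Z X) + b Z (b X Y) = 0"
    by (intro ext) (simp only: zero_fun_apply)
  then show ?thesis by (simp add: b_def)
qed

lemma g_sum:
  assumes x: "x \<in> U" and v: "v \<in> tangent_space M A x" and u: "\<And>i. i \<in> I \<Longrightarrow> u i \<in> tangent_space M A x"
  shows "(\<lambda>f. \<Sum>i\<in>I. c i * u i f) \<in> tangent_space M A x \<and>
    g x (\<lambda>f. \<Sum>i\<in>I. c i * u i f) v = (\<Sum>i\<in>I. c i * g x (u i) v)"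
  using u
proof (induction I rule: infinite_finite_induct)
  case (insert j I)
  have t: "(\<lambda>f. c j * u j f) \<in> tangent_space M A x"
    using insert by (intro tangent_space_scale) auto
  have r: "(\<lambda>f. \<Sum>i\<in>I. c i * u i f) \<in> tangent_space M A x"
    using insert by auto
  show ?case
    using tangent_space_add[OF t r] g_axioms(2)[OF x t r v] g_axioms(3)[OF x _ v v, of "u j" "c j"] insert
    by simp
qed (simp_all add: tangent_space_zero g_zero[OF x v])

lemma frame_expansion:
  assumes X: "X \<in> Vf"
  shows "X = (\<Sum>i\<in>UNIV. vf_scale (ip X (restr (e i))) (restr (e i)))"
proof (intro ext)
  fix x f
  show "X x f = (\<Sum>i\<in>UNIV. vf_scale (ip X (restr (e i))) (restr (e i))) x f"
  proof (cases "x \<in> U")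
    case True
    have t: "e i x \<in> tangent_space M A x" for i using e_vf True by (rule vf_tangent)
    have "X x \<in> tangent_space M A x" using X True vf_tangent by (simp add: Vf_def)
    then obtain c where c: "X x = (\<lambda>f. \<Sum>i\<in>UNIV. c i * e i x f)"
      using frame True unfolding orthonormal_frame_on_def by blast
    have o: "g x (e i x) (e j x) = (if i = j then 1 else 0)" for i j
      using frame True unfolding orthonormal_frame_on_def by blast
    have "g x (X x) (e j x) = c j" for j
    proof -
      have "g x (X x) (e j x) = (\<Sum>i\<in>UNIV. c i * g x (e i x) (e j x))"
        unfolding c using g_sum[OF True t, where u = "\<lambda>i. e i x" and I = UNIV] t by blast
      also have "\<dots> = (\<Sum>i\<in>UNIV. if i = j then c i else 0)"
        by (intro sum.cong refl) (simp add: o)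
      finally show ?thesis by simp
    qed
    then show ?thesis
      using True by (simp add: sum_fun_apply vf_scale_def ip_def restr_in c)
  next
    case False
    then show ?thesis using X by (simp add: sum_fun_apply vf_scale_def Vf_def restr_def)
  qed
qed

text \<open>All fields and functions involved are zero outside \<open>U\<close>, so each axiom is an
  equation of total functions to be checked on \<open>U\<close>. \<open>const_on 1\<close> is the
  unit among these functions.\<close>

sublocale frame_calculus Fn Vf "\<lambda>X f x. X x f" vf_scale ip nab "\<lambda>i. restr (e i)" "const_on 1"
proof (unfold_locales, goal_cases)
  case (1 f h)
  then show ?case using smooth_fun_on_add[OF mfd, of U f h] by (simp add: Fn_def plus_fun_def)
next
  case (2 f)
  then show ?case using smooth_fun_on_mult[OF mfd smooth_fun_on_const[OF U_open, of A "-1"], of f] by (simp add: Fn_def fun_Compl_def)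
next
  case (3 f h)
  then show ?case using smooth_fun_on_mult[OF mfd, of U f h] by (simp add: Fn_def times_fun_def)
next
  case 4
  show ?case by (rule const_on_Fn)
next
  case (5 f)
  then show ?case by (auto simp: Fn_def const_on_def fun_eq_iff)
next
  case (6 X Y)
  then show ?case using vector_field_on_add[OF mfd, of U X Y] by (simp add: Vf_def vf_add_eq)
next
  case (7 X)
  have "vf_scale (\<lambda>_. -1) X = - X" by (simp add: vf_scale_def fun_eq_iff)
  then show ?case
    using 7 vector_field_on_scale[OF mfd _ smooth_fun_on_const[OF U_open, of A "-1"], of X] by (simp add: Vf_def)
next
  case (8 u X)
  then show ?case using vector_field_on_scale[OF mfd, of U X u] by (simp add: Vf_def Fn_def) (simp add: vf_scale_def)
next
  case (9 X f)
  then show ?case using vf_sf by (simp add: Vf_def Fn_def)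
next
  case (10 X Y f)
  then show ?case by (simp add: fun_eq_iff)
next
  case (11 u X f)
  then show ?case by (simp add: fun_eq_iff vf_scale_def)
next
  case (12 X f h)
  show ?case
  proof
    fix x
    show "X x (f + h) = ((\<lambda>x. X x f) + (\<lambda>x. X x h)) x"
      using 12 tangent_spaceD(1)[OF vf_tangent sf_near sf_near, of X x f h]
      by (cases "x \<in> U") (simp_all add: Vf_def Fn_def plus_fun_def)
  qed
next
  case (13 X f h)
  show ?case
  proof
    fix x
    show "X x (f * h) = ((\<lambda>x. X x f) * h + f * (\<lambda>x. X x h)) x"
      using 13 tangent_spaceD(2)[OF vf_tangent sf_near sf_near, of X x f h]
      by (cases "x \<in> U") (simp_all add: Vf_def Fn_def times_fun_def)
  qed
next
  case (14 X Y)
  then have "sf (ip X Y)"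
    by (intro smooth_fun_on_cong[OF mfd g_smooth[of X Y]]) (simp_all add: Vf_def ip_def)
  then show ?case by (simp add: Fn_def ip_def)
next
  case (15 X Y)
  show ?case
  proof
    fix x
    show "ip X Y x = ip Y X x"
    proof (cases "x \<in> U")
      case True
      then show ?thesis
        using 15 g_axioms(1)[OF True, of "X x" "Y x" "X x"] vf_tangent by (simp add: ip_def Vf_def)
    qed (simp add: ip_def)
  qed
next
  case (16 X Y Z)
  show ?case
  proof
    fix x
    show "ip (X + Y) Z x = (ip X Z + ip Y Z) x"
    proof (cases "x \<in> U")
      case True
      then show ?thesis
        using 16 g_axioms(2)[OF True, of "X x" "Y x" "Z x"] vf_tangent by (simp add: ip_def Vf_def plus_fun_def)
    qed (simp add: ip_def)
  qed
next
  case (17 u X Y)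
  show ?case
  proof
    fix x
    show "ip (vf_scale u X) Y x = (u * ip X Y) x"
    proof (cases "x \<in> U")
      case True
      then show ?thesis
        using 17 g_axioms(3)[OF True, of "X x" "Y x" "Y x" "u x"] vf_tangent by (simp add: ip_def Vf_def vf_scale_def)
    qed (simp add: ip_def)
  qed
next
  case (18 X Y)
  then show ?case by (rule nab_in_Vf)
next
  case (19 X Y Z)
  then show ?case
    using D_axioms(1)[OF _ _ _ smooth_fun_on_const[OF U_open, of A 0], of X Y Z]
    by (auto simp: nab_def restr_def Vf_def fun_eq_iff vf_add_eq)
next
  case (20 u X Y)
  then show ?case
    using D_axioms(2)[of X Y Y u]
    by (auto simp: nab_def restr_def Vf_def Fn_def fun_eq_iff vf_scale_def)
next
  case (21 X Y Z)
  then show ?case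
    using D_axioms(3)[OF _ _ _ smooth_fun_on_const[OF U_open, of A 0], of X Y Z]
    by (auto simp: nab_def restr_def Vf_def fun_eq_iff vf_add_eq)
next
  case (22 u X Y)
  then show ?case
    using D_axioms(4)[of X Y Y u]
    by (auto simp: nab_def restr_def Vf_def Fn_def fun_eq_iff vf_scale_def vf_add_def)
next
  case (23 X Y f)
  show ?case
  proof
    fix x
    show "(nab X Y - nab Y X) x f = ((\<lambda>x. X x (\<lambda>x. Y x f)) - (\<lambda>x. Y x (\<lambda>x. X x f))) x"
    proof (cases "x \<in> U")
      case True
      then show ?thesis using commutator_apply[OF 23(1,2) True] 23(3) sf_near by (simp add: Fn_def)
    next
      case False
      then show ?thesis using 23 by (simp add: nab_def restr_def Vf_def)
    qed
  qed
next
  case (24 X Y Z)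
  show ?case
  proof
    fix x
    show "X x (ip Y Z) = (ip (nab X Y) Z + ip Y (nab X Z)) x"
    proof (cases "x \<in> U")
      case True
      have v: "vf X" "vf Y" "vf Z" using 24 by (simp_all add: Vf_def)
      have "X x (\<lambda>y. g y (Y y) (Z y)) = X x (ip Y Z)"
        by (rule vf_germ[OF v(1) True g_smooth[OF v(2,3)]]) (simp add: ip_def)
      then show ?thesis
        using True D_axioms(6)[OF v smooth_fun_on_const[OF U_open, of A 0] True] by (simp add: ip_def nab_def restr_in)
    next
      case False
      then show ?thesis using 24 by (simp add: ip_def Vf_def)
    qed
  qed
next
  case (25 X Y Z)
  then show ?case by (rule jacobi_identity)
next
  case (26 i)
  show ?case by (rule Vf_restr[OF e_vf])
next
  case (27 i j)
  then show ?case
    using frame by (auto simp: ip_def const_on_def restr_in orthonormal_frame_on_def fun_eq_iff)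
next
  case (28 X)
  then show ?case by (rule frame_expansion)
next
  case (29 u X Y)
  then show ?case by (simp add: vf_scale_def fun_eq_iff distrib_left)
next
  case (30 u v X)
  then show ?case by (simp add: vf_scale_def fun_eq_iff distrib_right)
next
  case (31 u X)
  then show ?case by (simp add: vf_scale_def fun_eq_iff)
next
  case (32 u v X)
  then show ?case by (simp add: vf_scale_def fun_eq_iff)
next
  case (33 f)
  then show ?case by (simp add: fun_eq_iff)
qed

text \<open>\<open>T\<close> takes fields with arbitrary values outside \<open>U\<close>, \<open>T'\<close> takes their extensions by zero.\<close>
definition agree :: "nat \<Rightarrow> 'a tensor \<Rightarrow> ('a vfield list \<Rightarrow> 'a \<Rightarrow> real) \<Rightarrow> bool" where
  "agree k T T' \<longleftrightarrow> (\<forall>Xs x. length Xs = k \<and> (\<forall>X\<in>set Xs. vf X) \<and> x \<in> U \<longrightarrow> T Xs x = T' (map restr Xs) x)"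

lemma agreeD: "agree k T T' \<Longrightarrow> length Xs = k \<Longrightarrow> (\<And>X. X \<in> set Xs \<Longrightarrow> vf X) \<Longrightarrow> x \<in> U \<Longrightarrow> T Xs x = T' (map restr Xs) x"
  unfolding agree_def by blast

lemma Vf_restr_id: "X \<in> Vf \<Longrightarrow> restr X = X"
  by (auto simp: Vf_def restr_def fun_eq_iff)

lemma Vf_vf: "X \<in> Vf \<Longrightarrow> vf X"
  by (simp add: Vf_def)

lemma map_restr_vfs: "length Xs = k \<Longrightarrow> (\<And>X. X \<in> set Xs \<Longrightarrow> vf X) \<Longrightarrow> map restr Xs \<in> vfs k"
  by (auto simp: vfs_def Vf_restr)

text \<open>On the open set \<open>U\<close> both sides differentiate the same germ, and
  \<open>D\<close> is local (\<open>nab_restr\<close>), so agreement passes to the covariant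
  derivative.\<close>

lemma agree_cov:
  assumes a: "agree k T T'" and t: "tensor k T'"
  shows "agree (Suc k) (cov_deriv D T) (cov T')"
  unfolding agree_def
proof (intro allI impI, elim conjE)
  fix Zs x assume l: "length Zs = Suc k" and v: "\<forall>X\<in>set Zs. vf X" and x: "x \<in> U"
  obtain Xs Y where Z: "Zs = Xs @ [Y]" using l by (cases Zs rule: rev_cases) auto
  have Xs: "length Xs = k" "\<And>X. X \<in> set Xs \<Longrightarrow> vf X" and Y: "vf Y" using l v Z by auto
  have vX: "vf (Xs ! i)" if "i < k" for i using Xs that by auto
  have sf: "sf (T' (map restr Xs))"
    using tensor_Fn[OF t map_restr_vfs[OF Xs]] by (simp add: Fn_def)
  have "Y x (T' (map restr Xs)) = Y x (T Xs)"
    by (rule vf_germ[OF Y x sf]) (simp add: agreeD[OF a Xs])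
  moreover have "T (Xs[i := D Y (Xs ! i)]) x = T' ((map restr Xs)[i := nab (restr Y) (map restr Xs ! i)]) x" if "i < k" for i
  proof -
    have "\<And>X. X \<in> set (Xs[i := D Y (Xs ! i)]) \<Longrightarrow> vf X"
      using set_update_subset_insert[of Xs i "D Y (Xs ! i)"] Xs(2) D_vf[OF Y vX[OF that]] by blast
    then have "T (Xs[i := D Y (Xs ! i)]) x = T' (map restr (Xs[i := D Y (Xs ! i)])) x"
      using Xs(1) by (intro agreeD[OF a _ _ x]) auto
    then show ?thesis
      using that Xs(1) nab_restr[OF Y vX[OF that]] by (simp add: map_update)
  qed
  ultimately show "cov_deriv D T Zs x = cov T' (map restr Zs) x"
    using Xs(1) x by (simp add: Z cov_deriv_def cov_def Let_def sum_fun_apply restr_in)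
qed

lemma curvature_restr:
  assumes X: "vf X" and Y: "vf Y" and Z: "vf Z" and x: "x \<in> U"
  shows "Rop (restr X) (restr Y) (restr Z) x = curvature_op M A D X Y Z x"
proof -
  let ?L = "lie_bracket M A X Y"
  have b: "br (restr X) (restr Y) = restr ?L"
  proof (intro ext)
    fix y f
    show "br (restr X) (restr Y) y f = restr ?L y f"
    proof (cases "y \<in> U")
      case True
      have "(\<lambda>f. D X Y y f - D Y X y f) = ?L y"
        by (rule D_axioms(5)[OF X Y Y smooth_fun_on_const[OF U_open, of A 0] True])
      then show ?thesis
        using True by (simp add: br_def nab_restr X Y restr_in fun_eq_iff)
    next
      case False
      then show ?thesis by (simp add: br_def nab_restr X Y) (simp add: restr_def)
    qed
  qed
  \<comment> \<open>That the Lie bracket is a smooth field is read off from its extension by zero,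
    which is \<open>br\<close>.\<close>
  have "restr ?L \<in> Vf"
    unfolding b[symmetric] by (intro br_Vf Vf_restr X Y)
  then have L: "vf ?L"
    by (rule vector_field_on_cong[OF mfd Vf_vf]) (simp add: restr_in)
  show ?thesis
    unfolding Rop_def b curvature_op_def
    using x by (simp add: nab_restr X Y Z L D_vf restr_in fun_eq_iff)
qed

lemma agree_riemann: "agree 4 (riemann M A g D) Rm"
  unfolding agree_def
proof (intro allI impI, elim conjE)
  fix Xs :: "'a vfield list" and x assume l: "length Xs = 4" and v: "\<forall>X\<in>set Xs. vf X" and x: "x \<in> U"
  obtain P Q R S where Xs: "Xs = [P, Q, R, S]"
    using l by (auto simp: eval_nat_numeral length_Suc_conv)
  show "riemann M A g D Xs x = Rm (map restr Xs) x"
    using v x by (simp add: Xs riemann_def ip_def curvature_restr restr_in eval_nat_numeral)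
qed

end

section \<open>Einstein metrics and components at a point\<close>

locale einstein_frame = riemannian_frame M A g D U e
  for M :: "'a topology" and A :: "('a, 4) atlas" and g :: "'a metric_field"
    and D :: "'a connection" and U :: "'a set" and e :: "4 \<Rightarrow> 'a vfield" +
  fixes c :: real
  assumes ricci_const: "vf X \<Longrightarrow> vf Y \<Longrightarrow> x \<in> U \<Longrightarrow> ricci M A g D e [X, Y] x = c * g x (X x) (Y x)"
begin

text \<open>With Ric = cg one has R = 4c, so R/12 is c/3.\<close>

sublocale einstein_calculus Fn Vf "\<lambda>X f x. X x f" vf_scale ip nab "\<lambda>i. restr (e i)" "const_on 1" "const_on (c / 3)"
proof (unfold_locales, goal_cases)
  case 1
  show ?case by (rule const_on_Fn)
next
  case (2 X)
  show ?case
  proof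
    fix x
    show "X x (const_on (c / 3)) = 0 x"
      using 2 vf_constant[of X x "const_on (c / 3)" "c / 3"]
      by (cases "x \<in> U") (simp_all add: Vf_def const_on_def)
  qed
next
  case (3 X Y)
  show ?case
  proof
    fix x
    show "(\<Sum>j\<in>UNIV. Rm [X, restr (e j), Y, restr (e j)]) x = ((const_on (c / 3) + const_on (c / 3) + const_on (c / 3)) * ip X Y) x"
    proof (cases "x \<in> U")
      case True
      have "Rm [X, restr (e j), Y, restr (e j)] x = riemann M A g D [X, e j, Y, e j] x" for j
      proof -
        have "riemann M A g D [X, e j, Y, e j] x = Rm (map restr [X, e j, Y, e j]) x"
          by (rule agreeD[OF agree_riemann]) (use 3 True in \<open>auto simp: Vf_vf e_vf\<close>)
        then show ?thesis
          using 3 by (simp add: Vf_restr_id)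
      qed
      then have "(\<Sum>j\<in>UNIV. Rm [X, restr (e j), Y, restr (e j)]) x = ricci M A g D e [X, Y] x"
        by (simp add: sum_fun_apply ricci_def del: Rm_simp)
      then show ?thesis
        using True 3 by (simp add: ricci_const Vf_vf const_on_def ip_def)
    next
      case False
      then show ?thesis by (simp add: sum_fun_apply ip_def)
    qed
  qed
qed

lemma scalar_curv_eq: "x \<in> U \<Longrightarrow> scalar_curv M A g D e x = 4 * c"
  using frame by (simp add: scalar_curv_def ricci_const e_vf orthonormal_frame_on_def)

text \<open>With Ric = cg and R = 4c the two correction terms have coefficients -c and 2c/3, which
  add up to -c/3.\<close>

lemma agree_weyl: "agree 4 (weyl M A g D e) W"
  unfolding agree_def
proof (intro allI impI, elim conjE)
  fix Xs :: "'a vfield list" and x assume l: "length Xs = 4" and v: "\<forall>X\<in>set Xs. vf X" and x: "x \<in> U"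
  obtain P Q R S where Xs: "Xs = [P, Q, R, S]"
    using l by (auto simp: eval_nat_numeral length_Suc_conv)
  have r: "riemann M A g D Xs x = Rm (map restr Xs) x"
    using l v x by (intro agreeD[OF agree_riemann]) auto
  show "weyl M A g D e Xs x = W (map restr Xs) x"
    unfolding weyl_def Let_def r W_def
    using v x by (simp add: Xs ricci_const scalar_curv_eq ip_def restr_in const_on_def eval_nat_numeral field_simps del: Rm_simp)
qed

definition component :: "('a vfield list \<Rightarrow> 'a \<Rightarrow> real) \<Rightarrow> 'a \<Rightarrow> 4 list \<Rightarrow> real" where
  "component T x is = T (map (\<lambda>i. restr (e i)) is) x"

text \<open>Evaluation at \<open>x\<close> turns equations between functions into equations between
  reals, where rational coefficients are available.\<close>

lemma components:
  assumes x: "x \<in> U"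
  shows "weyl_third_derivative (\<lambda>i j k l. component W x [i, j, k, l]) (\<lambda>i j k l t. component (cov W) x [i, j, k, l, t]) (c / 3)
    (\<lambda>i j k l. component Rm x [i, j, k, l]) (\<lambda>i j k l p q t. component (cov (cov (cov W))) x [i, j, k, l, p, q, t])"
proof -
  let ?E = "\<lambda>i. restr (e i)"
  have ipE: "ip (?E i) (?E j) x = kron i j" for i j
    using x by (simp add: E_orthonormal kron_def const_on_def)
  have wr: "component W x [i, j, k, l] = component Rm x [i, j, k, l] - c / 3 * (kron i k * kron j l - kron i l * kron j k)" for i j k l
    unfolding component_def list.map W_simp using x by (simp add: ipE const_on_def del: Rm_simp)
  have kc: "kron i j = kron j i" for i j :: 4 by (simp add: kron_def)
  note Rm_sym = Rm_symmetries[OF E_Vf E_Vf E_Vf E_Vf, THEN fun_cong[of _ _ x]]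
  note T_sym = cov_W_symmetries[OF E_Vf E_Vf E_Vf E_Vf E_Vf, THEN fun_cong[of _ _ x]]
  have rtr: "(\<Sum>j\<in>UNIV. component Rm x [i, j, k, j]) = c * kron i k" for i k
    using fun_cong[OF ricci_einstein[OF E_Vf E_Vf, of i k], of x] x
    by (simp add: component_def sum_fun_apply ipE const_on_def del: Rm_simp)
  show ?thesis
  proof (unfold_locales, goal_cases)
    case (1 j i k l)
    show ?case using Rm_sym(1)[of i j k l] unfolding wr unfolding component_def list.map
      by (simp add: algebra_simps del: Rm_simp)
  next
    case (2 i j l k)
    show ?case using Rm_sym(2)[of i j k l] unfolding wr unfolding component_def list.map
      by (simp add: algebra_simps del: Rm_simp)
  next
    case (3 k l i j)
    show ?case using fun_cong[OF Rm_pair[OF E_Vf E_Vf E_Vf E_Vf], of k l i j x] unfolding wr unfolding component_def list.map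
      by (simp add: kc algebra_simps del: Rm_simp)
  next
    case (4 i j k l)
    show ?case using Rm_sym(3)[of i j k l] unfolding wr unfolding component_def list.map
      by (simp add: kc algebra_simps del: Rm_simp)
  next
    case (5 i k)
    have "(\<Sum>j\<in>UNIV. kron i k * kron j j - kron i j * kron j k) = 3 * kron i k"
      by (simp add: sum_subtractf)
    then have "(\<Sum>j\<in>UNIV. c / 3 * (kron i k * kron j j - kron i j * kron j k)) = c * kron i k"
      unfolding sum_distrib_left[symmetric] by simp
    then show ?case
      by (simp only: wr sum_subtractf rtr diff_self)
  next
    case 6
    show ?case by simp
  next
    case (7 j i k l t)
    show ?case using T_sym(1)[of i j k l t] by (simp add: component_def)
  next
    case (8 i j l k t)
    show ?case using T_sym(2)[of i j k l t] by (simp add: component_def)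
  next
    case (9 k l i j t)
    show ?case using T_sym(3)[of i j k l t] by (simp add: component_def)
  next
    case (10 i j k l t)
    show ?case using T_sym(4)[of i j k l t] by (simp add: component_def)
  next
    case (11 i j k l t)
    show ?case using T_sym(5)[of i j k l t] by (simp add: component_def)
  next
    case (12 i k t)
    show ?case using fun_cong[OF cov_W_trace[OF E_Vf E_Vf E_Vf, of i k t], of x] by (simp add: component_def sum_fun_apply)
  next
    case (13 i j k)
    show ?case using fun_cong[OF cov_W_divergence[OF E_Vf E_Vf E_Vf, of i j k], of x] by (simp add: component_def sum_fun_apply)
  next
    case (14 a b c d)
    show ?case by (simp add: wr)
  next
    case (15 a b c d f y z)
    show ?case
      using fun_cong[OF cov_W_commute[OF E_Vf E_Vf E_Vf E_Vf E_Vf E_Vf E_Vf, of a b c d f y z], of x]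
      by (simp add: component_def sum_fun_apply del: Rm_simp)
  next
    case (16 a b c d y z v)
    show ?case
      using fun_cong[OF cov_cov_W_commute[OF E_Vf E_Vf E_Vf E_Vf E_Vf E_Vf E_Vf, of a b c d y z v], of x]
      by (simp add: component_def sum_fun_apply del: Rm_simp)
  next
    case (17 i j k a b)
    show ?case
      using fun_cong[OF cov_cov_cov_W_divergence[OF E_Vf E_Vf E_Vf E_Vf E_Vf, of i j k a b], of x]
      by (simp add: component_def sum_fun_apply)
  next
    case (18 a b c d v y z)
    show ?case
      using fun_cong[OF cov_cov_cov_W_swap[OF E_Vf E_Vf E_Vf E_Vf E_Vf E_Vf E_Vf, of a b c d v y z], of x]
      by (simp add: component_def)
  qed
qed

end

lemma lists_length_0: "{is :: 'b list. length is = 0} = {[]}"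
  by auto

lemma sum_lists_Suc:
  fixes f :: "'b::finite list \<Rightarrow> real"
  shows "(\<Sum>is | length is = Suc k. f is) = (\<Sum>i\<in>UNIV. \<Sum>is | length is = k. f (i # is))"
  unfolding sum.cartesian_product
  by (rule sum.reindex_bij_witness[of _ "\<lambda>(i, is). i # is" "\<lambda>is. (hd is, tl is)"]) (auto simp: length_Suc_conv)

text \<open>Splits off the last derivative index, so that |\<nabla>^2 W|^2 takes the form it has in
  the Bochner formula.\<close>

lemma sum_lists_snoc:
  fixes f :: "'b::finite list \<Rightarrow> real"
  shows "(\<Sum>is | length is = Suc k. f is) = (\<Sum>is | length is = k. \<Sum>i\<in>UNIV. f (is @ [i]))"
proof -
  have "(\<Sum>is | length is = Suc k. f is) = (\<Sum>(is, i)\<in>{is. length is = k} \<times> UNIV. f (is @ [i]))"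
    by (rule sum.reindex_bij_witness[of _ "\<lambda>(is, i). is @ [i]" "\<lambda>is. (butlast is, last is)"])
       (auto simp: length_Suc_conv_rev)
  then show ?thesis by (simp add: sum.cartesian_product)
qed

lemma sum_lists_five:
  fixes f :: "'b::finite list \<Rightarrow> real"
  shows "(\<Sum>is | length is = 5. f is) =
    (\<Sum>i\<in>UNIV. \<Sum>j\<in>UNIV. \<Sum>k\<in>UNIV. \<Sum>l\<in>UNIV. \<Sum>t\<in>UNIV. f [i, j, k, l, t])"
  by (simp add: eval_nat_numeral sum_lists_Suc lists_length_0)

theorem theorem1p1:
  fixes M :: "'a topology" and A :: "('a, 4) atlas" and g :: "'a metric_field"
    and D :: "'a connection" and U :: "'a set" and e :: "4 \<Rightarrow> 'a vfield"
    and R :: "'a \<Rightarrow> real" and W :: "'a tensor" and x :: 'a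
  assumes "riemannian_manifold M A g"
    and "levi_civita M A g D"
    and "einstein M A g D"
    and "orthonormal_frame_on M A g U e"
    and "x \<in> U"
    and "R = scalar_curv M A g D e"
    and "W = weyl M A g D e"
  shows "1 / 2 * laplacian D e (\<lambda>_. norm_sq e 5 (cov_deriv D W)) [] x
    = norm_sq e 6 (cov_deriv D (cov_deriv D W)) x
      + 13 / 12 * R x * norm_sq e 5 (cov_deriv D W) x
      - 10 * (\<Sum>i\<in>UNIV. \<Sum>j\<in>UNIV. \<Sum>k\<in>UNIV. \<Sum>l\<in>UNIV. \<Sum>p\<in>UNIV. \<Sum>q\<in>UNIV. \<Sum>t\<in>UNIV.
          W [e i, e j, e k, e l] x * cov_deriv D W [e i, e j, e p, e q, e t] x
            * cov_deriv D W [e k, e l, e p, e q, e t] x)"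
proof -
  obtain c where c: "\<And>U e X Y x. orthonormal_frame_on M A g U e \<Longrightarrow> vector_field_on M A U X \<Longrightarrow> vector_field_on M A U Y
      \<Longrightarrow> x \<in> U \<Longrightarrow> ricci M A g D e [X, Y] x = c * g x (X x) (Y x)"
    using assms(3) unfolding einstein_def by blast
  interpret ein: einstein_frame M A g D U e c
    by unfold_locales (use assms(1,2,4) c in auto)
  note x = \<open>x \<in> U\<close>
  note W = \<open>W = weyl M A g D e\<close>
  let ?T = "ein.cov ein.W" and ?H = "ein.cov (ein.cov ein.W)" and ?K = "ein.cov (ein.cov (ein.cov ein.W))"
  interpret wd: weyl_third_derivative "\<lambda>i j k l. ein.component ein.W x [i, j, k, l]" "\<lambda>i j k l t. ein.component ?T x [i, j, k, l, t]"
    "c / 3" "\<lambda>i j k l. ein.component ein.Rm x [i, j, k, l]" "\<lambda>i j k l p q t. ein.component ?K x [i, j, k, l, p, q, t]"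
    by (rule ein.components[OF x])
  have aW: "ein.agree 4 W ein.W"
    unfolding W by (rule ein.agree_weyl)
  have aT: "ein.agree 5 (cov_deriv D W) ?T"
    using ein.agree_cov[OF aW ein.tensor_W] by simp
  have aH: "ein.agree 6 (cov_deriv D (cov_deriv D W)) ?H"
    using ein.agree_cov[OF aT ein.tensor_cov_W(1)] by simp
  have frame_component: "S (map e is) y = ein.component S' y is" if "ein.agree k S S'" "length is = k" "y \<in> U" for k S S' y "is"
  proof -
    have "S (map e is) y = S' (map ein.restr (map e is)) y"
      by (rule ein.agreeD[OF that(1)]) (use that ein.e_vf in auto)
    then show ?thesis by (simp add: ein.component_def o_def)
  qed
  \<comment> \<open>\<open>F\<close> is |\<nabla>W|^2 on \<open>U\<close>, extended by zero.\<close>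
  define F where "F = (\<Sum>is | length is = 5. ?T (map (\<lambda>i. ein.restr (e i)) is) * ?T (map (\<lambda>i. ein.restr (e i)) is))"
  have "F \<in> ein.Fn"
    unfolding F_def by (intro ein.Fn_sum ein.Fn_mult ein.tensor_Fn[OF ein.tensor_cov_W(1)]) simp_all
  \<comment> \<open>A function is a tensor of order 0, so the two derivatives of the Laplacian are
    two applications of \<open>agree_cov\<close>.\<close>
  then have tF: "ein.tensor 0 (\<lambda>_. F)"
    by (simp add: ein.tensor_def)
  have nF: "norm_sq e 5 (cov_deriv D W) y = F y" if "y \<in> U" for y
    using frame_component[OF aT _ that]
    by (simp add: norm_sq_def F_def sum_fun_apply ein.component_def power2_eq_square)
  have "ein.agree 0 (\<lambda>_. norm_sq e 5 (cov_deriv D W)) (\<lambda>_. F)"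
    by (simp add: ein.agree_def nF)
  then have aF: "ein.agree 2 (cov_deriv D (cov_deriv D (\<lambda>_. norm_sq e 5 (cov_deriv D W)))) (ein.cov (ein.cov (\<lambda>_. F)))"
    using ein.agree_cov[OF ein.agree_cov[OF _ tF] ein.tensor_cov[OF tF]] by (simp add: numeral_2_eq_2)
  \<comment> \<open>\<open>N\<close> and \<open>P\<close> are the two parts of the Bochner formula:
    |\<nabla>^2 W|^2 and W_{ijkl,t} W_{ijkl,tss}.\<close>
  define N where "N = (\<Sum>is | length is = 5. \<Sum>p\<in>UNIV. (ein.component ?H x (is @ [p]))\<^sup>2)"
  define P where "P = (\<Sum>is | length is = 5. ein.component ?T x is * (\<Sum>p\<in>UNIV. ein.component ?K x (is @ [p, p])))"
  have N: "N = norm_sq e 6 (cov_deriv D (cov_deriv D W)) x"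
    using frame_component[OF aH _ x] sum_lists_snoc[of "\<lambda>is. (ein.component ?H x is)\<^sup>2" 5]
    by (simp add: norm_sq_def N_def)
  have P: "P = 13 * (c / 3) * wd.norm2 - 10 * wd.A"
    using wd.pairing_K_trace unfolding P_def sum_lists_five wd.pairing_def wd.sum5_nested by simp
  have norm2: "wd.norm2 = norm_sq e 5 (cov_deriv D W) x"
    using frame_component[OF aT _ x]
    by (simp add: norm_sq_def wd.pairing_def wd.sum5_nested sum_lists_five power2_eq_square)
  have cubic: "(\<Sum>i\<in>UNIV. \<Sum>j\<in>UNIV. \<Sum>k\<in>UNIV. \<Sum>l\<in>UNIV. \<Sum>p\<in>UNIV. \<Sum>q\<in>UNIV. \<Sum>t\<in>UNIV.
          W [e i, e j, e k, e l] x * cov_deriv D W [e i, e j, e p, e q, e t] x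
            * cov_deriv D W [e k, e l, e p, e q, e t] x) = wd.A"
    using frame_component[OF aT _ x, of "[_, _, _, _, _]"] frame_component[OF aW _ x, of "[_, _, _, _]"]
    by (simp add: wd.A_def sum7_nested)
  have "laplacian D e (\<lambda>_. norm_sq e 5 (cov_deriv D W)) [] x =
      (\<Sum>p\<in>UNIV. ein.cov (ein.cov (\<lambda>_. F)) [ein.restr (e p), ein.restr (e p)] x)"
    using frame_component[OF aF _ x, of "[_, _]"] by (simp add: laplacian_def ein.component_def)
  also have "\<dots> = (\<Sum>p\<in>UNIV. 2 * (\<Sum>is | length is = 5. (ein.component ?H x (is @ [p]))\<^sup>2 + ein.component ?T x is * ein.component ?K x (is @ [p, p])))"
    unfolding F_def ein.bochner[OF ein.tensor_cov_W(1) ein.E_Vf]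
    by (simp add: sum_fun_apply ein.component_def power2_eq_square)
  also have "\<dots> = 2 * (N + P)"
    unfolding N_def P_def sum_distrib_left[symmetric]
    by (subst sum.swap) (simp add: sum.distrib sum_distrib_left)
  finally have "1 / 2 * laplacian D e (\<lambda>_. norm_sq e 5 (cov_deriv D W)) [] x = N + P"
    by simp
  \<comment> \<open>Since R = 4c, the coefficient \<open>13 * (c / 3)\<close> is 13/12 R.\<close>
  then show ?thesis
    unfolding cubic \<open>R = scalar_curv M A g D e\<close> ein.scalar_curv_eq[OF x] N P norm2 by simp
qed

end
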